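(* Let $a\colon\mathbb{N}\to\mathbb{Z}_{\ge0}$ be an $s$-function, and let $(X,\nu,T)$ be a uniquely ergodic topological dynamical system. Then for every integer $k\ge0$, every continuous function $h\colon X\to\mathbb{C}$ and every $x\in X$, $$\lim_{N\to\infty}\frac1N\sum_{\substack{1\le n\le N\\ a(n)=k}}h(T^{\Omega(n)}x)=d_k\cdot\int_X h\,d\nu,$$ where $d_k$ is the local density of $a$ of level $k$, given by $$d_k=\frac6{\pi^2}\sum_{\substack{f\in\mathscr{F}\\ a(f)=k}}\frac1f\prod_{p\mid f}\Big(1+\frac1p\Big)^{-1}.$$
   Context: $\mathbb{N}=\{1,2,3,\dots\}$. $\mathscr{F}$ is the set of squarefull positive integers ($n$ is squarefull if $p^2\mid n$ for every prime $p\mid n$; $1\in\mathscr{F}$). Every $n\ge1$ is uniquely $n=qf$ with $q$ squarefree, $f\in\mathscr{F}$, $\gcd(q,f)=1$; $f=f(n)$ is the squarefull part of $n$. A function $a\colon\mathbb{N}\to\mathbb{Z}_{\ge0}$ is an $s$-function if $a(n)=a(f(n))$ for all $n\ge1$ and, for every $\varepsilon>0$, $a(n)\ll_\varepsilon n^\varepsilon$. The local density of $a$ of level $k$ is $\lim_{N\to\infty}\frac1N\#\{n\le N: a(n)=k\}$. $\Omega(n)$ is the number of prime factors of $n$ counted with multiplicity. A uniquely ergodic topological dynamical system $(X,\nu,T)$ consists of a compact metric space $X$, a continuous map $T\colon X\to X$, and a $T$-invariant Borel probability measure $\nu$ on $X$ that is the only $T$-invariant Borel probability measure. *)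

theory Defs
  imports
    "HOL-Probability.Probability"
    "HOL-Computational_Algebra.Squarefree"
    "HOL-Library.Landau_Symbols"
begin

text \<open>
  Arithmetic functions are rendered as functions on \<^typ>\<open>nat\<close>; their value at 0 is
  junk and is never referred to.
\<close>

definition squarefull :: "nat \<Rightarrow> bool" where
  "squarefull n \<longleftrightarrow> n > 0 \<and> (\<forall>p. prime p \<longrightarrow> p dvd n \<longrightarrow> p\<^sup>2 dvd n)"

text \<open>
  This is not the complement of the library's \<^const>\<open>squarefree_part\<close>, which
  is the product of the primes of odd multiplicity.
\<close>

definition squarefull_part :: "nat \<Rightarrow> nat" where
  "squarefull_part n =
     (THE f. squarefull f \<and> (\<exists>q. squarefree q \<and> coprime q f \<and> n = q * f))"

lemma multiplicity_squarefull_factor: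
  fixes n q f p :: nat
  assumes "squarefull f" "squarefree q" "coprime q f" "n = q * f" "prime p"
  shows "multiplicity p f = (if multiplicity p n \<ge> 2 then multiplicity p n else 0)"
proof -
  have f0: "f > 0" and q0: "q > 0"
    using assms(1,2) by (auto simp: squarefull_def intro!: Nat.gr0I)
  have n: "multiplicity p n = multiplicity p q + multiplicity p f"
    using assms f0 q0 by (simp add: prime_elem_multiplicity_mult_distrib)
  show ?thesis
  proof (cases "p dvd f")
    case True
    have "\<not> p dvd q"
      using True assms(3,5) by (meson coprime_common_divisor not_prime_unit)
    hence "multiplicity p q = 0" by (rule not_dvd_imp_multiplicity_0)
    moreover have "p\<^sup>2 dvd f"
      using True assms(1,5) by (auto simp: squarefull_def)
    hence "multiplicity p f \<ge> 2"
      using f0 assms(5) by (intro multiplicity_geI) auto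
    ultimately show ?thesis using n by simp
  next
    case False
    hence "multiplicity p f = 0" by (rule not_dvd_imp_multiplicity_0)
    moreover have "\<not> p\<^sup>2 dvd q"
      using assms(2,5) by (auto simp: squarefree_def)
    hence "multiplicity p q < 2"
      using q0 assms(5) by (meson multiplicity_dvd' not_le)
    ultimately show ?thesis using n by simp
  qed
qed

lemma squarefull_factor_exists:
  fixes n :: nat
  assumes "n > 0"
  shows "\<exists>q f. squarefull f \<and> squarefree q \<and> coprime q f \<and> n = q * f"
  using assms
proof (induction n rule: less_induct)
  case (less n)
  show ?case
  proof (cases "n = 1")
    case True
    have "squarefull 1" by (auto simp: squarefull_def)
    thus ?thesis using True by (intro exI[of _ 1]) auto
  next
    case False
    then obtain p where p: "prime p" "p dvd n" using prime_factor_nat by blast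
    obtain m where m: "n = p ^ multiplicity p n * m" "\<not> p dvd m"
      using multiplicity_decompose'[of n p] p(1) less.prems
      by (metis not_prime_unit not_gr_zero)
    define k where "k = multiplicity p n"
    have k: "k \<ge> 1"
      using p less.prems unfolding k_def by (simp add: Suc_le_eq prime_multiplicity_gt_zero_iff)
    have n: "n = p ^ k * m" using m(1) by (simp add: k_def)
    have m0: "m > 0" using n less.prems by (auto intro!: Nat.gr0I)
    have pk: "p ^ k > 1" using p(1) k by (intro one_less_power) (auto simp: prime_gt_1_nat[unfolded One_nat_def])
    have "m < n" using n m0 pk by simp
    then obtain q f where qf: "squarefull f" "squarefree q" "coprime q f" "m = q * f"
      using less.IH m0 by blast
    have ndvd: "\<not> p dvd q" "\<not> p dvd f" using m(2) qf(4) by auto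
    hence cop: "coprime p q" "coprime p f" using p(1) by (auto intro: prime_imp_coprime)
    show ?thesis
    proof (cases "k = 1")
      case True
      have "squarefree (p * q)"
        using cop qf(2) p(1) by (intro squarefree_mult_coprime) (auto intro: squarefree_prime)
      moreover have "coprime (p * q) f" using cop qf(3) by simp
      moreover have "n = (p * q) * f" using n True qf(4) by simp
      ultimately show ?thesis using qf(1) by blast
    next
      case False
      have "r\<^sup>2 dvd p ^ k * f" if r: "prime r" "r dvd p ^ k * f" for r
      proof (cases "r dvd f")
        case True
        thus ?thesis using qf(1) r by (auto simp: squarefull_def)
      next
        case ndv: False
        hence "r = p"
          using r p(1) by (metis prime_dvd_mult_iff prime_dvd_power primes_dvd_imp_eq)
        moreover have "p\<^sup>2 dvd p ^ k" using k False by (intro le_imp_power_dvd) auto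
        ultimately show ?thesis by simp
      qed
      hence "squarefull (p ^ k * f)"
        using qf(1) p(1) by (auto simp: squarefull_def prime_gt_0_nat)
      moreover have "coprime q (p ^ k * f)" using cop qf(3) by (simp add: coprime_commute)
      moreover have "n = q * (p ^ k * f)" using n qf(4) by simp
      ultimately show ?thesis using qf(2) by blast
    qed
  qed
qed

lemma squarefull_part_unique:
  fixes n :: nat
  assumes "n > 0"
  shows "\<exists>!f. squarefull f \<and> (\<exists>q. squarefree q \<and> coprime q f \<and> n = q * f)"
proof (rule ex_ex1I)
  show "\<exists>f. squarefull f \<and> (\<exists>q. squarefree q \<and> coprime q f \<and> n = q * f)"
    using squarefull_factor_exists[OF assms] by blast
next
  fix f g
  assume f: "squarefull f \<and> (\<exists>q. squarefree q \<and> coprime q f \<and> n = q * f)"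
    and g: "squarefull g \<and> (\<exists>q. squarefree q \<and> coprime q g \<and> n = q * g)"
  show "f = g"
  proof (rule multiplicity_eq_nat)
    show "f > 0" "g > 0" using f g by (auto simp: squarefull_def)
    fix p :: nat assume "prime p"
    thus "multiplicity p f = multiplicity p g"
      using f g by (metis multiplicity_squarefull_factor)
  qed
qed

definition s_function :: "(nat \<Rightarrow> nat) \<Rightarrow> bool" where
  "s_function a \<longleftrightarrow>
     (\<forall>n\<ge>1. a n = a (squarefull_part n)) \<and>
     (\<forall>\<epsilon>>0. (\<lambda>n. real (a n)) \<in> O(\<lambda>n. real n powr \<epsilon>))"

definition level_frequency :: "(nat \<Rightarrow> nat) \<Rightarrow> nat \<Rightarrow> nat \<Rightarrow> real" where
  "level_frequency a k N = real (card {n. 1 \<le> n \<and> n \<le> N \<and> a n = k}) / real N"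

definition local_density :: "(nat \<Rightarrow> nat) \<Rightarrow> nat \<Rightarrow> real" where
  "local_density a k = lim (level_frequency a k)"

definition big_omega :: "nat \<Rightarrow> nat" where
  "big_omega n = size (prime_factorization n)"

definition invariant_borel_prob :: "'x::metric_space set \<Rightarrow> ('x \<Rightarrow> 'x) \<Rightarrow> 'x measure \<Rightarrow> bool" where
  "invariant_borel_prob X T \<mu> \<longleftrightarrow>
     prob_space \<mu> \<and>
     sets \<mu> = sets (restrict_space borel X) \<and>
     (\<forall>A\<in>sets \<mu>. emeasure \<mu> (T -` A \<inter> X) = emeasure \<mu> A)"

text \<open>
  The phase space is a compact subset \<open>X\<close> of an ambient metric space; only the
  restrictions to \<open>X\<close> of \<open>T\<close> and of functions on it matter.
\<close>

definition uniquely_ergodic :: "'x::metric_space set \<Rightarrow> 'x measure \<Rightarrow> ('x \<Rightarrow> 'x) \<Rightarrow> bool" where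
  "uniquely_ergodic X \<nu> T \<longleftrightarrow>
     compact X \<and> T ` X \<subseteq> X \<and> continuous_on X T \<and>
     invariant_borel_prob X T \<nu> \<and>
     (\<forall>\<mu>. invariant_borel_prob X T \<mu> \<longrightarrow> \<mu> = \<nu>)"

end

theory Submission
  imports Defs
begin

text \<open>
  Let \<open>b n\<close> be \<open>h\<close> at the iterate number \<open>\<Omega> n\<close> of \<open>x\<close> under \<open>T\<close> if \<open>a n = k\<close>, and 0 otherwise, and
  let \<open>b'\<close> be defined in the same way from \<open>T x\<close>. Then \<open>b (p n) = b' n\<close> for every prime \<open>p\<close> not
  dividing \<open>n\<close>, because multiplying by such a \<open>p\<close> does not change the squarefull part. By the Turan--Kubilius inequality the mean of \<open>b\<close> up to \<open>x\<close> is
  therefore close to an average of the means of \<open>b'\<close> up to \<open>x/p\<close>, for any weights on the primes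
  of large total mass. Chebyshev-type binomial estimates show that the primes are neither too
  sparse nor too concentrated on the logarithmic scale, so that there are two families of short
  intervals, rich in primes, which differ by a constant ratio \<open>\<rho>\<close> close to 1. Comparing the two
  resulting averages shows that the mean up to \<open>\<rho> x\<close> is close to the mean up to \<open>x\<close>; hence means
  vary slowly, and so the mean of \<open>b\<close> is asymptotically that of \<open>b'\<close>. Thus the orbit may be replaced
  by its ergodic averages, which by unique ergodicity converge uniformly on \<open>X\<close>. What remains is the
  density of the level set, summed over the squarefull parts.
\<close>

section \<open>Elementary prime number estimates\<close>

text \<open>The obstacle is that only the logarithmic mass of the primes in a long interval
  \<open>(x, A * x]\<close> is controlled, not where in it they lie. A pair of prime-rich intervals
  with a prescribed ratio is thus out of reach. Pigeonhole yields some ratio \<rho> (a power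
  \<open>l ^ d\<close>) of which only \<open>exp \<eta>' \<le> \<rho> \<le> exp \<eta>\<close> is
  known, and both bounds matter: the upper one makes the powers of \<rho> dense enough for a
  Lipschitz bound to fill the gaps, the lower one limits the number of multiplications by \<rho>
  that lead from \<open>x\<close> to \<open>K * x\<close>. Each multiplication costs an error of
  order \<tau>, and a small \<tau> requires fine cells (\<open>l\<close> near 1) and a large total
  weight \<open>M\<close>. Hence \<eta>' has to be fixed before \<tau>, which dictates the order of
  quantifiers. The upper bound for primes in short intervals serves only to keep the two members of
  a pair apart by a ratio of at least \<open>exp \<eta>'\<close>. Slow variation is needed for the
  means of \<open>b'\<close>, not of \<open>b\<close>, so a third sequence \<open>b''\<close>
  enters.\<close>

lemma prod_primes_dvd_nat:
  fixes n :: nat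
  assumes "finite P" "\<And>p. p \<in> P \<Longrightarrow> prime p" "\<And>p. p \<in> P \<Longrightarrow> p dvd n"
  shows "\<Prod>P dvd n"
  using assms
proof (induction P rule: finite_induct)
  case (insert p P)
  have "coprime p (\<Prod>P)"
    using insert by (intro prod_coprime_right primes_coprime) auto
  thus ?case using insert by (simp add: divides_mult)
qed auto

text \<open>Each such prime divides \<open>(n + m)!\<close> but neither \<open>n!\<close> nor
  \<open>m!\<close>, the latter because \<open>m \<le> n < p\<close>. So it divides the binomial
  coefficient, and so does the product of all of them.\<close>

lemma sum_ln_primes_le_ln_binomial:
  fixes n m :: nat
  assumes "m \<le> n"
  shows "(\<Sum>p | prime p \<and> n < p \<and> p \<le> n + m. ln (real p)) \<le> ln (real ((n + m) choose m))"
proof -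
  define P where "P = {p. prime p \<and> n < p \<and> p \<le> n + m}"
  have fin: "finite P" by (rule finite_subset[of _ "{..n+m}"]) (auto simp: P_def)
  have "p dvd ((n + m) choose m)" if "p \<in> P" for p
  proof -
    have "prime p" "n < p" "p \<le> n + m" using that by (auto simp: P_def)
    have "p dvd fact m * fact n * ((n + m) choose m)"
      using binomial_fact_lemma[of m "n + m"] \<open>prime p\<close> \<open>p \<le> n + m\<close>
      by (simp add: prime_dvd_fact_iff)
    thus ?thesis using \<open>prime p\<close> \<open>n < p\<close> assms
      by (auto simp: prime_dvd_mult_iff prime_dvd_fact_iff)
  qed
  hence "\<Prod>P dvd ((n + m) choose m)" using fin by (intro prod_primes_dvd_nat) (auto simp: P_def)
  hence "\<Prod>P \<le> ((n + m) choose m)" by (intro dvd_imp_le) auto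
  hence "real (\<Prod>P) \<le> real ((n + m) choose m)" by linarith
  moreover have "real (\<Prod>P) > 0" by (auto simp: P_def prime_gt_0_nat intro!: prod_pos)
  ultimately have "ln (real (\<Prod>P)) \<le> ln (real ((n + m) choose m))" by simp
  also have "ln (real (\<Prod>P)) = (\<Sum>p\<in>P. ln (real p))"
    unfolding of_nat_prod by (subst ln_prod) (auto simp: P_def prime_gt_0_nat)
  finally show ?thesis by (simp add: P_def)
qed

definition chebyshev_theta :: "nat \<Rightarrow> real" where
  "chebyshev_theta n = (\<Sum>p | prime p \<and> p \<le> n. ln (real p))"

lemma chebyshev_theta_le: "chebyshev_theta n \<le> 4 * ln 2 * real n"
proof (induction n rule: less_induct)
  case (less n)
  show ?case
  proof (cases "n \<le> 1")
    case True
    hence "{p. prime p \<and> p \<le> n} = {}" by (auto dest: prime_gt_1_nat)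
    thus ?thesis unfolding chebyshev_theta_def by (simp only: sum.empty) simp
  next
    case False
    define k where "k = n - n div 2"
    define m where "m = n div 2"
    have km: "k + m = n" "m \<le> k" "k < n" "2 * k \<le> n + 1" using False by (auto simp: k_def m_def)
    have "{p. prime p \<and> p \<le> n} = {p. prime p \<and> p \<le> k} \<union> {p. prime p \<and> k < p \<and> p \<le> k + m}"
      using km by auto
    hence "chebyshev_theta n = chebyshev_theta k + (\<Sum>p | prime p \<and> k < p \<and> p \<le> k + m. ln (real p))"
      unfolding chebyshev_theta_def by (subst sum.union_disjoint[symmetric]) auto
    also have "\<dots> \<le> chebyshev_theta k + ln (real ((k + m) choose m))"
      using sum_ln_primes_le_ln_binomial[OF km(2)] by simp
    also have "ln (real ((k + m) choose m)) \<le> ln (2 ^ n)"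
    proof -
      have "(n choose m) \<le> 2 ^ n" using km by (intro binomial_le_pow2)
      hence "real (n choose m) \<le> 2 ^ n" by (metis of_nat_le_iff of_nat_numeral of_nat_power)
      thus ?thesis using km by simp
    qed
    also have "ln (2 ^ n :: real) = n * ln 2" by (simp add: ln_realpow)
    also have "chebyshev_theta k \<le> 4 * ln 2 * real k" by (rule less.IH) (use km in auto)
    \<comment> \<open>From \<open>2 * k \<le> n + 1\<close> and \<open>n \<ge> 2\<close> follows
      \<open>4 * k \<le> 3 * n\<close>. With the constant 2 in place of 4, the rounding up of
      \<open>n / 2\<close> could not be absorbed.\<close>
    also have "4 * ln 2 * real k + real n * ln 2 \<le> 4 * ln 2 * real n"
    proof -
      have "4 * real k + real n \<le> 4 * real n" using km False by linarith
      from mult_right_mono[OF this, of "ln 2"] show ?thesis by (simp add: algebra_simps)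
    qed
    finally show ?thesis by simp
  qed
qed

text \<open>This weight is the scale-invariant one: Mertens' first theorem says that the mass of
  \<open>(x, y]\<close> is \<open>ln (y / x)\<close> up to a bounded error.\<close>

definition log_mass :: "real \<Rightarrow> real \<Rightarrow> real" where
  "log_mass x y = (\<Sum>p | prime p \<and> x < real p \<and> real p \<le> y. ln (real p) / real p)"

lemma finite_real_bounded_nat [simp]:
  "finite {p::nat. P p \<and> Q p \<and> real p \<le> y}"
  "finite {p::nat. Q p \<and> real p \<le> y}"
  by (rule finite_subset[of _ "{..nat \<lfloor>y\<rfloor>}"]; force simp: le_nat_floor)+

lemma log_mass_split:
  assumes "x \<le> y" "y \<le> z"
  shows "log_mass x z = log_mass x y + log_mass y z"
proof -
  have "{p. prime p \<and> x < real p \<and> real p \<le> z} =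
    {p. prime p \<and> x < real p \<and> real p \<le> y} \<union> {p. prime p \<and> y < real p \<and> real p \<le> z}"
    using assms by auto
  thus ?thesis unfolding log_mass_def by (subst sum.union_disjoint[symmetric]) auto
qed

lemma log_mass_nonneg: "log_mass x y \<ge> 0"
  unfolding log_mass_def by (intro sum_nonneg) (auto dest: prime_gt_1_nat)

lemma log_mass_mono:
  assumes "x' \<le> x" "y \<le> y'"
  shows "log_mass x y \<le> log_mass x' y'"
  unfolding log_mass_def using assms by (intro sum_mono2) (auto dest: prime_gt_1_nat)

text \<open>The bound \<open>N choose m \<le> (1 + z)\<^sup>N / z\<^sup>m\<close> with \<open>z = sqrt t\<close>.\<close>

lemma log_mass_short_interval:
  assumes t: "0 < t" "t \<le> 1/2" and x: "x \<ge> 4 / t"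
  shows "log_mass x ((1 + t) * x) \<le> 4 * sqrt t"
proof -
  define n where "n = nat \<lfloor>x\<rfloor>"
  define N where "N = nat \<lfloor>(1 + t) * x\<rfloor>"
  define m where "m = N - n"
  \<comment> \<open>This value balances the two errors: \<open>N * ln (1 + z)\<close> is at most
    \<open>2 * x * z\<close>, and \<open>m * ln (1 / z)\<close> is at most
    \<open>2 * t * x / z\<close>, which is the same number.\<close>
  define z where "z = sqrt t"
  have x8: "x \<ge> 8" 
  proof -
    have "4 / t \<ge> 4 / (1/2)" using t by (intro divide_left_mono) auto
    thus ?thesis using x by simp
  qed
  \<comment> \<open>This absorbs the rounding, giving
    \<open>m \<le> t * x + 1 \<le> 2 * t * x\<close>.\<close>
  have tx: "t * x \<ge> 4" using x t by (simp add: field_simps)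
  have tx2: "t * x \<le> x / 2" using mult_right_mono[OF t(2), of x] x8 by simp
  have n: "real n \<le> x" "x < real n + 1" using x8 by (auto simp: n_def)
  have N: "real N \<le> (1 + t) * x" "(1 + t) * x < real N + 1"
    using x8 t tx by (auto simp: N_def)
  have nN: "n \<le> N" unfolding n_def N_def using tx by (intro nat_mono floor_mono) (simp add: algebra_simps)
  have mn: "n + m = N" using nN by (simp add: m_def)
  have rm: "real m \<le> t * x + 1" using n N mn by (simp add: algebra_simps) 
  have "m \<le> n" using rm n tx2 x8 by linarith
  have z: "0 < z" "z \<le> 1" "z * z = t" using t by (auto simp: z_def real_le_lsqrt)
  have set: "{p. prime p \<and> x < real p \<and> real p \<le> (1 + t) * x} = {p. prime p \<and> n < p \<and> p \<le> n + m}"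
    using n N mn by (auto)
  have "real (N choose m) * z ^ m \<le> (z + 1) ^ N"
  proof -
    have "(z + 1) ^ N = (\<Sum>k\<le>N. of_nat (N choose k) * z ^ k * 1 ^ (N - k))" by (rule binomial_ring)
    also have "\<dots> \<ge> of_nat (N choose m) * z ^ m * 1 ^ (N - m)"
      by (rule member_le_sum[where f = "\<lambda>k. of_nat (N choose k) * z ^ k * 1 ^ (N - k)"]) (use z mn in auto)
    finally show ?thesis by simp
  qed
  hence "ln (real (N choose m) * z ^ m) \<le> ln ((z + 1) ^ N)"
    using z mn by (subst ln_le_cancel_iff) auto
  hence 1: "ln (real (N choose m)) + m * ln z \<le> N * ln (z + 1)"
    using z mn by (simp add: ln_mult ln_realpow)
  have 2: "N * ln (z + 1) \<le> (2 * x) * z"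
  proof (intro mult_mono)
    show "real N \<le> 2 * x" using N tx2 x8 by (simp only: distrib_right)
    show "ln (z + 1) \<le> z" using z ln_add_one_self_le_self[of z] by (simp add: add.commute)
  qed (use x8 z in auto)
  have 3: "m * (- ln z) \<le> (2 * t * x) * (1 / z)"
  proof (intro mult_mono)
    show "real m \<le> 2 * t * x" using rm tx by simp
    show "- ln z \<le> 1 / z" using ln_le_minus_one[of "1 / z"] z by (simp add: ln_div)
  qed (use x8 z t in auto)
  have "(2 * t * x) * (1 / z) = 2 * x * z" using z by (simp add: field_simps)
  hence binom: "ln (real (N choose m)) \<le> 4 * x * z" using 1 2 3 by simp
  have "log_mass x ((1 + t) * x) = (\<Sum>p | prime p \<and> n < p \<and> p \<le> n + m. ln (real p) / real p)"
    by (simp add: log_mass_def set)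
  also have "\<dots> \<le> (\<Sum>p | prime p \<and> n < p \<and> p \<le> n + m. ln (real p) * (1 / x))"
  proof (intro sum_mono)
    fix p assume "p \<in> {p. prime p \<and> n < p \<and> p \<le> n + m}"
    hence p: "prime p" "real p > x" using n by auto
    have "ln (real p) \<ge> 0" using p by (auto dest: prime_gt_1_nat)
    thus "ln (real p) / real p \<le> ln (real p) * (1 / x)"
      using p x8 by (simp add: divide_left_mono)
  qed
  also have "\<dots> = (\<Sum>p | prime p \<and> n < p \<and> p \<le> n + m. ln (real p)) * (1 / x)"
    by (simp only: sum_distrib_right)
  also have "\<dots> \<le> ln (real ((n + m) choose m)) * (1 / x)"
    using sum_ln_primes_le_ln_binomial[OF \<open>m \<le> n\<close>] x8 by (intro mult_right_mono) auto
  also have "\<dots> \<le> (4 * x * z) * (1 / x)" using binom mn x8 by (intro mult_right_mono) auto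
  finally show ?thesis using x8 z by (simp add: z_def)
qed

section \<open>Legendre's formula and Mertens' first theorem\<close>

lemma card_multiples_atLeastAtMost:
  fixes d n :: nat
  assumes "d > 0"
  shows "card {m \<in> {1..n}. d dvd m} = n div d"
proof -
  have "bij_betw (\<lambda>k. d * k) {1..n div d} {m \<in> {1..n}. d dvd m}"
    using assms
    by (intro bij_betwI[where g = "\<lambda>m. m div d"])
       (auto simp: less_eq_div_iff_mult_less_eq mult.commute div_le_mono Suc_le_eq dvd_def)
  thus ?thesis using bij_betw_same_card by fastforce
qed

lemma of_nat_div_le_divide: "real (n div d) \<le> real n / real d"
proof (cases "d = 0")
  case False
  have "real (n div d * d) \<le> real n" using div_times_less_eq_dividend[of n d] of_nat_le_iff by blast
  thus ?thesis using False by (simp add: field_simps)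
qed auto

lemma divide_le_of_nat_div_plus_1:
  assumes "d > 0"
  shows "real n / real d \<le> real (n div d) + 1"
proof -
  have "real n \<le> real (d + n div d * d)"
    using dividend_less_div_times[OF assms, of n] by linarith
  thus ?thesis using assms by (simp add: field_simps)
qed

text \<open>Legendre's formula: the exponent of \<open>p\<close> in \<open>m\<close> is the number
  of \<open>i\<close> with \<open>p ^ i dvd m\<close>. Stopping at \<open>i = n\<close> loses
  nothing, since \<open>i < p ^ i \<le> m \<le> n\<close> for each such \<open>i\<close>.\<close>

lemma multiplicity_fact:
  fixes p n :: nat
  assumes p: "prime p"
  shows "multiplicity p (fact n :: nat) = (\<Sum>i=1..n. n div p ^ i)"
proof -
  have "multiplicity p (fact n :: nat) = (\<Sum>m=1..n. multiplicity p m)"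
    by (induction n) (use p in \<open>simp_all add: fact_Suc prime_elem_multiplicity_mult_distrib del: mult_Suc\<close>)
  also have "\<dots> = (\<Sum>m=1..n. \<Sum>i=1..n. of_bool (p ^ i dvd m))"
  proof (intro sum.cong refl)
    fix m assume m: "m \<in> {1..n}"
    have "(\<Sum>i=1..n. of_bool (p ^ i dvd m)) = card {i \<in> {1..n}. p ^ i dvd m}"
      by (simp add: sum.If_cases of_bool_def Int_def)
    also have "{i \<in> {1..n}. p ^ i dvd m} = {1..multiplicity p m}"
    proof -
      have "i \<le> n" if "i \<le> multiplicity p m" for i
      proof -
        have "p ^ i dvd m" using that by (simp add: multiplicity_dvd')
        hence "p ^ i \<le> m" using m by (intro dvd_imp_le) auto
        moreover have "i < p ^ i" using p by (intro power_gt_expt) (auto dest: prime_gt_1_nat)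
        ultimately show "i \<le> n" using m by auto
      qed
      moreover have "p ^ i dvd m \<longleftrightarrow> i \<le> multiplicity p m" for i
        using m p by (intro power_dvd_iff_le_multiplicity) (auto dest: prime_gt_1_nat)
      ultimately show ?thesis by auto
    qed
    finally show "multiplicity p m = (\<Sum>i=1..n. of_bool (p ^ i dvd m))" by simp
  qed
  also have "\<dots> = (\<Sum>i=1..n. \<Sum>m=1..n. of_bool (p ^ i dvd m))" by (rule sum.swap)
  also have "\<dots> = (\<Sum>i=1..n. n div p ^ i)"
  proof (intro sum.cong refl)
    fix i
    have "(\<Sum>m=1..n. of_bool (p ^ i dvd m)) = card {m \<in> {1..n}. p ^ i dvd m}"
      by (simp add: sum.If_cases of_bool_def Int_def)
    thus "(\<Sum>m=1..n. of_bool (p ^ i dvd m)) = n div p ^ i"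
      using p card_multiples_atLeastAtMost[of "p ^ i" n] by (simp only:) (simp add: prime_gt_0_nat)
  qed
  finally show ?thesis .
qed

lemma ln_fact_eq_sum_primes:
  "ln (fact n) = (\<Sum>p | prime p \<and> p \<le> n. real (multiplicity p (fact n :: nat)) * ln (real p))"
proof -
  have pf: "prime_factors (fact n :: nat) = {p. prime p \<and> p \<le> n}"
    by (auto simp: prime_factors_dvd prime_dvd_fact_iff)
  have "(fact n :: real) = real (fact n)" by simp
  also have "(fact n :: nat) = (\<Prod>p\<in>prime_factors (fact n). p ^ multiplicity p (fact n))"
    by (intro prime_factorization_nat) auto
  also have "real \<dots> = (\<Prod>p | prime p \<and> p \<le> n. real p ^ multiplicity p (fact n :: nat))"
    by (simp add: pf)
  also have "ln \<dots> = (\<Sum>p | prime p \<and> p \<le> n. ln (real p ^ multiplicity p (fact n :: nat)))"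
    by (intro ln_prod) (auto simp: prime_gt_0_nat)
  also have "\<dots> = (\<Sum>p | prime p \<and> p \<le> n. real (multiplicity p (fact n :: nat)) * ln (real p))"
    by (intro sum.cong refl ln_realpow)
  finally show ?thesis .
qed

lemma ln_fact_ge: "ln (fact n :: real) \<ge> real n * ln (real n) - real n"
proof (induction n)
  case (Suc n)
  show ?case
  proof (cases "n = 0")
    case False
    have "ln (real n + 1) - ln (real n) = ln (1 + 1 / real n)"
      using False ln_div[of "real n + 1" "real n"] by (simp add: add_divide_distrib)
    also have "\<dots> \<le> 1 / real n" by (rule ln_add_one_self_le_self) auto
    finally have "real n * (ln (real n + 1) - ln (real n)) \<le> real n * (1 / real n)"
      by (intro mult_left_mono) auto
    hence "real n * ln (real n + 1) \<le> real n * ln (real n) + 1" using False by (simp add: algebra_simps)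
    moreover have "ln (fact (Suc n) :: real) = ln (real n + 1) + ln (fact n)"
      by (simp only: fact_Suc) (subst ln_mult, auto simp: add.commute)
    ultimately show ?thesis using Suc by (simp add: algebra_simps)
  qed auto
qed auto

lemma ln_fact_le: "ln (fact n :: real) \<le> real n * ln (real n)"
proof -
  have "(fact n :: real) \<le> real n ^ n"
    using fact_le_power[of n, where 'a = real] by simp
  hence "ln (fact n :: real) \<le> ln (real n ^ n)" by (subst ln_le_cancel_iff) (auto intro: Nat.gr0I)
  thus ?thesis by (simp add: ln_realpow)
qed

text \<open>Upper half of Mertens' theorem. Replacing \<open>n / p\<close> by the exponent of
  \<open>p\<close> in \<open>n!\<close> costs at most 1 for each prime, in total
  \<open>chebyshev_theta n\<close>, which is of order \<open>n\<close>.\<close>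

lemma log_mass_atMost_upper:
  assumes "n \<ge> 1"
  shows "log_mass 0 (real n) \<le> ln (real n) + 4 * ln 2"
proof -
  let ?P = "{p. prime p \<and> p \<le> n}"
  have "real n * log_mass 0 (real n) = (\<Sum>p\<in>?P. real n / real p * ln (real p))"
    unfolding log_mass_def sum_distrib_left by (intro sum.cong) (auto simp: prime_gt_0_nat)
  also have "\<dots> \<le> (\<Sum>p\<in>?P. real (multiplicity p (fact n :: nat)) * ln (real p) + ln (real p))"
  proof (intro sum_mono)
    fix p assume "p \<in> ?P"
    hence p: "prime p" "p \<le> n" "p \<ge> 1" by (auto dest: prime_gt_0_nat)
    have "n div p ^ 1 \<le> multiplicity p (fact n :: nat)"
      unfolding multiplicity_fact[OF p(1)] by (rule member_le_sum) (use assms in auto)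
    moreover have "real n / real p \<le> real (n div p) + 1"
      using p(3) by (intro divide_le_of_nat_div_plus_1) auto
    ultimately have "real n / real p \<le> real (multiplicity p (fact n :: nat)) + 1" by simp
    from mult_right_mono[OF this, of "ln (real p)"] p(3)
    show "real n / real p * ln (real p) \<le>
      real (multiplicity p (fact n :: nat)) * ln (real p) + ln (real p)" by (simp add: algebra_simps)
  qed
  also have "\<dots> = ln (fact n) + chebyshev_theta n"
    by (simp add: sum.distrib ln_fact_eq_sum_primes chebyshev_theta_def)
  also have "\<dots> \<le> real n * ln (real n) + 4 * ln 2 * real n"
    by (intro add_mono ln_fact_le chebyshev_theta_le)
  also have "\<dots> = real n * (ln (real n) + 4 * ln 2)" by (simp add: algebra_simps)
  finally show ?thesis using assms by simp
qed

text \<open>Lower half of Mertens' theorem: the higher powers of \<open>p\<close> add to the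
  exponent of \<open>p\<close> in \<open>n!\<close> only about \<open>n / p ^ 2\<close>, and the sum
  of \<open>ln p / p ^ 2\<close> converges.\<close>

lemma log_mass_atMost_lower:
  "\<exists>K. \<forall>n\<ge>1. log_mass 0 (real n) \<ge> ln (real n) - K"
proof -
  \<comment> \<open>A summable majorant of \<open>2 * ln p / p ^ 2\<close>, obtained from
    \<open>ln p \<le> 2 * sqrt p\<close>.\<close>
  define g where "g = (\<lambda>p::nat. 4 * real p powr (-3/2))"
  have g: "summable g" unfolding g_def by (intro summable_mult) (simp add: summable_real_powr_iff)
  have "log_mass 0 (real n) \<ge> ln (real n) - (1 + suminf g)" if "n \<ge> 1" for n
  proof -
    let ?P = "{p. prime p \<and> p \<le> n}"
    have "real n * ln (real n) - real n \<le> ln (fact n)" by (rule ln_fact_ge)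
    also have "\<dots> = (\<Sum>p\<in>?P. real (multiplicity p (fact n :: nat)) * ln (real p))"
      by (rule ln_fact_eq_sum_primes)
    also have "\<dots> \<le> (\<Sum>p\<in>?P. real n * (ln (real p) / real p) + real n * g p)"
    proof (intro sum_mono)
      fix p assume "p \<in> ?P"
      hence p: "prime p" "real p \<ge> 2" by (auto dest: prime_ge_2_nat)
      have "real (multiplicity p (fact n :: nat)) = (\<Sum>i=1..n. real (n div p ^ i))"
        by (simp add: multiplicity_fact[OF p(1)])
      also have "\<dots> \<le> (\<Sum>i=1..n. real n * (1 / real p) ^ i)"
        by (intro sum_mono order.trans[OF of_nat_div_le_divide]) (simp add: power_divide)
      also have "\<dots> = real n * (\<Sum>i=1..n. (1 / real p) ^ i)" by (simp add: sum_distrib_left)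
      also have "(\<Sum>i=1..n. (1 / real p) ^ i) = (1 / real p - (1 / real p) ^ Suc n) / (1 - 1 / real p)"
        using p by (subst sum_gp) auto
      also have "real n * \<dots> \<le> real n * ((1 / real p) / (1 - 1 / real p))"
        using p by (intro mult_left_mono divide_right_mono) auto
      also have "(1 / real p) / (1 - 1 / real p) \<le> 1 / real p + 2 / real p ^ 2"
        using p by (simp add: field_simps power2_eq_square)
      finally have "real (multiplicity p (fact n :: nat)) \<le> real n * (1 / real p + 2 / real p ^ 2)"
        by (simp add: mult_left_mono)
      hence "real (multiplicity p (fact n :: nat)) * ln (real p) \<le>
          real n * (1 / real p + 2 / real p ^ 2) * ln (real p)"
        using p by (intro mult_right_mono) auto
      also have "\<dots> = real n * (ln (real p) / real p) + real n * (2 / real p ^ 2 * ln (real p))"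
        by (simp add: algebra_simps)
      also have "2 / real p ^ 2 * ln (real p) \<le> g p"
      proof -
        have "ln (real p powr (1/2)) \<le> real p powr (1/2) - 1" using p by (intro ln_le_minus_one) auto
        hence "ln (real p) \<le> 2 * real p powr (1/2)" using p by (simp add: ln_powr)
        hence "2 / real p ^ 2 * ln (real p) \<le> 2 / real p ^ 2 * (2 * real p powr (1/2))"
          by (intro mult_left_mono) auto
        also have "\<dots> = 4 * (real p powr (1/2) / real p powr 2)" using p by simp
        also have "\<dots> = g p" unfolding g_def by (subst powr_diff[symmetric]) simp
        finally show ?thesis .
      qed
      finally show "real (multiplicity p (fact n :: nat)) * ln (real p) \<le>
          real n * (ln (real p) / real p) + real n * g p" by (simp add: mult_left_mono)
    qed
    also have "\<dots> = real n * (\<Sum>p\<in>?P. ln (real p) / real p) + real n * sum g ?P"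
      by (simp add: sum.distrib sum_distrib_left)
    also have "(\<Sum>p\<in>?P. ln (real p) / real p) = log_mass 0 (real n)"
      unfolding log_mass_def by (intro sum.cong) (auto simp: prime_gt_0_nat)
    also have "sum g ?P \<le> suminf g" by (intro sum_le_suminf g) (auto simp: g_def)
    finally have "real n * ln (real n) - real n \<le> real n * log_mass 0 (real n) + real n * suminf g"
      by (simp add: mult_left_mono)
    hence "real n * (ln (real n) - (1 + suminf g)) \<le> real n * log_mass 0 (real n)"
      by (simp add: algebra_simps)
    thus ?thesis using that by simp
  qed
  thus ?thesis by blast
qed

lemma log_mass_long_interval:
  "\<exists>A>1. \<forall>x\<ge>1. log_mass x (A * x) \<ge> 1"
proof -
  obtain K where K: "\<And>n. n \<ge> 1 \<Longrightarrow> log_mass 0 (real n) \<ge> ln (real n) - K"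
    using log_mass_atMost_lower by blast
  \<comment> \<open>The exponential outweighs the error terms of both halves of Mertens' theorem and
    leaves 1. The factor 2 pays for rounding \<open>A * x\<close> down to an integer.\<close>
  define A where "A = 2 * exp (\<bar>K\<bar> + 4 * ln 2 + 1)"
  have A: "A \<ge> 2" by (simp add: A_def)
  have "log_mass x (A * x) \<ge> 1" if x: "x \<ge> 1" for x
  proof -
    define n where "n = nat \<lfloor>x\<rfloor>"
    define m where "m = nat \<lfloor>A * x\<rfloor>"
    have Ax: "A * x \<ge> 2 * x" using A x by (intro mult_right_mono) auto
    have n: "n \<ge> 1" "real n \<le> x" "x < real n + 1" using x by (auto simp: n_def le_nat_iff)
    have "A * x \<ge> 1" using Ax x by linarith
    hence m: "m \<ge> 1" "real m \<le> A * x" "A * x < real m + 1" by (auto simp: m_def le_nat_iff)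
    have "log_mass 0 (real n) + log_mass x (A * x) \<ge> log_mass 0 (real m)"
    proof -
      have "log_mass 0 (real m) \<le> log_mass 0 (A * x)" using m by (intro log_mass_mono) auto
      also have "\<dots> = log_mass 0 x + log_mass x (A * x)" using x Ax by (intro log_mass_split) auto
      also have "log_mass 0 x = log_mass 0 (real n)"
      proof -
        have "real p \<le> x \<longleftrightarrow> p \<le> n" for p using n by linarith
        thus ?thesis by (simp add: log_mass_def)
      qed
      finally show ?thesis by simp
    qed
    moreover have "log_mass 0 (real m) \<ge> ln (real m) - K" using m by (intro K)
    moreover have "log_mass 0 (real n) \<le> ln (real n) + 4 * ln 2" using n by (intro log_mass_atMost_upper)
    moreover have "ln (real m) \<ge> ln (real n * (A / 2))"
    proof (subst ln_le_cancel_iff)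
      have "real n * (A / 2) \<le> x * (A / 2)" using n A by (intro mult_right_mono) auto
      also have "\<dots> = A * x / 2" by simp
      also have "\<dots> \<le> real m" using m Ax x by linarith
      finally show "real n * (A / 2) \<le> real m" .
    qed (use n m A in auto)
    moreover have "ln (real n * (A / 2)) = ln (real n) + (\<bar>K\<bar> + 4 * ln 2 + 1)"
      using n by (subst ln_mult) (auto simp: A_def)
    ultimately show ?thesis by linarith
  qed
  thus ?thesis using A by (intro exI[of _ A]) auto
qed

section \<open>Pairs of prime-rich cells with a common ratio\<close>

text \<open>The weight \<open>1 / p\<close> is the one of the Turan-Kubilius inequality, whereas
  Mertens' theorem speaks of \<open>ln p / p\<close>. On the cell number \<open>i\<close> they
  differ by a factor of about \<open>i * ln l\<close>, which is constant up to the width of the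
  cell.\<close>

definition prime_mass :: "real \<Rightarrow> nat \<Rightarrow> real" where
  "prime_mass l i = (\<Sum>p | prime p \<and> l ^ i < real p \<and> real p \<le> l ^ Suc i. 1 / real p)"

lemma prime_mass_nonneg: "prime_mass l i \<ge> 0"
  unfolding prime_mass_def by (intro sum_nonneg) auto

lemma log_mass_power_eq_sum:
  assumes "l \<ge> 1" "a \<le> b"
  shows "log_mass (l ^ a) (l ^ b) = (\<Sum>i=a..<b. log_mass (l ^ i) (l ^ Suc i))"
  using assms(2)
proof (induction b rule: dec_induct)
  case base
  have "{p. prime p \<and> l ^ a < real p \<and> real p \<le> l ^ a} = {}" by auto
  thus ?case unfolding log_mass_def by (simp only: sum.empty) simp
next
  case (step b)
  have "log_mass (l ^ a) (l ^ Suc b) = log_mass (l ^ a) (l ^ b) + log_mass (l ^ b) (l ^ Suc b)"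
    using step assms(1) by (intro log_mass_split power_increasing) auto
  thus ?case using step by simp
qed

lemma log_mass_le_prime_mass:
  assumes "l > 1"
  shows "log_mass (l ^ i) (l ^ Suc i) \<le> real (Suc i) * ln l * prime_mass l i"
  unfolding log_mass_def prime_mass_def sum_distrib_left
proof (intro sum_mono)
  fix p assume p: "p \<in> {p. prime p \<and> l ^ i < real p \<and> real p \<le> l ^ Suc i}"
  hence "ln (real p) \<le> ln (l ^ Suc i)" using assms by (subst ln_le_cancel_iff) (auto simp: prime_gt_0_nat)
  also have "\<dots> = real (Suc i) * ln l" using assms by (subst ln_realpow) auto
  finally show "ln (real p) / real p \<le> real (Suc i) * ln l * (1 / real p)"
    by (simp add: divide_right_mono)
qed

text \<open>
  Pigeonhole: if the heavy cells of every block lay within \<open>r\<close> of each other, then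
  \<open>log_mass_short_interval\<close> would make the total mass too small.
\<close>

lemma heavy_cells_apart:
  fixes l :: real and r R B j H :: nat
  assumes l: "l > 1" and "r \<ge> 1" "R \<ge> 1" "B \<ge> 1" and H: "H = B * R"
    and t: "l ^ r = 1 + t" "0 < t" "t \<le> 1/2" "4 * sqrt t \<le> 1 / (4 * real B)"
    and j: "l ^ (j * H) \<ge> 4 / t"
    and mass: "log_mass (l ^ (j * H)) (l ^ (j * H + H)) \<ge> 1"
  shows "\<exists>i d. r \<le> d \<and> d < R \<and> j * H \<le> i \<and> i + d < j * H + H \<and>
           log_mass (l ^ i) (l ^ Suc i) \<ge> 1 / (2 * real H) \<and>
           log_mass (l ^ (i + d)) (l ^ Suc (i + d)) \<ge> 1 / (2 * real H)"
proof (rule ccontr)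
  assume neg: "\<not> ?thesis"
  define s where "s = (\<lambda>i. log_mass (l ^ i) (l ^ Suc i))"
  \<comment> \<open>The threshold is half the average share of one of \<open>H\<close> cells in a
    mass of 1, so the light cells together carry at most 1/2.\<close>
  define heavy where "heavy = (\<lambda>i. s i \<ge> 1 / (2 * real H))"
  have s0: "s i \<ge> 0" for i by (simp add: s_def log_mass_nonneg)
  have Hpos: "real H > 0" using assms by simp
  have apart: False if "r \<le> d" "d < R" "j * H \<le> i" "i + d < j * H + H" "heavy i" "heavy (i + d)" for i d
    using neg that by (auto simp: heavy_def s_def)
  \<comment> \<open>Heavy cells in a run of \<open>R\<close> cells are less than \<open>R\<close>
    apart, hence by \<open>neg\<close> less than \<open>r\<close> apart. So they all lie among the
    \<open>r\<close> cells starting with the first heavy one, and these form a single interval of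
    ratio \<open>1 + t\<close>.\<close>
  have block: "(\<Sum>i=c..<c + R. s i) \<le> real R / (2 * real H) + 4 * sqrt t"
    if c: "j * H \<le> c" "c + R \<le> j * H + H" for c
  proof (cases "\<exists>i\<in>{c..<c+R}. heavy i")
    case False
    hence "(\<Sum>i=c..<c + R. s i) \<le> (\<Sum>i=c..<c + R. 1 / (2 * real H))"
      by (intro sum_mono) (force simp: heavy_def)
    also have "\<dots> = real R / (2 * real H)" by simp
    finally show ?thesis using t by (simp add: add_increasing2)
  next
    case True
    define i0 where "i0 = (LEAST i. i \<in> {c..<c+R} \<and> heavy i)"
    have "i0 \<in> {c..<c+R} \<and> heavy i0"
      unfolding i0_def by (rule LeastI_ex) (use True in blast)
    hence i0: "i0 \<in> {c..<c+R}" "heavy i0" by blast+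
    have least: "i0 \<le> i" if "i \<in> {c..<c+R}" "heavy i" for i
      unfolding i0_def by (rule Least_le) (use that in auto)
    have "(\<Sum>i=c..<c + R. s i) \<le> (\<Sum>i=c..<c + R. 1 / (2 * real H) + (if i \<in> {i0..<i0+r} then s i else 0))"
    proof (intro sum_mono)
      fix i assume i: "i \<in> {c..<c+R}"
      show "s i \<le> 1 / (2 * real H) + (if i \<in> {i0..<i0+r} then s i else 0)"
      proof (cases "heavy i")
        case True
        have "i0 \<le> i" using least i True by blast
        moreover have "\<not> i \<ge> i0 + r"
        proof
          assume "i \<ge> i0 + r"
          hence "r \<le> i - i0" "i - i0 < R" "j * H \<le> i0" "i0 + (i - i0) < j * H + H" "heavy (i0 + (i - i0))"
            using i0 i c True by auto
          thus False using apart i0(2) by blast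
        qed
        ultimately show ?thesis by simp
      next
        case False
        thus ?thesis using s0[of i] by (auto simp: heavy_def)
      qed
    qed
    also have "\<dots> = real R / (2 * real H) + (\<Sum>i\<in>{c..<c+R} \<inter> {i0..<i0+r}. s i)"
      by (simp only: sum.distrib sum.inter_restrict[OF finite_atLeastLessThan]) simp
    also have "(\<Sum>i\<in>{c..<c+R} \<inter> {i0..<i0+r}. s i) \<le> (\<Sum>i=i0..<i0+r. s i)"
      using s0 by (intro sum_mono2) auto
    also have "\<dots> = log_mass (l ^ i0) (l ^ (i0 + r))"
      unfolding s_def using l by (subst log_mass_power_eq_sum) auto
    also have "\<dots> = log_mass (l ^ i0) ((1 + t) * l ^ i0)" by (simp add: power_add t(1) mult.commute)
    also have "\<dots> \<le> 4 * sqrt t"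
    proof (intro log_mass_short_interval t)
      have "4 / t \<le> l ^ (j * H)" by (rule j)
      also have "\<dots> \<le> l ^ i0" using l i0 c by (intro power_increasing) auto
      finally show "4 / t \<le> l ^ i0" .
    qed
    finally show ?thesis by simp
  qed
  have "1 \<le> (\<Sum>i=j*H..<j*H+H. s i)"
    using mass l by (subst (asm) log_mass_power_eq_sum) (auto simp: s_def)
  also have "\<dots> = (\<Sum>i<B*R. s (j * H + i))"
    unfolding H[symmetric] lessThan_atLeast0 using sum.shift_bounds_nat_ivl[of s 0 "j * H" H]
    by (simp add: add.commute)
  also have "\<dots> = (\<Sum>b<B. \<Sum>i=b*R..<b*R+R. s (j * H + i))"
    by (rule sum.nat_group[symmetric])
  also have "\<dots> \<le> (\<Sum>b<B. real R / (2 * real H) + 4 * sqrt t)"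
  proof (intro sum_mono)
    fix b assume b: "b \<in> {..<B}"
    have "(\<Sum>i=b*R..<b*R+R. s (j * H + i)) = (\<Sum>i=j*H+b*R..<(j*H+b*R)+R. s i)"
      using sum.shift_bounds_nat_ivl[of s "b*R" "j * H" "b*R+R"] by (simp add: add_ac)
    also have "\<dots> \<le> real R / (2 * real H) + 4 * sqrt t"
    proof (rule block)
      have "Suc b * R \<le> B * R" using b by (intro mult_right_mono) auto
      thus "j * H + b * R + R \<le> j * H + H" by (simp add: H)
    qed auto
    finally show "(\<Sum>i=b*R..<b*R+R. s (j * H + i)) \<le> real R / (2 * real H) + 4 * sqrt t" .
  qed
  \<comment> \<open>The light cells account for 1/2 because \<open>H = B * R\<close>. The heavy ones
    add at most 1/4, which leaves the total below the given mass 1.\<close>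
  also have "\<dots> = 1 / 2 + real B * (4 * sqrt t)" using assms by (simp add: H field_simps)
  also have "\<dots> \<le> 1 / 2 + real B * (1 / (4 * real B))" by (intro add_left_mono mult_left_mono t) auto
  also have "\<dots> < 1" using assms by simp
  finally show False by simp
qed

text \<open>Every late block of \<open>H\<close> cells contains two heavy cells at a distance
  \<open>d\<close> with \<open>r \<le> d < R\<close>, and in block number \<open>j\<close> both have
  prime mass at least \<open>c / (j + 1)\<close>. The harmonic series diverges and there are
  finitely many \<open>d\<close>, so some fixed \<open>d\<close> collects a divergent series. That
  \<eta>' does not depend on \<open>r\<close> is the point: as \<open>r\<close> grows the cells
  become finer, while \<open>l ^ d\<close> stays at least \<open>exp \<eta>'\<close>.\<close>

lemma prime_pairs_with_constant_ratio:
  assumes eta: "\<eta> > 0"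
  shows "\<exists>\<eta>'>0. \<forall>r\<ge>1. \<exists>d\<ge>r. exp (\<eta>' / real r) ^ d \<le> exp \<eta> \<and>
    \<not> summable (\<lambda>i. min (prime_mass (exp (\<eta>' / real r)) i) (prime_mass (exp (\<eta>' / real r)) (i + d)))"
proof -
  obtain A where A: "A > 1" "\<And>x. x \<ge> 1 \<Longrightarrow> log_mass x (A * x) \<ge> 1"
    using log_mass_long_interval by blast
  \<comment> \<open>\<open>B\<close> intervals of ratio \<open>exp \<eta>\<close> cover one of ratio
    \<open>A\<close>. With \<open>l ^ R = exp \<eta>\<close> this makes a block of
    \<open>B * R\<close> cells long enough to have logarithmic mass at least 1.\<close>
  obtain B :: nat where B: "ln A / \<eta> < real B" using reals_Archimedean2 by blast
  have "ln A / \<eta> > 0" using A eta by simp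
  hence B1: "B \<ge> 1" using B by (cases B) auto
  have AB: "A \<le> exp (real B * \<eta>)"
  proof -
    have "ln A \<le> real B * \<eta>" using B eta by (simp add: field_simps)
    thus ?thesis using A by (subst ln_le_cancel_iff[symmetric]) auto
  qed
  \<comment> \<open>Chosen so that \<open>4 * sqrt t0 = 1 / (4 * B)\<close>, the bound required by
    \<open>heavy_cells_apart\<close>.\<close>
  define t0 where "t0 = (1 / (16 * real B)) ^ 2"
  have t0: "0 < t0" "t0 \<le> 1/2" "sqrt t0 = 1 / (16 * real B)"
  proof -
    have "1 / (16 * real B) \<le> 1 / 16" using B1 by (simp add: field_simps)
    hence "(1 / (16 * real B)) ^ 2 \<le> (1 / 16) ^ 2" using B1 by (intro power_mono) auto
    thus "t0 \<le> 1/2" by (simp add: t0_def power2_eq_square)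
  qed (use B1 in \<open>auto simp: t0_def\<close>)
  \<comment> \<open>\<open>Q\<close> makes \<open>exp (\<eta> / Q) \<le> 1 + t0\<close>, so that
    \<open>r\<close> cells, of joint ratio \<open>exp \<eta>'\<close>, form a short interval in the
    sense of \<open>log_mass_short_interval\<close>.\<close>
  obtain Q :: nat where Q: "\<eta> / ln (1 + t0) < real Q" using reals_Archimedean2 by blast
  have "\<eta> / ln (1 + t0) > 0" using t0 eta by simp
  hence Q1: "Q \<ge> 1" using Q by (cases Q) auto
  define \<eta>' where "\<eta>' = \<eta> / real Q"
  have eta': "\<eta>' > 0" using eta Q1 by (simp add: \<eta>'_def)
  define t where "t = exp \<eta>' - 1"
  have "\<eta>' \<le> ln (1 + t0)" using Q Q1 t0 by (simp add: \<eta>'_def field_simps)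
  hence "exp \<eta>' \<le> 1 + t0" using t0 by (metis add_pos_pos exp_le_cancel_iff exp_ln zero_less_one)
  hence t: "t \<le> t0" "t > 0" using eta' by (auto simp: t_def)
  show ?thesis
  proof (intro exI[of _ \<eta>'] conjI eta' allI impI)
    fix r :: nat assume r: "r \<ge> 1"
    define R where "R = r * Q"
    define H where "H = B * R"
    define l where "l = exp (\<eta>' / real r)"
    define m where "m = (\<lambda>d i. min (prime_mass l i) (prime_mass l (i + d)))"
    have R: "R \<ge> 1" "H \<ge> 1" using r Q1 B1 by (auto simp: R_def H_def)
    have l: "l > 1" using eta' r by (simp add: l_def)
    have lr: "l ^ r = 1 + t" using r by (simp add: l_def t_def exp_of_nat_mult[symmetric])
    have lR: "l ^ R = exp \<eta>"
      using r Q1 by (simp add: l_def R_def \<eta>'_def exp_of_nat_mult[symmetric])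
    have "l ^ H = (l ^ R) ^ B" unfolding H_def by (metis mult.commute power_mult)
    hence lH: "l ^ H \<ge> A" using AB by (simp add: lR exp_of_nat_mult)
    have m0: "m d i \<ge> 0" for d i by (simp add: m_def prime_mass_nonneg)
    have "\<exists>d\<in>{r..<R}. \<not> summable (m d)"
    proof (rule ccontr)
      assume "\<not> ?thesis"
      hence "summable (\<lambda>i. \<Sum>d=r..<R. m d i)" by (intro summable_sum) auto
      define G where "G = (\<lambda>i. \<Sum>d=r..<R. m d i)"
      have G0: "G i \<ge> 0" for i by (auto simp: G_def intro!: sum_nonneg m0)
      have "summable (\<lambda>j. sum G {j * H..<j * H + H})"
        using sums_group[of G _ H] R \<open>summable (\<lambda>i. \<Sum>d=r..<R. m d i)\<close>
        unfolding G_def[symmetric] summable_def by fastforce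
      \<comment> \<open>A cell \<open>k\<close> of block \<open>j\<close> has
        \<open>k + 1 \<le> (j + 1) * H\<close>. Hence a logarithmic mass of
        \<open>1 / (2 * H)\<close> forces a prime mass of at least
        \<open>c / (j + 1)\<close>.\<close>
      define c where "c = 1 / (2 * real H) / (real H * ln l)"
      have c: "c > 0" using R l by (simp add: c_def)
      obtain j0 where j0: "4 / t < l ^ j0" using real_arch_pow[OF l] by blast
      have lower: "c * inverse (real (Suc j)) \<le> sum G {j * H..<j * H + H}" if j: "j \<ge> j0" for j
      proof -
        have "j0 * 1 \<le> j * H" using R j by (intro mult_mono) auto
        hence "l ^ j0 \<le> l ^ (j * H)" using l by (intro power_increasing) auto
        hence large: "4 / t \<le> l ^ (j * H)" using j0 by linarith
        have "log_mass (l ^ (j * H)) (A * l ^ (j * H)) \<ge> 1" using l by (intro A) auto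
        also have "log_mass (l ^ (j * H)) (A * l ^ (j * H)) \<le> log_mass (l ^ (j * H)) (l ^ (j * H + H))"
          using lH l by (intro log_mass_mono) (auto simp: power_add mult.commute intro!: mult_mono)
        finally have mass: "log_mass (l ^ (j * H)) (l ^ (j * H + H)) \<ge> 1" .
        have "4 * sqrt t \<le> 4 * sqrt t0" using t by simp
        also have "\<dots> = 1 / (4 * real B)" by (simp add: t0)
        finally obtain i d where id: "r \<le> d" "d < R" "j * H \<le> i" "i + d < j * H + H"
           "log_mass (l ^ i) (l ^ Suc i) \<ge> 1 / (2 * real H)"
           "log_mass (l ^ (i + d)) (l ^ Suc (i + d)) \<ge> 1 / (2 * real H)"
          using heavy_cells_apart[OF l r R(1) B1 H_def lr t(2) _ _ large mass] t t0 by auto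
        have mass_ge: "c * inverse (real (Suc j)) \<le> prime_mass l k"
          if k: "k < j * H + H" "log_mass (l ^ k) (l ^ Suc k) \<ge> 1 / (2 * real H)" for k
        proof -
          have "1 / (2 * real H) \<le> real (Suc k) * ln l * prime_mass l k"
            using k(2) log_mass_le_prime_mass[OF l, of k] by linarith
          also have "\<dots> \<le> (real (Suc j) * real H) * ln l * prime_mass l k"
          proof (intro mult_right_mono)
            have "Suc k \<le> Suc j * H" using k(1) by simp
            thus "real (Suc k) \<le> real (Suc j) * real H" by (metis of_nat_le_iff of_nat_mult)
          qed (use l prime_mass_nonneg in auto)
          finally have "1 / (2 * real H) / (real (Suc j) * real H * ln l) \<le> prime_mass l k"
            using R l by (subst pos_divide_le_eq) (auto simp: mult.commute)
          thus ?thesis by (simp add: c_def field_simps)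
        qed
        have "c * inverse (real (Suc j)) \<le> m d i"
          unfolding m_def using mass_ge[of i] mass_ge[of "i + d"] id by simp
        also have "\<dots> \<le> G i" unfolding G_def using id m0 by (intro member_le_sum) auto
        also have "\<dots> \<le> sum G {j * H..<j * H + H}" using id G0 by (intro member_le_sum) auto
        finally show ?thesis .
      qed
      have "summable (\<lambda>j. c * inverse (real (Suc j)))"
        by (rule summable_comparison_test_ev[OF _ \<open>summable (\<lambda>j. sum G {j * H..<j * H + H})\<close>])
           (use lower c in \<open>auto simp: eventually_at_top_linorder intro!: exI[of _ j0]\<close>)
      hence "summable (\<lambda>j. inverse (real (Suc j)))" using c by (subst (asm) summable_cmult_iff) auto
      hence "summable (\<lambda>j. inverse (real j))"
        using summable_Suc_iff[of "\<lambda>j. inverse (real j)"] by simp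
      thus False using not_summable_harmonic[where 'a = real] by simp
    qed
    then obtain d where d: "r \<le> d" "d < R" "\<not> summable (m d)" by auto
    have "l ^ d \<le> exp \<eta>" using d l unfolding lR[symmetric] by (intro power_increasing) auto
    thus "\<exists>d\<ge>r. exp (\<eta>' / real r) ^ d \<le> exp \<eta> \<and>
      \<not> summable (\<lambda>i. min (prime_mass (exp (\<eta>' / real r)) i) (prime_mass (exp (\<eta>' / real r)) (i + d)))"
      using d unfolding m_def l_def by blast
  qed
qed

section \<open>Mean values along multiplication by primes\<close>

text \<open>A real argument, and division by \<open>x\<close> itself rather than its floor, let the
  mean be taken at \<open>x / p\<close> and \<open>l ^ d * x\<close> without rounding in the
  normalisation.\<close>

definition mean_upto :: "(nat \<Rightarrow> complex) \<Rightarrow> real \<Rightarrow> complex" where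
  "mean_upto f x = (\<Sum>n=1..nat \<lfloor>x\<rfloor>. f n) / of_real x"

lemma sum_multiples:
  fixes f :: "nat \<Rightarrow> 'a::comm_monoid_add"
  assumes "d > 0"
  shows "(\<Sum>n | n \<in> {1..N} \<and> d dvd n. f n) = (\<Sum>m=1..N div d. f (d * m))"
  using assms
  by (intro sum.reindex_bij_witness[of _ "\<lambda>m. d * m" "\<lambda>n. n div d"])
     (auto simp: less_eq_div_iff_mult_less_eq mult.commute div_le_mono Suc_le_eq dvd_def)

lemma sum_inverse_squares_le:
  assumes "finite P"
  shows "(\<Sum>p\<in>P. 1 / real p ^ 2) \<le> 3"
proof -
  \<comment> \<open>A possible term at 0 vanishes because \<open>1 / 0 = 0\<close>.\<close>
  have "(\<Sum>p\<in>P. 1 / real p ^ 2) = (\<Sum>p\<in>P - {0}. 1 / (real (p - 1) + 1) ^ 2)"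
    using assms by (intro sum.mono_neutral_cong_right) (auto simp: of_nat_diff)
  also have "\<dots> = (\<Sum>n\<in>(\<lambda>p. p - 1) ` (P - {0}). 1 / (real n + 1) ^ 2)"
    by (subst sum.reindex) (auto simp: inj_on_def)
  also have "\<dots> \<le> (\<Sum>n. 1 / (real n + 1) ^ 2)"
    using inverse_squares_sums assms by (intro sum_le_suminf) (auto simp: sums_iff add.commute)
  also have "\<dots> = pi ^ 2 / 6" using inverse_squares_sums by (simp add: sums_iff add.commute)
  also have "pi ^ 2 \<le> 4 ^ 2" using pi_less_4 by (intro power_mono) auto
  finally show ?thesis by simp
qed

text \<open>Expanding the square, distinct primes contribute at most \<open>N / (p * q)\<close> each
  time, as for independent events. The diagonal adds at most \<open>N * M\<close>, since
  \<open>c p \<le> 1\<close>. Rounding in the first moment loses at most \<open>card P\<close>,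
  which \<open>N \<ge> 2 * card P\<close> turns into the factor 2.\<close>

lemma turan_kubilius_variance:
  fixes c :: "nat \<Rightarrow> real"
  assumes P: "finite P" "\<And>p. p \<in> P \<Longrightarrow> prime p"
    and c: "\<And>p. p \<in> P \<Longrightarrow> 0 \<le> c p" "\<And>p. p \<in> P \<Longrightarrow> c p \<le> 1"
    and M: "M = (\<Sum>p\<in>P. c p / real p)" and N: "2 * card P \<le> N"
  shows "(\<Sum>n=1..N. ((\<Sum>p\<in>P. if p dvd n then c p else 0) - M) ^ 2) \<le> 2 * M * real N"
proof -
  define w where "w = (\<lambda>n. \<Sum>p\<in>P. if p dvd n then c p else 0)"
  have p0: "p > 0" if "p \<in> P" for p using P(2)[OF that] by (simp add: prime_gt_0_nat)
  have M0: "M \<ge> 0" unfolding M using c by (intro sum_nonneg) auto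
  have w1: "(\<Sum>n=1..N. w n) \<ge> real N * M - real (card P)"
  proof -
    have "(\<Sum>n=1..N. w n) = (\<Sum>p\<in>P. \<Sum>n=1..N. if p dvd n then c p else 0)"
      unfolding w_def by (rule sum.swap)
    also have "\<dots> = (\<Sum>p\<in>P. c p * real (N div p))"
    proof (intro sum.cong refl)
      fix p assume "p \<in> P"
      have "(\<Sum>n=1..N. if p dvd n then c p else 0) = c p * real (card {n \<in> {1..N}. p dvd n})"
        by (simp add: sum.If_cases Int_def)
      thus "(\<Sum>n=1..N. if p dvd n then c p else 0) = c p * real (N div p)"
        using p0[OF \<open>p \<in> P\<close>] by (simp only: card_multiples_atLeastAtMost)
    qed
    also have "\<dots> \<ge> (\<Sum>p\<in>P. c p * (real N / real p) - 1)"
    proof (intro sum_mono)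
      fix p assume p: "p \<in> P"
      have "c p * (real N / real p) \<le> c p * (real (N div p) + 1)"
        using p0[OF p] c p by (intro mult_left_mono divide_le_of_nat_div_plus_1) auto
      thus "c p * (real N / real p) - 1 \<le> c p * real (N div p)"
        using c(2)[OF p] by (simp add: algebra_simps)
    qed
    also have "(\<Sum>p\<in>P. c p * (real N / real p) - 1) = real N * M - real (card P)"
      by (simp add: M sum_subtractf sum_distrib_left mult_ac)
    finally show ?thesis .
  qed
  have w2: "(\<Sum>n=1..N. w n ^ 2) \<le> real N * M ^ 2 + real N * M"
  proof -
    have "(\<Sum>n=1..N. w n ^ 2) =
        (\<Sum>n=1..N. \<Sum>p\<in>P. \<Sum>q\<in>P. if p dvd n \<and> q dvd n then c p * c q else 0)"
      unfolding w_def power2_eq_square sum_product by (intro sum.cong) auto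
    also have "\<dots> = (\<Sum>p\<in>P. \<Sum>n=1..N. \<Sum>q\<in>P. if p dvd n \<and> q dvd n then c p * c q else 0)"
      by (rule sum.swap)
    also have "\<dots> = (\<Sum>p\<in>P. \<Sum>q\<in>P. \<Sum>n=1..N. if p dvd n \<and> q dvd n then c p * c q else 0)"
      by (intro sum.cong refl sum.swap)
    also have "\<dots> \<le> (\<Sum>p\<in>P. \<Sum>q\<in>P. real N * (c p / real p * (c q / real q)) +
        (if p = q then real N * (c p / real p) else 0))"
    proof (intro sum_mono)
      fix p q assume pq: "p \<in> P" "q \<in> P"
      have "(\<Sum>n=1..N. if p dvd n \<and> q dvd n then c p * c q else 0) =
          c p * c q * real (card {n \<in> {1..N}. lcm p q dvd n})"
        by (simp add: sum.If_cases Int_def)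
      also have "\<dots> = c p * c q * real (N div lcm p q)"
        using p0[OF pq(1)] p0[OF pq(2)] by (subst card_multiples_atLeastAtMost) (auto simp: lcm_pos_nat)
      also have "\<dots> \<le> c p * c q * (real N / real (lcm p q))"
        using c pq by (intro mult_left_mono of_nat_div_le_divide) auto
      also have "\<dots> \<le> real N * (c p / real p * (c q / real q)) +
        (if p = q then real N * (c p / real p) else 0)"
      proof (cases "p = q")
        case True
        have "c p * c q * (real N / real (lcm p q)) = c p * (real N * (c p / real p))"
          using True by simp
        also have "\<dots> \<le> 1 * (real N * (c p / real p))" using c pq by (intro mult_right_mono) auto
        moreover have "0 \<le> real N * (c p / real p * (c q / real q))" using c pq by simp
        ultimately show ?thesis unfolding if_P[OF True] by linarith
      next
        case False
        hence "coprime p q" using P(2) pq by (intro primes_coprime) auto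
        hence "lcm p q = p * q" by (simp add: lcm_coprime)
        thus ?thesis using False by (simp add: mult_ac)
      qed
      finally show "(\<Sum>n=1..N. if p dvd n \<and> q dvd n then c p * c q else 0) \<le>
        real N * (c p / real p * (c q / real q)) + (if p = q then real N * (c p / real p) else 0)" .
    qed
    also have "\<dots> = (\<Sum>p\<in>P. \<Sum>q\<in>P. real N * (c p / real p * (c q / real q))) +
        (\<Sum>p\<in>P. real N * (c p / real p))"
      using P(1) by (simp add: sum.distrib)
    also have "\<dots> = real N * M ^ 2 + real N * M"
    proof -
      have "M ^ 2 = (\<Sum>p\<in>P. \<Sum>q\<in>P. c p / real p * (c q / real q))"
        by (simp only: M power2_eq_square sum_product)
      hence "real N * M ^ 2 = (\<Sum>p\<in>P. \<Sum>q\<in>P. real N * (c p / real p * (c q / real q)))"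
        by (simp only: sum_distrib_left)
      moreover have "real N * M = (\<Sum>p\<in>P. real N * (c p / real p))"
        by (simp only: M sum_distrib_left)
      ultimately show ?thesis by (simp only:)
    qed
    finally show ?thesis .
  qed
  have "(\<Sum>n=1..N. (w n - M) ^ 2) = (\<Sum>n=1..N. w n ^ 2) - 2 * M * (\<Sum>n=1..N. w n) + real N * M ^ 2"
    by (simp add: power2_diff sum.distrib sum_subtractf sum_distrib_left mult_ac)
  also have "\<dots> \<le> (real N * M ^ 2 + real N * M) - 2 * M * (real N * M - real (card P)) + real N * M ^ 2"
    using w1 w2 M0 by (intro add_right_mono diff_mono mult_left_mono) auto
  also have "\<dots> = M * (real N + 2 * real (card P))" by (simp add: algebra_simps power2_eq_square)
  also have "\<dots> \<le> M * (2 * real N)" using N M0 by (intro mult_left_mono) auto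
  finally show ?thesis by (simp add: w_def mult_ac)
qed

text \<open>Everything that the averaging argument uses of the dynamics: \<open>b\<close> comes from
  an orbit and \<open>b'\<close> from the orbit moved on by one step of \<open>T\<close>, since
  multiplication by a prime raises the number of prime factors by one.\<close>

locale prime_shift =
  fixes b b' :: "nat \<Rightarrow> complex"
  assumes norm_b: "norm (b n) \<le> 1" and norm_b': "norm (b' n) \<le> 1"
    and shift: "prime p \<Longrightarrow> n > 0 \<Longrightarrow> \<not> p dvd n \<Longrightarrow> b (p * n) = b' n"
begin

text \<open>The shift relation fails at most at the multiples of \<open>p\<close>, of which there
  are at most \<open>K / p\<close>, and each failure costs at most 2.\<close>

lemma dilate_sum:
  assumes p: "prime p"
  shows "norm ((\<Sum>m=1..K. b (p * m)) - (\<Sum>m=1..K. b' m)) \<le> 2 * real K / real p"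
proof -
  have "norm ((\<Sum>m=1..K. b (p * m)) - (\<Sum>m=1..K. b' m)) \<le> (\<Sum>m=1..K. norm (b (p * m) - b' m))"
    unfolding sum_subtractf[symmetric] by (rule norm_sum)
  also have "\<dots> \<le> (\<Sum>m=1..K. if p dvd m then 2 else 0)"
  proof (intro sum_mono)
    fix m assume "m \<in> {1..K}"
    have "norm (b (p * m) - b' m) \<le> 2"
      using norm_triangle_ineq4[of "b (p * m)" "b' m"] norm_b[of "p * m"] norm_b'[of m] by linarith
    thus "norm (b (p * m) - b' m) \<le> (if p dvd m then 2 else 0)"
      using shift[OF p, of m] \<open>m \<in> {1..K}\<close> by auto
  qed
  also have "\<dots> = 2 * real (card {m \<in> {1..K}. p dvd m})" by (simp add: sum.If_cases Int_def)
  also have "\<dots> = 2 * real (K div p)"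
    using p by (subst card_multiples_atLeastAtMost) (auto simp: prime_gt_0_nat)
  also have "\<dots> \<le> 2 * (real K / real p)" by (intro mult_left_mono of_nat_div_le_divide) auto
  finally show ?thesis by simp
qed

text \<open>The inequality in dual form. Let \<open>w n\<close> be the sum of \<open>c p\<close>
  over \<open>p\<close> dividing \<open>n\<close>. By Cauchy-Schwarz and the variance bound,
  \<open>b\<close> is nearly orthogonal to \<open>w - M\<close>, so \<open>M\<close> times the sum
  of \<open>b\<close> is nearly the sum of \<open>b * w\<close>. Grouping the latter by
  \<open>p\<close> gives sums of \<open>b (p * m)\<close>, where \<open>b'\<close> may be inserted.
  The term \<open>6 / M\<close> comes from the multiples \<open>m\<close> of \<open>p\<close>: twice
  the bound 3 for the sum of \<open>1 / p ^ 2\<close>.\<close>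

lemma turan_kubilius:
  fixes c :: "nat \<Rightarrow> real"
  assumes P: "finite P" "\<And>p. p \<in> P \<Longrightarrow> prime p"
    and c: "\<And>p. p \<in> P \<Longrightarrow> 0 \<le> c p" "\<And>p. p \<in> P \<Longrightarrow> c p \<le> 1"
    and M: "M = (\<Sum>p\<in>P. c p / real p)" "M > 0" and x: "x \<ge> 2 * real (card P) + 1"
  shows "norm (mean_upto b x - (\<Sum>p\<in>P. of_real (c p / real p / M) * mean_upto b' (x / real p)))
           \<le> sqrt (2 / M) + 6 / M"
proof -
  define N where "N = nat \<lfloor>x\<rfloor>"
  have x1: "x \<ge> 1" using x by linarith
  have N: "2 * card P \<le> N" "real N \<le> x" using x x1 by (auto simp: N_def le_nat_iff le_floor_iff)
  have p0: "p > 0" if "p \<in> P" for p using P(2)[OF that] by (simp add: prime_gt_0_nat)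
  define w where "w = (\<lambda>n. \<Sum>p\<in>P. if p dvd n then c p else 0)"
  have var: "(\<Sum>n=1..N. (w n - M) ^ 2) \<le> 2 * M * real N"
    unfolding w_def by (rule turan_kubilius_variance[OF P c M(1) N(1)])
  have cs: "norm (\<Sum>n=1..N. b n * of_real (w n - M)) \<le> real N * sqrt (2 * M)"
  proof -
    have "norm (\<Sum>n=1..N. b n * of_real (w n - M)) \<le> (\<Sum>n=1..N. norm (b n * of_real (w n - M)))"
      by (rule norm_sum)
    also have "\<dots> \<le> (\<Sum>n=1..N. \<bar>w n - M\<bar>)"
    proof (intro sum_mono)
      fix n show "norm (b n * of_real (w n - M)) \<le> \<bar>w n - M\<bar>"
        using mult_right_mono[OF norm_b[of n], of "\<bar>w n - M\<bar>"]
        by (simp only: norm_mult norm_of_real) simp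
    qed
    also have "\<dots> \<le> sqrt ((2 * M * real N) * real N)"
    proof (rule real_le_rsqrt)
      have "(\<Sum>n=1..N. \<bar>w n - M\<bar>) ^ 2 \<le> (\<Sum>n=1..N. \<bar>w n - M\<bar> ^ 2) * real (card {1..N})"
        by (rule sum_squared_le_sum_of_squares)
      also have "\<dots> \<le> (2 * M * real N) * real N" using var M(2) by (intro mult_mono) auto
      finally show "(\<Sum>n=1..N. \<bar>w n - M\<bar>) ^ 2 \<le> (2 * M * real N) * real N" .
    qed
    also have "\<dots> = real N * sqrt (2 * M)" by (simp add: real_sqrt_mult mult_ac)
    finally show ?thesis .
  qed
  have bw: "(\<Sum>n=1..N. b n * of_real (w n)) = (\<Sum>p\<in>P. of_real (c p) * (\<Sum>m=1..N div p. b (p * m)))"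
  proof -
    have "(\<Sum>n=1..N. b n * of_real (w n)) = (\<Sum>n=1..N. \<Sum>p\<in>P. if p dvd n then of_real (c p) * b n else 0)"
      unfolding w_def of_real_sum sum_distrib_left by (intro sum.cong refl) auto
    also have "\<dots> = (\<Sum>p\<in>P. \<Sum>n=1..N. if p dvd n then of_real (c p) * b n else 0)" by (rule sum.swap)
    also have "\<dots> = (\<Sum>p\<in>P. \<Sum>n | n \<in> {1..N} \<and> p dvd n. of_real (c p) * b n)"
      by (rule sum.cong[OF refl]) (simp add: sum.If_cases Int_def)
    also have "\<dots> = (\<Sum>p\<in>P. \<Sum>m=1..N div p. of_real (c p) * b (p * m))"
      by (intro sum.cong refl sum_multiples p0)
    finally show ?thesis by (simp add: sum_distrib_left)
  qed
  have dil: "norm ((\<Sum>p\<in>P. of_real (c p) * (\<Sum>m=1..N div p. b (p * m))) -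
      (\<Sum>p\<in>P. of_real (c p) * (\<Sum>m=1..N div p. b' m))) \<le> 6 * real N"
  proof -
    have "norm ((\<Sum>p\<in>P. of_real (c p) * (\<Sum>m=1..N div p. b (p * m))) -
        (\<Sum>p\<in>P. of_real (c p) * (\<Sum>m=1..N div p. b' m))) \<le>
        (\<Sum>p\<in>P. norm (of_real (c p) * (\<Sum>m=1..N div p. b (p * m)) - of_real (c p) * (\<Sum>m=1..N div p. b' m)))"
      unfolding sum_subtractf[symmetric] by (rule norm_sum)
    also have "\<dots> \<le> (\<Sum>p\<in>P. 2 * real N * (1 / real p ^ 2))"
    proof (intro sum_mono)
      fix p assume p: "p \<in> P"
      have "norm (of_real (c p) * (\<Sum>m=1..N div p. b (p * m)) - of_real (c p) * (\<Sum>m=1..N div p. b' m))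
          = c p * norm ((\<Sum>m=1..N div p. b (p * m)) - (\<Sum>m=1..N div p. b' m))"
        using c(1)[OF p] by (simp only: right_diff_distrib[symmetric] norm_mult norm_of_real abs_of_nonneg)
      also have "\<dots> \<le> 1 * (2 * real (N div p) / real p)"
        using c p P by (intro mult_mono dilate_sum) auto
      also have "\<dots> = 2 * real (N div p) / real p" by simp
      also have "\<dots> \<le> 2 * (real N / real p) / real p"
        by (intro divide_right_mono mult_left_mono of_nat_div_le_divide) auto
      finally show "norm (of_real (c p) * (\<Sum>m=1..N div p. b (p * m)) -
          of_real (c p) * (\<Sum>m=1..N div p. b' m)) \<le> 2 * real N * (1 / real p ^ 2)"
        by (simp add: power2_eq_square)
    qed
    also have "\<dots> = 2 * real N * (\<Sum>p\<in>P. 1 / real p ^ 2)" by (simp add: sum_distrib_left)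
    also have "\<dots> \<le> 2 * real N * 3" by (intro mult_left_mono sum_inverse_squares_le P) auto
    finally show ?thesis by simp
  qed
  define D where "D = of_real M * (\<Sum>n=1..N. b n) - (\<Sum>p\<in>P. of_real (c p) * (\<Sum>m=1..N div p. b' m))"
  have "D = ((\<Sum>p\<in>P. of_real (c p) * (\<Sum>m=1..N div p. b (p * m))) -
      (\<Sum>p\<in>P. of_real (c p) * (\<Sum>m=1..N div p. b' m))) - (\<Sum>n=1..N. b n * of_real (w n - M))"
    unfolding D_def bw[symmetric] by (simp add: sum_subtractf sum_distrib_left algebra_simps)
  hence "norm D \<le> 6 * real N + real N * sqrt (2 * M)"
    using norm_triangle_ineq4 cs dil by (smt (verit))
  also have "\<dots> \<le> x * (6 + sqrt (2 * M))" using N M by (simp add: algebra_simps add_mono mult_right_mono)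
  finally have normD: "norm D \<le> x * (6 + sqrt (2 * M))" .
  have "mean_upto b x - (\<Sum>p\<in>P. of_real (c p / real p / M) * mean_upto b' (x / real p)) = D / of_real (M * x)"
  proof -
    have "of_real (c p / real p / M) * mean_upto b' (x / real p) =
        of_real (c p) * (\<Sum>m=1..N div p. b' m) / of_real (M * x)" if p: "p \<in> P" for p
    proof -
      have "nat \<lfloor>x / real p\<rfloor> = N div p"
        using floor_divide_real_eq_div[of "int p" x] x1 by (simp add: N_def nat_div_distrib)
      thus ?thesis using p0[OF p] x1 M(2) by (simp add: mean_upto_def)
    qed
    hence "(\<Sum>p\<in>P. of_real (c p / real p / M) * mean_upto b' (x / real p)) =
        (\<Sum>p\<in>P. of_real (c p) * (\<Sum>m=1..N div p. b' m)) / of_real (M * x)"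
      by (simp add: sum_divide_distrib)
    moreover have "mean_upto b x = of_real M * (\<Sum>n=1..N. b n) / of_real (M * x)"
      using M(2) x1 by (simp add: mean_upto_def N_def)
    ultimately show ?thesis by (simp add: D_def diff_divide_distrib)
  qed
  hence "norm (mean_upto b x - (\<Sum>p\<in>P. of_real (c p / real p / M) * mean_upto b' (x / real p))) = norm D / (M * x)"
    using M(2) x1 by (simp only: norm_divide norm_of_real) simp
  also have "\<dots> \<le> x * (6 + sqrt (2 * M)) / (M * x)" using normD M x1 by (intro divide_right_mono) auto
  also have "\<dots> = 6 / M + sqrt (2 * M) / M" using x1 by (simp add: add_divide_distrib)
  also have "sqrt (2 * M) / M = sqrt (2 / M)"
    using M(2) by (simp add: real_sqrt_mult real_sqrt_divide field_simps)
  finally show ?thesis by simp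
qed

end

lemma norm_sum_le_of_bounded:
  fixes f :: "nat \<Rightarrow> complex"
  assumes "\<And>n. norm (f n) \<le> 1"
  shows "norm (sum f A) \<le> real (card A)"
  using sum_norm_bound[of A f 1] assms by simp

text \<open>One copy of \<open>1 - x / y\<close> bounds the terms between \<open>x\<close> and
  \<open>y\<close>, the other the change of normalisation. The term \<open>1 / y\<close> is the
  rounding error in the number of new terms.\<close>

lemma mean_upto_lipschitz:
  assumes f: "\<And>n. norm (f n) \<le> 1" and x: "0 < x" "x \<le> y"
  shows "norm (mean_upto f y - mean_upto f x) \<le> 2 * (1 - x / y) + 1 / y"
proof -
  define S where "S = (\<lambda>z::real. \<Sum>n=1..nat \<lfloor>z\<rfloor>. f n)"
  have "nat \<lfloor>x\<rfloor> \<le> nat \<lfloor>y\<rfloor>" using x by (intro nat_mono floor_mono)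
  hence "{1..nat \<lfloor>y\<rfloor>} = {1..nat \<lfloor>x\<rfloor>} \<union> {Suc (nat \<lfloor>x\<rfloor>)..nat \<lfloor>y\<rfloor>}" by auto
  hence "S y = S x + (\<Sum>n=Suc (nat \<lfloor>x\<rfloor>)..nat \<lfloor>y\<rfloor>. f n)"
    unfolding S_def by (simp only:) (rule sum.union_disjoint, auto)
  hence "norm (S y - S x) = norm (\<Sum>n=Suc (nat \<lfloor>x\<rfloor>)..nat \<lfloor>y\<rfloor>. f n)" by simp
  also have "\<dots> \<le> real (card {Suc (nat \<lfloor>x\<rfloor>)..nat \<lfloor>y\<rfloor>})"
    by (rule norm_sum_le_of_bounded[of f, OF f])
  also have "\<dots> = real (nat \<lfloor>y\<rfloor>) - real (nat \<lfloor>x\<rfloor>)"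
    using x by (simp add: of_nat_diff nat_mono floor_mono)
  also have "\<dots> \<le> y - x + 1" using x by (simp add: of_nat_nat) linarith
  finally have 1: "norm (S y - S x) \<le> y - x + 1" .
  have "norm (S x) \<le> real (card {1..nat \<lfloor>x\<rfloor>})" unfolding S_def by (rule norm_sum_le_of_bounded[of f, OF f])
  also have "\<dots> \<le> x" using x by (simp add: of_nat_nat)
  finally have 2: "norm (S x) \<le> x" .
  have "mean_upto f y - mean_upto f x = (S y - S x) / of_real y - S x * of_real (1 / x - 1 / y)"
    using x by (simp add: mean_upto_def S_def diff_divide_distrib right_diff_distrib)
  also have "norm \<dots> \<le> norm ((S y - S x) / of_real y) + norm (S x * of_real (1 / x - 1 / y))"
    by (rule norm_triangle_ineq4)
  also have "norm ((S y - S x) / of_real y) = norm (S y - S x) / y" using x by (simp add: norm_divide)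
  also have "\<dots> \<le> (y - x + 1) / y" using 1 x by (intro divide_right_mono) auto
  also have "norm (S x * of_real (1 / x - 1 / y)) = norm (S x) * (1 / x - 1 / y)"
    using x by (simp only: norm_mult norm_of_real) (simp add: frac_le)
  also have "\<dots> \<le> x * (1 / x - 1 / y)" using 2 x by (intro mult_right_mono) (auto simp: frac_le)
  also have "(y - x + 1) / y + x * (1 / x - 1 / y) = 2 * (1 - x / y) + 1 / y"
    using x by (simp add: field_simps)
  finally show ?thesis by simp
qed

context prime_shift
begin

text \<open>
  The weights \<open>c p = m i / prime_mass l (g i)\<close> on the cell \<open>{l ^ g i<..l ^ (g i + 1)}\<close> turn
  the sum over primes in \<open>turan_kubilius\<close> into a sum over cells with prescribed masses.
\<close>

lemma turan_kubilius_cells: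
  fixes m :: "nat \<Rightarrow> real"
  assumes l: "l > 1" and I: "finite I" and g: "inj_on g I"
    and m: "\<And>i. i \<in> I \<Longrightarrow> 0 \<le> m i" "\<And>i. i \<in> I \<Longrightarrow> m i \<le> prime_mass l (g i)"
    and M: "M = sum m I" "M > 0"
  shows "eventually (\<lambda>x. norm (mean_upto b x - (\<Sum>i\<in>I. of_real (m i / M) * mean_upto b' (x / l ^ g i)))
           \<le> sqrt (2 / M) + 7 / M + 2 * (1 - 1 / l)) at_top"
proof -
  define cell where "cell = (\<lambda>i. {p. prime p \<and> l ^ g i < real p \<and> real p \<le> l ^ Suc (g i)})"
  define ix where "ix = (\<lambda>p. THE i. i \<in> I \<and> p \<in> cell i)"
  define P where "P = (\<Union>i\<in>I. cell i)"
  define c where "c = (\<lambda>p. m (ix p) / prime_mass l (g (ix p)))"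
  have disj: "i = j" if "i \<in> I" "j \<in> I" "p \<in> cell i" "p \<in> cell j" for i j p
  proof -
    have *: "g i \<le> g j" if "p \<in> cell i" "p \<in> cell j" for i j
    proof (rule ccontr)
      assume "\<not> g i \<le> g j"
      hence "l ^ Suc (g j) \<le> l ^ g i" using l by (intro power_increasing) auto
      thus False using that by (auto simp: cell_def)
    qed
    show ?thesis using *[of i j] *[of j i] that g by (auto simp: inj_on_def)
  qed
  have ix: "ix p = i" if "i \<in> I" "p \<in> cell i" for p i
    unfolding ix_def using that disj by (intro the_equality) auto
  have fin: "finite (cell i)" for i by (simp add: cell_def)
  have sumP: "(\<Sum>p\<in>P. F p) = (\<Sum>i\<in>I. \<Sum>p\<in>cell i. F p)" for F :: "nat \<Rightarrow> 'z::comm_monoid_add"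
    unfolding P_def using I fin disj by (intro sum.UNION_disjoint) blast+
  \<comment> \<open>If the cell contains no prime, then \<open>m i\<close> vanishes as well, so the
    default value of division by zero in \<open>c\<close> is the right one.\<close>
  have mass0: "m i = 0" if "i \<in> I" "prime_mass l (g i) = 0" for i
    using m[of i] that by auto
  have cellsum: "(\<Sum>p\<in>cell i. c p / real p) = m i" if i: "i \<in> I" for i
  proof -
    have "(\<Sum>p\<in>cell i. c p / real p) = (\<Sum>p\<in>cell i. m i / prime_mass l (g i) * (1 / real p))"
      by (intro sum.cong) (auto simp: c_def ix[OF i])
    also have "\<dots> = m i / prime_mass l (g i) * prime_mass l (g i)"
      by (simp only: sum_distrib_left[symmetric] prime_mass_def cell_def)
    finally show ?thesis using mass0[OF i] by (cases "prime_mass l (g i) = 0") auto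
  qed
  have c01: "0 \<le> c p" "c p \<le> 1" if "p \<in> P" for p
  proof -
    obtain i where i: "i \<in> I" "p \<in> cell i" using \<open>p \<in> P\<close> by (auto simp: P_def)
    show "0 \<le> c p" "c p \<le> 1"
      using m[OF i(1)] prime_mass_nonneg[of l "g i"] by (auto simp: c_def ix[OF i] divide_le_eq_1)
  qed
  have finP: "finite P" using I fin by (auto simp: P_def)
  have M': "M = (\<Sum>p\<in>P. c p / real p)" by (simp add: sumP M(1) cellsum)
  have prP: "prime p" if "p \<in> P" for p using that by (auto simp: P_def cell_def)
  \<comment> \<open>\<open>L\<close> bounds the endpoints of all cells. For
    \<open>x \<ge> L * M\<close> the rounding term of \<open>mean_upto_lipschitz\<close> at
    \<open>x / l ^ g i\<close> is at most \<open>1 / M\<close>, which turns 6 into 7 in the final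
    bound.\<close>
  define L where "L = (\<Sum>i\<in>I. l ^ Suc (g i))"
  have L: "l ^ Suc (g i) \<le> L" if "i \<in> I" for i
    unfolding L_def using that I l by (intro member_le_sum) auto
  show ?thesis
    using eventually_ge_at_top[of "2 * real (card P) + 1"] eventually_ge_at_top[of "L * M"]
  proof eventually_elim
    case (elim x)
    have x: "x > 0" using elim(1) by linarith
    have tk: "norm (mean_upto b x - (\<Sum>p\<in>P. of_real (c p / real p / M) * mean_upto b' (x / real p)))
           \<le> sqrt (2 / M) + 6 / M"
      by (rule turan_kubilius[OF finP prP c01 M' M(2) elim(1)])
    define A where "A = (\<Sum>p\<in>P. of_real (c p / real p / M) * mean_upto b' (x / real p))"
    define B where "B = (\<Sum>i\<in>I. of_real (m i / M) * mean_upto b' (x / l ^ g i))"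
    have "B = (\<Sum>p\<in>P. of_real (c p / real p / M) * mean_upto b' (x / l ^ g (ix p)))"
      unfolding B_def sumP
    proof (intro sum.cong refl)
      fix i assume i: "i \<in> I"
      have "(\<Sum>p\<in>cell i. of_real (c p / real p / M) * mean_upto b' (x / l ^ g (ix p))) =
        (\<Sum>p\<in>cell i. of_real (c p / real p / M) * mean_upto b' (x / l ^ g i))"
        by (intro sum.cong refl) (simp add: ix[OF i])
      also have "\<dots> = of_real (\<Sum>p\<in>cell i. c p / real p / M) * mean_upto b' (x / l ^ g i)"
        by (simp only: sum_distrib_right of_real_sum)
      also have "(\<Sum>p\<in>cell i. c p / real p / M) = m i / M"
        by (simp only: sum_divide_distrib[symmetric] cellsum[OF i])
      finally show "of_real (m i / M) * mean_upto b' (x / l ^ g i) =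
        (\<Sum>p\<in>cell i. of_real (c p / real p / M) * mean_upto b' (x / l ^ g (ix p)))" by simp
    qed
    hence "norm (A - B) = norm (\<Sum>p\<in>P. of_real (c p / real p / M) *
        (mean_upto b' (x / real p) - mean_upto b' (x / l ^ g (ix p))))"
      by (simp add: A_def sum_subtractf right_diff_distrib)
    also have "\<dots> \<le> (\<Sum>p\<in>P. norm (of_real (c p / real p / M) *
        (mean_upto b' (x / real p) - mean_upto b' (x / l ^ g (ix p)))))" by (rule norm_sum)
    also have "\<dots> \<le> (\<Sum>p\<in>P. c p / real p / M * (2 * (1 - 1 / l) + 1 / M))"
    proof (intro sum_mono)
      fix p assume p: "p \<in> P"
      then obtain i where i: "i \<in> I" "p \<in> cell i" by (auto simp: P_def)
      have pc: "l ^ g i < real p" "real p \<le> l ^ g i * l" using i by (auto simp: cell_def mult.commute)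
      have l0: "l ^ g i > 0" using l by simp
      have "norm (mean_upto b' (x / l ^ g i) - mean_upto b' (x / real p)) \<le>
          2 * (1 - (x / real p) / (x / l ^ g i)) + 1 / (x / l ^ g i)"
        using pc l0 x by (intro mean_upto_lipschitz norm_b') (auto simp: frac_le)
      also have "(x / real p) / (x / l ^ g i) = l ^ g i / real p" using x by simp
      also have "2 * (1 - l ^ g i / real p) \<le> 2 * (1 - 1 / l)"
      proof -
        have "real p > 0" using pc l0 by linarith
        hence "1 / l \<le> l ^ g i / real p" using pc l by (simp add: field_simps)
        thus ?thesis by simp
      qed
      also have "1 / (x / l ^ g i) \<le> 1 / M"
      proof -
        have "l ^ g i \<le> L" using L[OF i(1)] l l0 by (smt (verit) power_Suc mult_le_cancel_right1)
        hence "l ^ g i * M \<le> x" using elim(2) M(2) by (smt (verit) mult_right_mono)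
        thus ?thesis using x M(2) by (simp add: field_simps)
      qed
      finally have "norm (mean_upto b' (x / real p) - mean_upto b' (x / l ^ g (ix p))) \<le> 2 * (1 - 1 / l) + 1 / M"
        by (simp add: ix[OF i] norm_minus_commute)
      thus "norm (of_real (c p / real p / M) * (mean_upto b' (x / real p) - mean_upto b' (x / l ^ g (ix p))))
        \<le> c p / real p / M * (2 * (1 - 1 / l) + 1 / M)"
        unfolding norm_mult norm_of_real using c01[OF p] M(2) by (intro mult_mono) auto
    qed
    also have "\<dots> = 2 * (1 - 1 / l) + 1 / M"
      using M(2) by (simp only: sum_distrib_right[symmetric] sum_divide_distrib[symmetric] M'[symmetric]) simp
    finally have "norm (A - B) \<le> 2 * (1 - 1 / l) + 1 / M" .
    moreover have "norm (mean_upto b x - B) \<le> norm (mean_upto b x - A) + norm (A - B)"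
      using norm_triangle_ineq[of "mean_upto b x - A" "A - B"] by simp
    ultimately have "norm (mean_upto b x - B) \<le> sqrt (2 / M) + 6 / M + (2 * (1 - 1 / l) + 1 / M)"
      using tk unfolding A_def[symmetric] by linarith
    thus ?case unfolding B_def[symmetric] by (simp add: algebra_simps add_divide_distrib[symmetric])
  qed
qed

end

text \<open>For given \<tau>, a large \<open>r\<close> brings \<open>l = exp (\<eta>' / r)\<close>
  close to 1, and divergence of the series of minima then allows a finite set of cells with
  \<open>M\<close> as large as desired. Neither choice affects \<eta>', which is fixed
  first.\<close>

lemma good_cells:
  assumes "\<eta> > 0"
  shows "\<exists>\<eta>'>0. \<forall>\<tau>>0. \<exists>l d I. l > 1 \<and> finite I \<and> exp \<eta>' \<le> l ^ d \<and> l ^ d \<le> exp \<eta> \<and>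
     (let M = (\<Sum>i\<in>I. min (prime_mass l i) (prime_mass l (i + d)))
      in M > 0 \<and> sqrt (2 / M) + 7 / M + 2 * (1 - 1 / l) \<le> \<tau>)"
proof -
  obtain \<eta>' where eta': "\<eta>' > 0"
    "\<forall>r\<ge>1. \<exists>d\<ge>r. exp (\<eta>' / real r) ^ d \<le> exp \<eta> \<and>
    \<not> summable (\<lambda>i. min (prime_mass (exp (\<eta>' / real r)) i) (prime_mass (exp (\<eta>' / real r)) (i + d)))"
    using prime_pairs_with_constant_ratio[OF assms] by blast
  show ?thesis
  proof (rule exI[of _ \<eta>'], intro conjI eta'(1) allI impI)
    fix \<tau> :: real assume tau: "\<tau> > 0"
    obtain r :: nat where r: "4 * \<eta>' / \<tau> < real r" using reals_Archimedean2 by blast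
    have r1: "r \<ge> 1" using r eta'(1) tau by (cases r) (auto simp: field_simps)
    define l where "l = exp (\<eta>' / real r)"
    obtain d where d: "d \<ge> r" "l ^ d \<le> exp \<eta>"
      "\<not> summable (\<lambda>i. min (prime_mass l i) (prime_mass l (i + d)))"
      using eta'(2)[rule_format, OF r1] unfolding l_def[symmetric] by blast
    have l: "l > 1" using eta'(1) r1 by (simp add: l_def)
    have lim: "((\<lambda>M::real. sqrt (2 / M) + 7 / M) \<longlongrightarrow> 0) at_top" by real_asymp
    have "eventually (\<lambda>M::real. sqrt (2 / M) + 7 / M < \<tau> / 2) at_top"
      using order_tendstoD(2)[OF lim, of "\<tau> / 2"] tau by simp
    then obtain M0 where M0: "\<And>M. M \<ge> M0 \<Longrightarrow> sqrt (2 / M) + 7 / M < \<tau> / 2"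
      by (auto simp: eventually_at_top_linorder)
    have "\<exists>n. (\<Sum>i<n. min (prime_mass l i) (prime_mass l (i + d))) > max M0 0"
    proof (rule ccontr)
      assume "\<not> ?thesis"
      hence "(\<Sum>i<n. min (prime_mass l i) (prime_mass l (i + d))) \<le> max M0 0" for n
        by (meson not_less)
      hence "summable (\<lambda>i. min (prime_mass l i) (prime_mass l (i + d)))"
        by (intro summableI_nonneg_bounded[of _ "max M0 0"]) (auto simp: prime_mass_nonneg)
      thus False using d by blast
    qed
    then obtain n where n: "(\<Sum>i<n. min (prime_mass l i) (prime_mass l (i + d))) > max M0 0" by blast
    define M where "M = (\<Sum>i<n. min (prime_mass l i) (prime_mass l (i + d)))"
    have "exp \<eta>' = l ^ r" using r1 by (simp add: l_def exp_of_nat_mult[symmetric])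
    also have "\<dots> \<le> l ^ d" using l d by (intro power_increasing) auto
    finally have "exp \<eta>' \<le> l ^ d" .
    moreover have "2 * (1 - 1 / l) \<le> \<tau> / 2"
    proof -
      have "1 - 1 / l = 1 - exp (- (\<eta>' / real r))" by (simp add: l_def exp_minus field_simps)
      also have "\<dots> \<le> \<eta>' / real r" using exp_ge_add_one_self[of "- (\<eta>' / real r)"] by simp
      also have "\<dots> \<le> \<tau> / 4" using r r1 tau by (simp add: field_simps)
      finally show ?thesis by simp
    qed
    moreover have "sqrt (2 / M) + 7 / M < \<tau> / 2" using n by (intro M0) (simp add: M_def)
    ultimately show "\<exists>l d I. l > 1 \<and> finite I \<and> exp \<eta>' \<le> l ^ d \<and> l ^ d \<le> exp \<eta> \<and>
     (let M = (\<Sum>i\<in>I. min (prime_mass l i) (prime_mass l (i + d)))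
      in M > 0 \<and> sqrt (2 / M) + 7 / M + 2 * (1 - 1 / l) \<le> \<tau>)"
      using n l d unfolding Let_def
      by (intro exI[of _ l] exI[of _ d] exI[of _ "{..<n}"]) (auto simp: M_def)
  qed
qed

section \<open>Slow variation of the means\<close>

context prime_shift
begin

text \<open>Being minima, the same weights are admissible for the cells \<open>i\<close> and for the
  cells \<open>i + d\<close>. The second average at \<open>l ^ d * x\<close> has the terms at
  \<open>l ^ d * x / l ^ (i + d) = x / l ^ i\<close>, so it coincides with the first average at
  \<open>x\<close>. Both means are thus within \<tau> of the same number.\<close>

lemma mean_upto_almost_periodic:
  assumes l: "l > 1" and I: "finite I"
    and M: "M = (\<Sum>i\<in>I. min (prime_mass l i) (prime_mass l (i + d)))" "M > 0"
    and tau: "sqrt (2 / M) + 7 / M + 2 * (1 - 1 / l) \<le> \<tau>"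
  shows "eventually (\<lambda>x. norm (mean_upto b (l ^ d * x) - mean_upto b x) \<le> 2 * \<tau>) at_top"
proof -
  define m where "m = (\<lambda>i. min (prime_mass l i) (prime_mass l (i + d)))"
  have m: "0 \<le> m i" "m i \<le> prime_mass l i" "m i \<le> prime_mass l (i + d)" for i
    by (auto simp: m_def prime_mass_nonneg)
  have M': "M = sum m I" by (simp add: M(1) m_def)
  have 1: "eventually (\<lambda>x. norm (mean_upto b x - (\<Sum>i\<in>I. of_real (m i / M) * mean_upto b' (x / l ^ i)))
           \<le> sqrt (2 / M) + 7 / M + 2 * (1 - 1 / l)) at_top"
    by (rule turan_kubilius_cells[OF l I _ _ _ M' M(2)]) (use m in auto)
  have 2: "eventually (\<lambda>x. norm (mean_upto b x - (\<Sum>i\<in>I. of_real (m i / M) * mean_upto b' (x / l ^ (i + d))))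
           \<le> sqrt (2 / M) + 7 / M + 2 * (1 - 1 / l)) at_top"
    by (rule turan_kubilius_cells[OF l I _ _ _ M' M(2)]) (use m in auto)
  have lim: "filterlim (\<lambda>x. l ^ d * x) at_top at_top"
    using l by (intro filterlim_tendsto_pos_mult_at_top[OF tendsto_const _ filterlim_ident]) auto
  show ?thesis using 1 eventually_compose_filterlim[OF 2 lim]
  proof eventually_elim
    case (elim x)
    define A where "A = (\<Sum>i\<in>I. of_real (m i / M) * mean_upto b' (x / l ^ i))"
    have "(\<Sum>i\<in>I. of_real (m i / M) * mean_upto b' (l ^ d * x / l ^ (i + d))) = A"
      using l by (simp add: A_def power_add)
    hence "norm (mean_upto b x - A) \<le> \<tau>" "norm (mean_upto b (l ^ d * x) - A) \<le> \<tau>"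
      using elim tau unfolding A_def by auto
    moreover have "norm (mean_upto b (l ^ d * x) - mean_upto b x) \<le>
        norm (mean_upto b (l ^ d * x) - A) + norm (mean_upto b x - A)"
      by (metis dist_norm dist_triangle2)
    ultimately show ?case by linarith
  qed
qed

text \<open>A point \<open>y\<close> of \<open>[x, K * x]\<close> is reached by at most
  \<open>k\<close> multiplications by \<open>\<rho> = l ^ d\<close>, each costing
  \<open>2 * \<tau>\<close>. What remains is a factor below \<open>\<rho> \<le> exp \<eta>\<close>,
  to which the Lipschitz bound applies.\<close>

lemma mean_upto_slowly_varying:
  assumes eps: "\<epsilon> > 0" and K: "K \<ge> 1"
  shows "eventually (\<lambda>x. \<forall>y\<in>{x..K * x}. norm (mean_upto b y - mean_upto b x) \<le> \<epsilon>) at_top"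
proof -
  define \<eta> where "\<eta> = \<epsilon> / 8"
  have eta: "\<eta> > 0" using eps by (simp add: \<eta>_def)
  obtain \<eta>' where eta': "\<eta>' > 0" "\<forall>\<tau>>0. \<exists>l d I. l > 1 \<and> finite I \<and> exp \<eta>' \<le> l ^ d \<and> l ^ d \<le> exp \<eta> \<and>
     (let M = (\<Sum>i\<in>I. min (prime_mass l i) (prime_mass l (i + d)))
      in M > 0 \<and> sqrt (2 / M) + 7 / M + 2 * (1 - 1 / l) \<le> \<tau>)"
    using good_cells[OF eta] by blast
  define k where "k = nat \<lceil>ln K / \<eta>'\<rceil>"
  \<comment> \<open>Possible only because \<open>k\<close> depends on \<open>K\<close> and \<eta>'
    alone. The steps then cost at most \<open>\<epsilon> / 2\<close>, the Lipschitz bound at most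
    \<open>2 * \<eta> + \<epsilon> / 8 = 3 * \<epsilon> / 8\<close>.\<close>
  define \<tau> where "\<tau> = \<epsilon> / (4 * (real k + 1))"
  have tau: "\<tau> > 0" using eps by (simp add: \<tau>_def)
  obtain l d I where lI: "l > 1" "finite I" "exp \<eta>' \<le> l ^ d" "l ^ d \<le> exp \<eta>"
    and "let M = (\<Sum>i\<in>I. min (prime_mass l i) (prime_mass l (i + d)))
      in M > 0 \<and> sqrt (2 / M) + 7 / M + 2 * (1 - 1 / l) \<le> \<tau>"
    using eta'(2)[rule_format, OF tau] by blast
  hence "eventually (\<lambda>x. norm (mean_upto b (l ^ d * x) - mean_upto b x) \<le> 2 * \<tau>) at_top"
    unfolding Let_def by (intro mean_upto_almost_periodic[of l I]) auto
  then obtain x0 where x0: "\<And>x. x \<ge> x0 \<Longrightarrow> norm (mean_upto b (l ^ d * x) - mean_upto b x) \<le> 2 * \<tau>"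
    by (auto simp: eventually_at_top_linorder)
  define \<rho> where "\<rho> = l ^ d"
  have rho: "\<rho> > 1" using lI(3) eta'(1) by (smt (verit) \<rho>_def one_less_exp_iff)
  have step: "norm (mean_upto b (\<rho> ^ i * x) - mean_upto b x) \<le> real i * (2 * \<tau>)" if x: "x \<ge> max x0 1" for i x
  proof (induction i)
    case (Suc i)
    have "1 * x \<le> \<rho> ^ i * x" using rho x by (intro mult_right_mono) auto
    hence "x0 \<le> \<rho> ^ i * x" using x by linarith
    from x0[OF this] have "norm (mean_upto b (\<rho> * (\<rho> ^ i * x)) - mean_upto b (\<rho> ^ i * x)) \<le> 2 * \<tau>"
      unfolding \<rho>_def .
    moreover have "norm (mean_upto b (\<rho> ^ Suc i * x) - mean_upto b x) \<le>
       norm (mean_upto b (\<rho> * (\<rho> ^ i * x)) - mean_upto b (\<rho> ^ i * x)) + norm (mean_upto b (\<rho> ^ i * x) - mean_upto b x)"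
      using norm_triangle_ineq[of "mean_upto b (\<rho> * (\<rho> ^ i * x)) - mean_upto b (\<rho> ^ i * x)"
          "mean_upto b (\<rho> ^ i * x) - mean_upto b x"] by (simp add: mult.assoc)
    ultimately show ?case using Suc by (simp add: algebra_simps)
  qed auto
  show ?thesis
    using eventually_ge_at_top[of "max x0 1"] eventually_ge_at_top[of "8 / \<epsilon>"]
  proof eventually_elim
    case (elim x)
    show ?case
    proof
      fix y assume y: "y \<in> {x..K * x}"
      have x: "x > 0" using elim(1) by simp
      define i where "i = nat \<lfloor>ln (y / x) / ln \<rho>\<rfloor>"
      have lnr: "ln \<rho> > 0" "ln \<rho> \<ge> \<eta>'" "ln \<rho> \<le> \<eta>"
        using rho lI(3,4) by (auto simp: \<rho>_def ln_ge_iff) (metis \<rho>_def exp_gt_zero ln_exp ln_le_cancel_iff rho zero_less_one order.strict_trans)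
      have yx: "ln (y / x) \<ge> 0" using y x by simp
      have i: "real i \<le> ln (y / x) / ln \<rho>" "ln (y / x) / ln \<rho> < real i + 1"
        using yx lnr by (auto simp: i_def of_nat_nat)
      have "ln (y / x) \<le> ln K" using y x K by (subst ln_le_cancel_iff) (auto simp: field_simps)
      hence "real i \<le> ln K / \<eta>'"
        using i(1) lnr eta'(1) yx by (smt (verit) frac_le)
      hence "i \<le> k" unfolding k_def by linarith
      have "ln (\<rho> ^ i) \<le> ln (y / x)" using i(1) lnr rho by (simp add: ln_realpow field_simps)
      hence lo: "\<rho> ^ i * x \<le> y" using rho x y by (subst (asm) ln_le_cancel_iff) (auto simp: field_simps)
      have "ln (y / x) < ln (\<rho> ^ Suc i)" using i(2) lnr rho by (simp add: ln_realpow field_simps del: power_Suc)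
      hence hi: "y < \<rho> * (\<rho> ^ i * x)" using rho x y by (subst (asm) ln_less_cancel_iff) (auto simp: field_simps)
      have z: "0 < \<rho> ^ i * x" using rho x by simp
      have "norm (mean_upto b y - mean_upto b (\<rho> ^ i * x)) \<le> 2 * (1 - (\<rho> ^ i * x) / y) + 1 / y"
        by (rule mean_upto_lipschitz[OF norm_b z lo])
      also have "1 - (\<rho> ^ i * x) / y \<le> \<eta>"
      proof -
        have "1 / \<rho> \<le> (\<rho> ^ i * x) / y" using hi z lo rho by (simp add: field_simps)
        moreover have "1 - 1 / \<rho> \<le> ln \<rho>" using ln_le_minus_one[of "1 / \<rho>"] rho by (simp add: ln_div)
        ultimately show ?thesis using lnr by linarith
      qed
      also have "1 / y \<le> \<epsilon> / 8" using elim(2) y eps x by (simp add: field_simps) (smt (verit) mult_left_mono)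
      finally have 1: "norm (mean_upto b y - mean_upto b (\<rho> ^ i * x)) \<le> 2 * \<eta> + \<epsilon> / 8" by simp
      have "norm (mean_upto b (\<rho> ^ i * x) - mean_upto b x) \<le> real i * (2 * \<tau>)" by (rule step[OF elim(1)])
      also have "\<dots> \<le> (real k + 1) * (2 * \<tau>)" using \<open>i \<le> k\<close> tau by (intro mult_right_mono) auto
      also have "\<dots> = \<epsilon> / 2" by (simp add: \<tau>_def field_simps)
      finally have 2: "norm (mean_upto b (\<rho> ^ i * x) - mean_upto b x) \<le> \<epsilon> / 2" .
      have "norm (mean_upto b y - mean_upto b x) \<le>
        norm (mean_upto b y - mean_upto b (\<rho> ^ i * x)) + norm (mean_upto b (\<rho> ^ i * x) - mean_upto b x)"
        using norm_triangle_ineq[of "mean_upto b y - mean_upto b (\<rho> ^ i * x)"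
          "mean_upto b (\<rho> ^ i * x) - mean_upto b x"] by simp
      thus "norm (mean_upto b y - mean_upto b x) \<le> \<epsilon>" using 1 2 eps by (simp add: \<eta>_def)
    qed
  qed
qed

end

text \<open>\<open>turan_kubilius_cells\<close> approximates the mean of \<open>b\<close> by a
  convex combination of means of \<open>b'\<close> at the finitely many points
  \<open>x / l ^ i\<close>. By the second hypothesis the means of \<open>b'\<close> vary slowly, so
  each of these may be replaced by the mean at \<open>x\<close>.\<close>

theorem mean_upto_shift_invariant:
  assumes "prime_shift b b'" "prime_shift b' b''"
  shows "((\<lambda>x. mean_upto b x - mean_upto b' x) \<longlongrightarrow> 0) at_top"
proof (rule tendstoI)
  fix \<epsilon> :: real assume eps: "\<epsilon> > 0"
  interpret b: prime_shift b b' by fact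
  interpret b': prime_shift b' b'' by fact
  have e3: "\<epsilon> / 3 > 0" using eps by simp
  \<comment> \<open>Any positive value would serve in place of 1: what matters here is a large
    \<open>M\<close> with \<open>l\<close> near 1.\<close>
  obtain \<eta>' where eta': "\<eta>' > 0" "\<forall>\<tau>>0. \<exists>l d I. l > 1 \<and> finite I \<and> exp \<eta>' \<le> l ^ d \<and> l ^ d \<le> exp 1 \<and>
     (let M = (\<Sum>i\<in>I. min (prime_mass l i) (prime_mass l (i + d)))
      in M > 0 \<and> sqrt (2 / M) + 7 / M + 2 * (1 - 1 / l) \<le> \<tau>)"
    using good_cells[OF zero_less_one] by blast
  obtain l d I where lI: "l > 1" "finite I" 
    and "let M = (\<Sum>i\<in>I. min (prime_mass l i) (prime_mass l (i + d)))
      in M > 0 \<and> sqrt (2 / M) + 7 / M + 2 * (1 - 1 / l) \<le> \<epsilon> / 3"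
    using eta'(2)[rule_format, OF e3] by blast
  define m where "m = (\<lambda>i. min (prime_mass l i) (prime_mass l (i + d)))"
  define M where "M = sum m I"
  have M: "M > 0" "sqrt (2 / M) + 7 / M + 2 * (1 - 1 / l) \<le> \<epsilon> / 3"
    using \<open>let M = _ in _\<close> by (simp_all add: Let_def M_def m_def)
  have m0: "0 \<le> m i" for i by (auto simp: m_def prime_mass_nonneg)
  have 1: "eventually (\<lambda>x. norm (mean_upto b x - (\<Sum>i\<in>I. of_real (m i / M) * mean_upto b' (x / l ^ i)))
           \<le> sqrt (2 / M) + 7 / M + 2 * (1 - 1 / l)) at_top"
    by (rule b.turan_kubilius_cells[OF lI _ _ _ M_def M(1)]) (auto simp: m_def prime_mass_nonneg)
  define K where "K = 1 + (\<Sum>i\<in>I. l ^ i)"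
  have K: "K \<ge> 1" "\<And>i. i \<in> I \<Longrightarrow> l ^ i \<le> K" 
  proof -
    show "K \<ge> 1" unfolding K_def using lI by (auto intro!: sum_nonneg)
    show "l ^ i \<le> K" if "i \<in> I" for i
      using member_le_sum[of i I "\<lambda>i. l ^ i"] that lI by (simp add: K_def)
  qed
  have "eventually (\<lambda>x. \<forall>y\<in>{x..K * x}. norm (mean_upto b' y - mean_upto b' x) \<le> \<epsilon> / 3) at_top"
    by (rule b'.mean_upto_slowly_varying[OF e3 K(1)])
  then obtain x0 where x0: "\<forall>x\<ge>x0. \<forall>y\<in>{x..K * x}. norm (mean_upto b' y - mean_upto b' x) \<le> \<epsilon> / 3"
    unfolding eventually_at_top_linorder by blast
  show "eventually (\<lambda>x. dist (mean_upto b x - mean_upto b' x) 0 < \<epsilon>) at_top"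
    using 1 eventually_ge_at_top[of "K * max x0 1"]
  proof eventually_elim
    case (elim x)
    define A where "A = (\<Sum>i\<in>I. of_real (m i / M) * mean_upto b' (x / l ^ i))"
    have "mean_upto b' x = (\<Sum>i\<in>I. of_real (m i / M) * mean_upto b' x)"
      using M(1) by (simp only: sum_distrib_right[symmetric] of_real_sum[symmetric]
          sum_divide_distrib[symmetric] M_def[symmetric]) simp
    hence "norm (A - mean_upto b' x) =
        norm (\<Sum>i\<in>I. of_real (m i / M) * (mean_upto b' (x / l ^ i) - mean_upto b' x))"
      by (simp only: A_def right_diff_distrib sum_subtractf)
    also have "\<dots> \<le> (\<Sum>i\<in>I. norm (of_real (m i / M) * (mean_upto b' (x / l ^ i) - mean_upto b' x)))"
      by (rule norm_sum)
    also have "\<dots> \<le> (\<Sum>i\<in>I. m i / M * (\<epsilon> / 3))"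
    proof (intro sum_mono)
      fix i assume i: "i \<in> I"
      have li: "1 \<le> l ^ i" "l ^ i \<le> K" using K(2)[OF i] lI by auto
      have "K * 1 \<le> K * max x0 1" using K by (intro mult_left_mono) auto
      hence x: "x > 0" using elim(2) K by linarith
      have "K * x0 \<le> K * max x0 1" using K by (intro mult_left_mono) auto
      hence "x0 * K \<le> x" using elim(2) by (simp only: mult.commute)
      hence "x0 \<le> x / K" using K by (subst pos_le_divide_eq) auto
      also have "\<dots> \<le> x / l ^ i" using li x K by (intro divide_left_mono) auto
      finally have "x0 \<le> x / l ^ i" .
      moreover have "x \<in> {x / l ^ i..K * (x / l ^ i)}" using li x by (auto simp: field_simps)
      ultimately have "norm (mean_upto b' (x / l ^ i) - mean_upto b' x) \<le> \<epsilon> / 3"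
        using x0 by (subst norm_minus_commute) blast
      thus "norm (of_real (m i / M) * (mean_upto b' (x / l ^ i) - mean_upto b' x)) \<le> m i / M * (\<epsilon> / 3)"
        unfolding norm_mult norm_of_real using m0[of i] M(1) by (intro mult_mono) auto
    qed
    also have "\<dots> = \<epsilon> / 3"
      using M(1) by (simp only: sum_distrib_right[symmetric] sum_divide_distrib[symmetric] M_def[symmetric]) simp
    finally have "norm (A - mean_upto b' x) \<le> \<epsilon> / 3" .
    moreover have "norm (mean_upto b x - A) \<le> \<epsilon> / 3" using elim(1) M(2) unfolding A_def by linarith
    moreover have "norm (mean_upto b x - mean_upto b' x) \<le> norm (mean_upto b x - A) + norm (A - mean_upto b' x)"
      using norm_triangle_ineq[of "mean_upto b x - A" "A - mean_upto b' x"] by simp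
    ultimately have "norm (mean_upto b x - mean_upto b' x) \<le> 2 * \<epsilon> / 3" by linarith
    also have "\<dots> < \<epsilon>" using eps by simp
    finally show ?case by simp
  qed
qed

section \<open>Uniform averages in uniquely ergodic systems\<close>

text \<open>At the first differing digit \<open>k0\<close> the codes differ by
  \<open>2 / 3 ^ (k0 + 1)\<close>, and all later digits together can undo only half of that. This is
  the gap structure of the Cantor set.\<close>

lemma ternary_code_agree:
  fixes s t :: "nat \<Rightarrow> real"
  assumes "\<And>k. s k \<in> {0, 2}" "\<And>k. t k \<in> {0, 2}"
    and close: "\<bar>(\<Sum>k. s k / 3 ^ Suc k) - (\<Sum>k. t k / 3 ^ Suc k)\<bar> < 1 / 3 ^ K" and "k < K"
  shows "s k = t k"
proof (rule ccontr)
  assume "s k \<noteq> t k"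
  define k0 where "k0 = (LEAST k. s k \<noteq> t k)"
  have k0: "s k0 \<noteq> t k0" "k0 \<le> k"
    unfolding k0_def
    using LeastI[of "\<lambda>k. s k \<noteq> t k", OF \<open>s k \<noteq> t k\<close>] Least_le[of "\<lambda>k. s k \<noteq> t k", OF \<open>s k \<noteq> t k\<close>]
    by blast+
  have below: "s j = t j" if "j < k0" for j
    using not_less_Least[of j "\<lambda>k. s k \<noteq> t k"] that unfolding k0_def by blast
  have geo: "summable (\<lambda>k. 2 / 3 ^ Suc k :: real)"
    using summable_mult[OF summable_geometric[of "1/3::real"], of "2/3"]
    by (simp add: power_divide mult.commute)
  have sm: "summable (\<lambda>k. u k / 3 ^ Suc k)" if "\<And>k. u k \<in> {0, 2}" for u :: "nat \<Rightarrow> real"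
  proof (intro summable_comparison_test[OF _ geo] exI[of _ 0] allI impI)
    show "norm (u n / 3 ^ Suc n) \<le> 2 / 3 ^ Suc n" for n using that[of n] by auto
  qed
  define g where "g = (\<lambda>k. (s k - t k) / 3 ^ Suc k)"
  have g: "summable g" "suminf g = (\<Sum>k. s k / 3 ^ Suc k) - (\<Sum>k. t k / 3 ^ Suc k)"
    using sm[of s] sm[of t] assms(1,2) unfolding g_def diff_divide_distrib
    by (auto intro: summable_diff simp: suminf_diff)
  have "suminf g = (\<Sum>n. g (n + Suc k0)) + (\<Sum>i<Suc k0. g i)"
    by (rule suminf_split_initial_segment[OF g(1)])
  moreover have "(\<Sum>i<Suc k0. g i) = g k0" using below by (simp add: g_def)
  moreover have "\<bar>g k0\<bar> = 2 / 3 ^ Suc k0" using k0(1) assms(1)[of k0] assms(2)[of k0] by (auto simp: g_def)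
  moreover have "\<bar>\<Sum>n. g (n + Suc k0)\<bar> \<le> 1 / 3 ^ Suc k0"
  proof -
    have tail: "(\<lambda>n. 2 / 3 ^ Suc (n + Suc k0) :: real) sums (1 / 3 ^ Suc k0)"
      using sums_mult[OF geometric_sums[of "1/3::real"], of "2 / 3 / 3 ^ Suc k0"]
      by (simp add: power_divide power_add field_simps)
    have *: "norm (g (n + Suc k0)) \<le> 2 / 3 ^ Suc (n + Suc k0)" for n
      using assms(1)[of "n + Suc k0"] assms(2)[of "n + Suc k0"] by (auto simp: g_def)
    have "norm (\<Sum>n. g (n + Suc k0)) \<le> (\<Sum>n. 2 / 3 ^ Suc (n + Suc k0))"
      using * tail by (intro norm_suminf_le) (auto simp: sums_iff)
    thus ?thesis using tail by (simp add: sums_iff)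
  qed
  moreover have "1 / 3 ^ K \<le> (1 / 3 ^ Suc k0 :: real)"
    using \<open>k < K\<close> k0(2) by (intro divide_left_mono power_increasing) auto
  ultimately show False using close unfolding g(2)[symmetric] by (simp add: abs_if split: if_splits)
qed

text \<open>
  A compact metric space is coded by a subset of the Cantor set, a point \<open>x\<close> being sent to the
  ternary number that records which members of a countable family of small balls contain \<open>x\<close>.
  The decoding map is uniformly continuous, hence extends to the closure of the set of codes.
\<close>

lemma compact_ternary_coding:
  fixes X :: "'x::metric_space set"
  assumes X: "compact X" "X \<noteq> {}"
  obtains \<psi> :: "'x \<Rightarrow> real" and \<pi> :: "real \<Rightarrow> 'x"
  where "\<psi> \<in> borel_measurable borel" "\<And>x. 0 \<le> \<psi> x" "\<And>x. \<psi> x \<le> 1"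
    "continuous_on (closure (\<psi> ` X)) \<pi>" "\<pi> ` closure (\<psi> ` X) \<subseteq> X" "\<And>x. x \<in> X \<Longrightarrow> \<pi> (\<psi> x) = x"
proof -
  have "\<exists>F. finite F \<and> F \<subseteq> X \<and> X \<subseteq> (\<Union>c\<in>F. ball c (1 / real (Suc n)))" for n
  proof -
    have "X \<subseteq> (\<Union>c\<in>X. ball c (1 / real (Suc n)))" by force
    then obtain F where "F \<subseteq> X" "finite F" "X \<subseteq> (\<Union>c\<in>F. ball c (1 / real (Suc n)))"
      using compactE_image[OF X(1), of X "\<lambda>c. ball c (1 / real (Suc n))"] by auto
    thus ?thesis by blast
  qed
  then obtain F where F: "\<And>n. finite (F n)" "\<And>n. X \<subseteq> (\<Union>c\<in>F n. ball c (1 / real (Suc n)))" by metis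
  define S where "S = (\<Union>n. (\<lambda>c. ball c (1 / real (Suc n))) ` F n)"
  have S: "countable S" "S \<noteq> {}"
  proof -
    show "countable S" unfolding S_def by (intro countable_UN) (auto intro!: countable_finite F(1))
    obtain x where "x \<in> X" using X(2) by blast
    then obtain c where "c \<in> F 0" using F(2)[of 0] by blast
    thus "S \<noteq> {}" by (auto simp: S_def)
  qed
  define U where "U = from_nat_into S"
  have U: "open (U k)" for k using from_nat_into[OF S(2), of k] by (auto simp: U_def S_def)
  define s where "s = (\<lambda>x k. if x \<in> U k then 2 else 0 :: real)"
  define \<psi> where "\<psi> = (\<lambda>x. \<Sum>k. s x k / 3 ^ Suc k)"
  have s: "s x k \<in> {0, 2}" for x k by (simp add: s_def)
  have geo: "(\<lambda>k. 2 / 3 ^ Suc k :: real) sums 1"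
    using sums_mult[OF geometric_sums[of "1/3::real"], of "2/3"]
    by (simp add: power_divide mult.commute)
  have sm: "summable (\<lambda>k. s x k / 3 ^ Suc k)" for x
    using geo by (intro summable_comparison_test[OF _ sums_summable[OF geo]]) (auto simp: s_def intro!: exI[of _ 0])
  \<comment> \<open>Uniform continuity of the inverse of \<psi>: sufficiently close codes agree in
    the digits of all balls of radius \<open>1 / (n + 1)\<close>, and one of these balls contains
    \<open>x\<close>, hence also \<open>y\<close>.\<close>
  have fine: "\<exists>\<delta>>0. \<forall>x\<in>X. \<forall>y\<in>X. \<bar>\<psi> x - \<psi> y\<bar> < \<delta> \<longrightarrow> dist x y < \<epsilon>" if eps: "\<epsilon> > 0" for \<epsilon>
  proof -
    obtain n where n: "2 / \<epsilon> < real n" using reals_Archimedean2 by blast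
    have n2: "2 / real (Suc n) < \<epsilon>" using n eps by (simp add: field_simps)
    define J where "J = (\<lambda>c. to_nat_on S (ball c (1 / real (Suc n)))) ` F n"
    define K where "K = Suc (Max (insert 0 J))"
    have "dist x y < \<epsilon>" if xy: "x \<in> X" "y \<in> X" "\<bar>\<psi> x - \<psi> y\<bar> < 1 / 3 ^ K" for x y
    proof -
      obtain c where c: "c \<in> F n" "x \<in> ball c (1 / real (Suc n))" using F(2) xy(1) by blast
      define k where "k = to_nat_on S (ball c (1 / real (Suc n)))"
      have "k \<le> Max (insert 0 J)" using F(1) c(1) by (intro Max_ge) (auto simp: J_def k_def)
      hence "k < K" by (simp add: K_def)
      hence "s x k = s y k" using ternary_code_agree[of "s x" "s y" K k] s xy(3) by (simp add: \<psi>_def)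
      moreover have "U k = ball c (1 / real (Suc n))"
        unfolding U_def k_def using S c(1) by (intro from_nat_into_to_nat_on) (auto simp: S_def)
      ultimately have "y \<in> ball c (1 / real (Suc n))" using c(2) by (auto simp: s_def split: if_splits)
      hence "dist x y < 1 / real (Suc n) + 1 / real (Suc n)"
        using c(2) dist_triangle2[of x y c] by (simp add: dist_commute)
      thus ?thesis using n2 by simp
    qed
    thus ?thesis by (intro exI[of _ "1 / 3 ^ K"]) auto
  qed
  define C where "C = closure (\<psi> ` X)"
  \<comment> \<open>The value of \<pi> at a limit \<open>c\<close> of codes is a limit point of the
    coded points. The moduli are quantified inside so that one value serves for every
    \<epsilon>.\<close>
  have "\<exists>x\<in>X. \<forall>\<epsilon> \<delta>. \<delta> > 0 \<longrightarrow> (\<forall>x\<in>X. \<forall>y\<in>X. \<bar>\<psi> x - \<psi> y\<bar> < \<delta> \<longrightarrow> dist x y < \<epsilon>) \<longrightarrow>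
      (\<forall>y\<in>X. \<bar>\<psi> y - c\<bar> < \<delta> / 2 \<longrightarrow> dist y x \<le> \<epsilon>)" if c: "c \<in> C" for c
  proof -
    obtain w where w: "\<forall>n. w n \<in> \<psi> ` X" "w \<longlonglongrightarrow> c"
      using c unfolding C_def closure_sequential by blast
    hence "\<forall>n. \<exists>z. z \<in> X \<and> w n = \<psi> z" by blast
    then obtain z where "\<forall>n. z n \<in> X \<and> w n = \<psi> (z n)" by (rule choice[THEN exE])
    hence z: "z n \<in> X" "w n = \<psi> (z n)" for n by blast+
    obtain l r where l: "l \<in> X" "strict_mono r" "(z \<circ> r) \<longlonglongrightarrow> l"
      using X(1) z(1) unfolding compact_eq_seq_compact_metric seq_compact_def by blast
    show ?thesis
    proof (intro bexI[OF _ l(1)] allI impI ballI)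
      fix \<epsilon> \<delta> y assume d: "\<delta> > 0" "\<forall>x\<in>X. \<forall>y\<in>X. \<bar>\<psi> x - \<psi> y\<bar> < \<delta> \<longrightarrow> dist x y < \<epsilon>"
        and y: "y \<in> X" "\<bar>\<psi> y - c\<bar> < \<delta> / 2"
      have "(w \<circ> r) \<longlonglongrightarrow> c" using w(2) l(2) by (rule LIMSEQ_subseq_LIMSEQ)
      from tendstoD[OF this, of "\<delta> / 2"]
      have "eventually (\<lambda>n. dist ((w \<circ> r) n) c < \<delta> / 2) sequentially" using d(1) by simp
      hence ev: "eventually (\<lambda>n. dist y ((z \<circ> r) n) \<le> \<epsilon>) sequentially"
      proof eventually_elim
        case (elim n)
        hence "\<bar>\<psi> y - \<psi> (z (r n))\<bar> < \<delta>" using y(2) by (simp add: z(2) dist_real_def abs_if split: if_splits)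
        thus ?case using d(2) y(1) z(1) by (simp add: less_imp_le)
      qed
      have "(\<lambda>n. dist y ((z \<circ> r) n)) \<longlonglongrightarrow> dist y l" by (intro tendsto_intros l(3))
      thus "dist y l \<le> \<epsilon>" by (rule tendsto_upperbound[OF _ ev]) auto
    qed
  qed
  then obtain \<pi> where \<pi>: "\<And>c. c \<in> C \<Longrightarrow> \<pi> c \<in> X"
    "\<And>c \<epsilon> \<delta> y. c \<in> C \<Longrightarrow> \<delta> > 0 \<Longrightarrow> \<forall>x\<in>X. \<forall>y\<in>X. \<bar>\<psi> x - \<psi> y\<bar> < \<delta> \<longrightarrow> dist x y < \<epsilon> \<Longrightarrow>
      y \<in> X \<Longrightarrow> \<bar>\<psi> y - c\<bar> < \<delta> / 2 \<Longrightarrow> dist y (\<pi> c) \<le> \<epsilon>" by metis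
  show ?thesis
  proof (rule that)
    show "\<psi> \<in> borel_measurable borel"
    proof -
      have [measurable]: "U k \<in> sets borel" for k using U by simp
      have "(\<lambda>x. s x k) \<in> borel_measurable borel" for k unfolding s_def by measurable
      thus ?thesis unfolding \<psi>_def by (intro borel_measurable_suminf borel_measurable_divide) auto
    qed
    show "0 \<le> \<psi> x" for x
      unfolding \<psi>_def by (intro suminf_nonneg sm) (auto simp: s_def)
    have "\<psi> x \<le> (\<Sum>k. 2 / 3 ^ Suc k)" for x
      unfolding \<psi>_def by (intro suminf_le sm sums_summable[OF geo]) (auto simp: s_def)
    thus "\<psi> x \<le> 1" for x using geo by (simp add: sums_iff)
    show "continuous_on (closure (\<psi> ` X)) \<pi>"
      unfolding C_def[symmetric] continuous_on_iff
    proof (intro ballI allI impI)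
      fix c e assume c: "c \<in> C" and e: "(e::real) > 0"
      then obtain d where d: "d > 0" "\<forall>x\<in>X. \<forall>y\<in>X. \<bar>\<psi> x - \<psi> y\<bar> < d \<longrightarrow> dist x y < e / 3"
        using fine[of "e / 3"] by auto
      show "\<exists>d>0. \<forall>c'\<in>C. dist c' c < d \<longrightarrow> dist (\<pi> c') (\<pi> c) < e"
      proof (intro exI[of _ "d / 4"] conjI ballI impI)
        fix c' assume c': "c' \<in> C" "dist c' c < d / 4"
        obtain y where y: "y \<in> X" "\<bar>\<psi> y - c\<bar> < d / 4"
          using c d(1) unfolding C_def closure_approachable by (auto simp: dist_real_def dest: spec[of _ "d / 4"])
        have "dist y (\<pi> c) \<le> e / 3" using d y c by (intro \<pi>(2)[of c d]) auto
        moreover have "dist y (\<pi> c') \<le> e / 3"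
          using d y c' by (intro \<pi>(2)[of c' d]) (auto simp: dist_real_def abs_if split: if_splits)
        ultimately show "dist (\<pi> c') (\<pi> c) < e" using dist_triangle3[of "\<pi> c'" "\<pi> c" y] e by linarith
      qed (use d in auto)
    qed
    show "\<pi> ` closure (\<psi> ` X) \<subseteq> X" using \<pi>(1) by (auto simp: C_def)
    show "\<pi> (\<psi> x) = x" if x: "x \<in> X" for x
    proof -
      have "\<psi> x \<in> C" unfolding C_def by (rule subsetD[OF closure_subset]) (use x in simp)
      have "dist x (\<pi> (\<psi> x)) \<le> 0 + \<epsilon>" if eps: "\<epsilon> > 0" for \<epsilon>
      proof -
        obtain d where "d > 0" "\<forall>x\<in>X. \<forall>y\<in>X. \<bar>\<psi> x - \<psi> y\<bar> < d \<longrightarrow> dist x y < \<epsilon>"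
          using fine[OF eps] by blast
        thus ?thesis using \<pi>(2)[OF \<open>\<psi> x \<in> C\<close>, of d \<epsilon> x] x by simp
      qed
      hence "dist x (\<pi> (\<psi> x)) \<le> 0" by (rule field_le_epsilon)
      thus ?thesis by simp
    qed
  qed
qed

text \<open>The indicator of a closed set is the limit of the continuous functions
  \<open>max 0 (1 - n * infdist x F)\<close>, so dominated convergence gives equality on closed
  sets, an intersection-stable generator. The images \<open>M'\<close> and \<open>N'\<close> in the
  ambient space allow its own closed sets to be used.\<close>

lemma prob_space_eqI_continuous:
  fixes X :: "'x::metric_space set"
  assumes "prob_space M" "prob_space N"
    and sets_eq: "sets M = sets (restrict_space borel X)" "sets N = sets (restrict_space borel X)"
    and eq: "\<And>u :: 'x \<Rightarrow> real. continuous_on UNIV u \<Longrightarrow> (\<And>x. \<bar>u x\<bar> \<le> 1) \<Longrightarrow>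
      integral\<^sup>L M u = integral\<^sup>L N u"
  shows "M = N"
proof -
  have X: "space M = X" "space N = X"
    using sets_eq_imp_space_eq[OF sets_eq(1)] sets_eq_imp_space_eq[OF sets_eq(2)] by (auto simp: space_restrict_space)
  have meas: "u \<in> borel_measurable M" "u \<in> borel_measurable N"
    if "u \<in> borel_measurable borel" for u :: "'x \<Rightarrow> real"
    using that measurable_cong_sets[OF sets_eq(1) refl] measurable_cong_sets[OF sets_eq(2) refl]
    by (auto intro: measurable_restrict_space1)
  have sub: "B \<inter> X \<in> sets M" "B \<inter> X \<in> sets N" if "B \<in> sets borel" for B
    using that sets_eq by (auto simp: sets_restrict_space)
  interpret M: prob_space M by fact
  interpret N: prob_space N by fact
  have closed: "measure M (F \<inter> X) = measure N (F \<inter> X)" if F: "closed F" for F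
  proof (cases "F = {}")
    case False
    define u where "u = (\<lambda>n x. max 0 (1 - real n * infdist x F))"
    have uc: "continuous_on UNIV (u n)" for n unfolding u_def by (intro continuous_intros)
    have ub: "\<bar>u n x\<bar> \<le> 1" for n x by (auto simp: u_def infdist_nonneg)
    have lim: "(\<lambda>n. u n x) \<longlonglongrightarrow> indicator F x" for x
    proof (cases "x \<in> F")
      case True
      thus ?thesis by (simp add: u_def)
    next
      case n: False
      hence pos: "infdist x F > 0" using F False by (metis in_closed_iff_infdist_zero infdist_nonneg less_eq_real_def)
      obtain k :: nat where k: "1 / infdist x F < real k" using reals_Archimedean2 by blast
      have "eventually (\<lambda>n. u n x = 0) sequentially"
        using eventually_ge_at_top[of k]
      proof eventually_elim
        case (elim n)
        have "1 \<le> real k * infdist x F" using k pos by (simp add: field_simps)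
        also have "\<dots> \<le> real n * infdist x F" using elim pos by (intro mult_right_mono) auto
        finally show ?case by (simp add: u_def)
      qed
      thus ?thesis using n by (simp add: tendsto_eventually)
    qed
    have ubm: "u n \<in> borel_measurable borel" for n using uc by (intro borel_measurable_continuous_onI)
    have fm: "(indicator F :: 'x \<Rightarrow> real) \<in> borel_measurable borel" using F by (simp add: borel_measurable_indicator)
    have "(\<lambda>n. integral\<^sup>L M (u n)) \<longlonglongrightarrow> integral\<^sup>L M (indicator F)"
      by (rule integral_dominated_convergence[where w = "\<lambda>_. 1"])
         (simp_all add: meas(1)[OF fm] meas(1)[OF ubm] lim ub)
    moreover have "(\<lambda>n. integral\<^sup>L N (u n)) \<longlonglongrightarrow> integral\<^sup>L N (indicator F)"
      by (rule integral_dominated_convergence[where w = "\<lambda>_. 1"])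
         (simp_all add: meas(2)[OF fm] meas(2)[OF ubm] lim ub)
    moreover have "integral\<^sup>L M (u n) = integral\<^sup>L N (u n)" for n using uc ub by (intro eq)
    ultimately have "(\<lambda>n. integral\<^sup>L M (u n)) \<longlonglongrightarrow> integral\<^sup>L M (indicator F)"
      "(\<lambda>n. integral\<^sup>L M (u n)) \<longlonglongrightarrow> integral\<^sup>L N (indicator F)" by simp_all
    hence "integral\<^sup>L M (indicator F :: 'x \<Rightarrow> real) = integral\<^sup>L N (indicator F)"
      by (rule LIMSEQ_unique)
    thus ?thesis by (simp add: X)
  qed auto
  define M' where "M' = distr M borel (\<lambda>x. x)"
  define N' where "N' = distr N borel (\<lambda>x. x)"
  have idm: "(\<lambda>x. x) \<in> borel_measurable M" "(\<lambda>x. x) \<in> borel_measurable N"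
    unfolding measurable_cong_sets[OF sets_eq(1) refl] measurable_cong_sets[OF sets_eq(2) refl]
    by (rule measurable_restrict_space1, simp)+
  have em: "emeasure M' B = emeasure M (B \<inter> X)" "emeasure N' B = emeasure N (B \<inter> X)"
    if "B \<in> sets borel" for B
    using that idm by (auto simp: M'_def N'_def emeasure_distr X vimage_def)
  have "M' = N'"
  proof (rule measure_eqI_generator_eq[where E = "Collect closed" and \<Omega> = UNIV and A = "\<lambda>_. UNIV"])
    show "Int_stable (Collect closed)" by (auto simp: Int_stable_def)
    show "sets M' = sigma_sets UNIV (Collect closed)"
      "sets N' = sigma_sets UNIV (Collect closed)"
      by (simp_all add: M'_def N'_def borel_eq_closed)
    show "emeasure M' F = emeasure N' F" if "F \<in> Collect closed" for F
      using that closed[of F] by (simp add: em M.emeasure_eq_measure N.emeasure_eq_measure)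
    show "emeasure M' UNIV \<noteq> \<infinity>" by (simp add: em)
  qed auto
  show ?thesis
  proof (rule measure_eqI)
    show "sets M = sets N" using sets_eq by simp
    fix A assume "A \<in> sets M"
    then obtain B where B: "B \<in> sets borel" "A = B \<inter> X"
      using sets_eq(1) by (auto simp: sets_restrict_space)
    thus "emeasure M A = emeasure N A" using em[OF B(1)] \<open>M' = N'\<close> by simp
  qed
qed

text \<open>Weak compactness is imported from the real line: the empirical measures are coded into
  \<open>[0, 1]\<close>, where tightness gives a limit along a subsequence, and the limit is
  decoded. Measurability of \<psi> suffices for coding; continuity is required of \<pi>
  only.\<close>

lemma empirical_measures_convergent_subsequence:
  fixes X :: "'x::metric_space set" and z :: "nat \<Rightarrow> nat \<Rightarrow> 'x"
  assumes X: "compact X" and L: "\<And>n. L n > 0" and z: "\<And>n j. j < L n \<Longrightarrow> z n j \<in> X"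
  obtains r :: "nat \<Rightarrow> nat" and \<mu> :: "'x measure"
  where "strict_mono r" "prob_space \<mu>" "sets \<mu> = sets (restrict_space borel X)"
    "\<And>u :: 'x \<Rightarrow> real. continuous_on X u \<Longrightarrow>
      (\<lambda>n. (\<Sum>j<L (r n). u (z (r n) j)) / real (L (r n))) \<longlonglongrightarrow> integral\<^sup>L \<mu> u"
proof -
  have ne: "X \<noteq> {}" using z[of 0 0] L[of 0] by blast
  then obtain x0 where x0: "x0 \<in> X" by blast
  obtain \<psi> :: "'x \<Rightarrow> real" and \<pi> :: "real \<Rightarrow> 'x" where \<psi>: "\<psi> \<in> borel_measurable borel"
      "\<And>x. 0 \<le> \<psi> x" "\<And>x. \<psi> x \<le> 1"
    and \<pi>: "continuous_on (closure (\<psi> ` X)) \<pi>" "\<pi> ` closure (\<psi> ` X) \<subseteq> X" "\<And>x. x \<in> X \<Longrightarrow> \<pi> (\<psi> x) = x"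
    using compact_ternary_coding[OF X ne] by blast
  define C where "C = closure (\<psi> ` X)"
  have C: "closed C" "\<And>x. x \<in> X \<Longrightarrow> \<psi> x \<in> C"
    unfolding C_def by (auto intro: subsetD[OF closure_subset])
  have Cne: "C \<noteq> {}" using C(2)[OF x0] by blast
  define m where "m = (\<lambda>n. distr (measure_pmf (pmf_of_set {..<L n})) borel (\<lambda>j. \<psi> (z n j)))"
  have pset: "set_pmf (pmf_of_set {..<L n}) = {..<L n}" for n
    using L[of n] by (intro set_pmf_of_set) auto
  have dist: "real_distribution (m n)" for n
    unfolding m_def by (rule prob_space.real_distribution_distr[OF prob_space_measure_pmf]) simp
  have int_m: "integral\<^sup>L (m n) g = (\<Sum>j<L n. g (\<psi> (z n j))) / real (L n)"
    if "g \<in> borel_measurable borel" for g :: "real \<Rightarrow> real" and n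
    unfolding m_def using that L[of n]
    by (subst integral_distr, simp, simp, subst integral_pmf_of_set) auto
  have "tight m"
    unfolding tight_def
  proof (intro conjI allI impI dist)
    fix \<epsilon> :: real assume "\<epsilon> > 0"
    have "measure (m n) {-1<..2} = 1" for n
    proof -
      have "-1 < \<psi> x \<and> \<psi> x \<le> 2" for x using \<psi>(2)[of x] \<psi>(3)[of x] by linarith
      hence "(\<lambda>j. \<psi> (z n j)) -` {-1<..2} = UNIV" by auto
      thus ?thesis unfolding m_def by (subst measure_distr) auto
    qed
    thus "\<exists>a b. a < b \<and> (\<forall>n. 1 - \<epsilon> < measure (m n) {a<..b})"
      using \<open>\<epsilon> > 0\<close> by (intro exI[of _ "-1"] exI[of _ 2]) auto
  qed
  then obtain r M where r: "strict_mono r" and M: "real_distribution M" and wc: "weak_conv_m (m \<circ> id \<circ> r) M"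
    using tight_imp_convergent_subsubsequence[of m id] strict_mono_id by blast
  interpret M: real_distribution M by fact
  have conv: "(\<lambda>n. (\<Sum>j<L (r n). g (\<psi> (z (r n) j))) / real (L (r n))) \<longlonglongrightarrow> integral\<^sup>L M g"
    if g: "continuous_on UNIV g" "\<And>x. norm (g x) \<le> B" for g :: "real \<Rightarrow> real" and B
  proof -
    have "(\<lambda>n. integral\<^sup>L ((m \<circ> id \<circ> r) n) g) \<longlonglongrightarrow> integral\<^sup>L M g"
    proof (rule weak_conv_imp_integral_bdd_continuous_conv[OF _ M wc _ g(2)])
      show "real_distribution ((m \<circ> id \<circ> r) n)" for n using dist by simp
      show "isCont g x" for x using g(1) by (simp add: continuous_on_eq_continuous_at)
    qed
    moreover have "g \<in> borel_measurable borel" using g(1) by (rule borel_measurable_continuous_onI)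
    ultimately show ?thesis by (simp add: int_m)
  qed
  have AE: "AE c in M. c \<in> C"
  proof -
    \<comment> \<open>A bounded continuous test function whose zero set is \<open>C\<close>. All
      coded points lie in \<open>C\<close>, so its limit integral vanishes.\<close>
    define g where "g = (\<lambda>c. min 1 (infdist c C))"
    have gc: "continuous_on UNIV g" unfolding g_def by (intro continuous_intros)
    have gb: "norm (g c) \<le> 1" for c by (auto simp: g_def infdist_nonneg)
    have gm: "g \<in> borel_measurable borel" using gc by (rule borel_measurable_continuous_onI)
    have "g (\<psi> (z n j)) = 0" if "j < L n" for n j using C(2)[OF z[OF that]] by (simp add: g_def)
    hence zero: "(\<Sum>j<L (r n). g (\<psi> (z (r n) j))) / real (L (r n)) = 0" for n by simp
    have "integral\<^sup>L M g = 0" using conv[OF gc gb] unfolding zero by (simp add: LIMSEQ_const_iff)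
    moreover have "integrable M g"
      by (rule M.integrable_const_bound[of _ 1]) (use gb gm in auto)
    ultimately have "AE c in M. g c = 0"
      by (subst (asm) integral_nonneg_eq_0_iff_AE) (auto simp: g_def infdist_nonneg)
    thus ?thesis
    proof eventually_elim
      case (elim c)
      hence "infdist c C = 0" by (auto simp: g_def min_def split: if_splits)
      thus ?case using C(1) Cne by (simp add: in_closed_iff_infdist_zero)
    qed
  qed
  \<comment> \<open>The value \<open>x0\<close> is taken on a null set and only makes the map total
    with values in \<open>X\<close>.\<close>
  define f where "f = (\<lambda>c. if c \<in> C then \<pi> c else x0)"
  have "f \<in> borel_measurable borel"
    unfolding f_def using C(1) \<pi>(1) by (intro borel_measurable_continuous_on_if) (auto simp: C_def)
  moreover have "f c \<in> X" for c
    unfolding f_def C_def using \<pi>(2) x0 by (simp add: image_subset_iff)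
  ultimately have fm: "f \<in> measurable M (restrict_space borel X)"
    by (intro measurable_restrict_space2) auto
  define \<mu> where "\<mu> = distr M (restrict_space borel X) f"
  show ?thesis
  proof (rule that[of r \<mu>])
    show "prob_space \<mu>" unfolding \<mu>_def by (rule M.prob_space_distr[OF fm])
    show "sets \<mu> = sets (restrict_space borel X)" by (simp add: \<mu>_def)
    fix u :: "'x \<Rightarrow> real" assume u: "continuous_on X u"
    have um: "u \<in> borel_measurable (restrict_space borel X)"
      using u by (rule borel_measurable_continuous_on_restrict)
    have "compact (u ` X)" by (rule compact_continuous_image[OF u X])
    then obtain B where B: "\<And>x. x \<in> X \<Longrightarrow> norm (u x) \<le> B"
      using compact_imp_bounded bounded_iff by (metis image_eqI)
    have B0: "0 \<le> B" using B[OF x0] norm_ge_zero order.trans by blast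
    have up: "continuous_on C (\<lambda>c. u (\<pi> c))"
      using continuous_on_compose2[OF u \<pi>(1,2)] by (simp add: C_def)
    have upb: "norm (u (\<pi> c)) \<le> B" if "c \<in> C" for c using B \<pi>(2) that by (auto simp: C_def)
    \<comment> \<open>Weak convergence tests functions on the whole line, while
      \<open>u \<circ> \<pi>\<close> is continuous on \<open>C\<close> only.\<close>
    obtain g where g: "continuous_on UNIV g" "\<And>c. c \<in> C \<Longrightarrow> g c = u (\<pi> c)" "\<And>c. norm (g c) \<le> B"
      using Tietze[OF up _ B0 upb, of UNIV] C(1) by auto
    have "integral\<^sup>L \<mu> u = (\<integral>c. u (f c) \<partial>M)"
      unfolding \<mu>_def by (rule integral_distr[OF fm um])
    also have "\<dots> = integral\<^sup>L M g"
    proof (rule integral_cong_AE)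
      show "(\<lambda>c. u (f c)) \<in> borel_measurable M" by (rule measurable_compose[OF fm um])
      show "g \<in> borel_measurable M" using borel_measurable_continuous_onI[OF g(1)] by simp
      show "AE c in M. u (f c) = g c" using AE by eventually_elim (simp add: f_def g(2))
    qed
    finally have int: "integral\<^sup>L \<mu> u = integral\<^sup>L M g" .
    have "g (\<psi> (z n j)) = u (z n j)" if "j < L n" for n j
      using g(2)[OF C(2)[OF z[OF that]]] \<pi>(3)[OF z[OF that]] by simp
    hence eq: "(\<Sum>j<L (r n). g (\<psi> (z (r n) j))) / real (L (r n)) = (\<Sum>j<L (r n). u (z (r n) j)) / real (L (r n))" for n
      by simp
    show "(\<lambda>n. (\<Sum>j<L (r n). u (z (r n) j)) / real (L (r n))) \<longlonglongrightarrow> integral\<^sup>L \<mu> u"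
      using conv[OF g(1,3)] unfolding eq int .
  qed (rule r)
qed

section \<open>Invariance of limits of empirical measures and uniform ergodic averages\<close>

lemma funpow_mem:
  assumes "T ` X \<subseteq> X" "x \<in> X"
  shows "(T ^^ j) x \<in> X"
  using assms by (induction j) auto

text \<open>Krylov-Bogolyubov argument. Bad points \<open>y n\<close> with lengths
  \<open>L n\<close> tending to infinity would yield a limit measure under which the integral of
  \<open>h\<close> is off by at least \<open>e\<close>. But that measure is invariant, so it is
  \<nu>.\<close>

lemma uniquely_ergodic_uniform_averages_real:
  fixes h :: "'x::metric_space \<Rightarrow> real"
  assumes ue: "uniquely_ergodic X \<nu> T" and h: "continuous_on X h" and e: "e > 0"
  shows "\<exists>n0. \<forall>n\<ge>n0. \<forall>y\<in>X. \<bar>(\<Sum>j<n. h ((T ^^ j) y)) / real n - integral\<^sup>L \<nu> h\<bar> \<le> e"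
proof (rule ccontr)
  have X: "compact X" "T ` X \<subseteq> X" "continuous_on X T"
    and unique: "\<And>\<mu>. invariant_borel_prob X T \<mu> \<Longrightarrow> \<mu> = \<nu>"
    using ue by (auto simp: uniquely_ergodic_def)
  assume "\<not> ?thesis"
  hence "\<forall>n. \<exists>L y. L \<ge> Suc n \<and> y \<in> X \<and> \<bar>(\<Sum>j<L. h ((T ^^ j) y)) / real L - integral\<^sup>L \<nu> h\<bar> > e"
    by (meson not_le)
  then obtain L y where L: "\<And>n. L n \<ge> Suc n" and y: "\<And>n. y n \<in> X"
    and far: "\<And>n. \<bar>(\<Sum>j<L n. h ((T ^^ j) (y n))) / real (L n) - integral\<^sup>L \<nu> h\<bar> > e"
    by metis
  define z where "z = (\<lambda>n j. (T ^^ j) (y n))"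
  have z: "z n j \<in> X" for n j unfolding z_def using X(2) y by (rule funpow_mem)
  obtain r \<mu> where r: "strict_mono r" and \<mu>: "prob_space \<mu>" "sets \<mu> = sets (restrict_space borel X)"
    and lim: "\<And>u :: 'x \<Rightarrow> real. continuous_on X u \<Longrightarrow>
      (\<lambda>n. (\<Sum>j<L (r n). u (z (r n) j)) / real (L (r n))) \<longlonglongrightarrow> integral\<^sup>L \<mu> u"
  proof (rule empirical_measures_convergent_subsequence[OF X(1), of L z])
    show "L n > 0" for n using L[of n] by simp
  qed (use z in auto)
  have Lr: "filterlim (\<lambda>n. real (L (r n))) at_top sequentially"
  proof (rule filterlim_at_top_mono[OF filterlim_real_sequentially])
    show "eventually (\<lambda>n. real n \<le> real (L (r n))) sequentially"
    proof (intro always_eventually allI)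
      fix n show "real n \<le> real (L (r n))"
        using L[of "r n"] seq_suble[OF r, of n] by linarith
    qed
  qed
  have shift: "integral\<^sup>L \<mu> (\<lambda>x. u (T x)) = integral\<^sup>L \<mu> u" if u: "continuous_on X u" for u :: "'x \<Rightarrow> real"
  proof -
    obtain B where B: "\<And>x. x \<in> X \<Longrightarrow> norm (u x) \<le> B"
      using compact_imp_bounded[OF compact_continuous_image[OF u X(1)]] bounded_iff by (metis image_eqI)
    have uT: "continuous_on X (\<lambda>x. u (T x))" by (rule continuous_on_compose2[OF u X(3,2)])
    \<comment> \<open>Moving an orbit segment by one step changes only its two end terms, and these
      disappear after division by the length.\<close>
    have tele: "(\<Sum>j<k. u (T (z n j))) = (\<Sum>j<k. u (z n j)) + (u (z n k) - u (z n 0))" for n k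
      by (induction k) (auto simp: z_def)
    have "(\<lambda>n. (u (z (r n) (L (r n))) - u (z (r n) 0)) / real (L (r n))) \<longlonglongrightarrow> 0"
    proof (rule Lim_null_comparison)
      show "(\<lambda>n. 2 * B / real (L (r n))) \<longlonglongrightarrow> 0"
        by (rule tendsto_divide_0[OF tendsto_const filterlim_at_top_imp_at_infinity[OF Lr]])
      show "eventually (\<lambda>n. norm ((u (z (r n) (L (r n))) - u (z (r n) 0)) / real (L (r n))) \<le> 2 * B / real (L (r n))) sequentially"
      proof (intro always_eventually allI)
        fix n
        have "norm (u (z (r n) (L (r n))) - u (z (r n) 0)) \<le> 2 * B"
          using B[OF z[of "r n" "L (r n)"]] B[OF z[of "r n" 0]]
          by (intro norm_triangle_ineq4[THEN order.trans]) simp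
        thus "norm ((u (z (r n) (L (r n))) - u (z (r n) 0)) / real (L (r n))) \<le> 2 * B / real (L (r n))"
          by (simp add: divide_right_mono)
      qed
    qed
    from tendsto_add[OF lim[OF u] this]
    have "(\<lambda>n. (\<Sum>j<L (r n). u (T (z (r n) j))) / real (L (r n))) \<longlonglongrightarrow> integral\<^sup>L \<mu> u"
      by (simp add: tele add_divide_distrib)
    thus ?thesis using lim[OF uT] LIMSEQ_unique by blast
  qed
  have sp: "space \<mu> = X" using sets_eq_imp_space_eq[OF \<mu>(2)] by (simp add: space_restrict_space)
  have Tm: "T \<in> measurable \<mu> \<mu>"
  proof -
    have "T \<in> measurable (restrict_space borel X) (restrict_space borel X)"
      using X(2) by (intro measurable_restrict_space2 borel_measurable_continuous_on_restrict X(3))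
         (auto simp: space_restrict_space)
    thus ?thesis using measurable_cong_sets[OF \<mu>(2,2)] by simp
  qed
  have "distr \<mu> \<mu> T = \<mu>"
  proof (rule prob_space_eqI_continuous)
    show "prob_space (distr \<mu> \<mu> T)" by (rule prob_space.prob_space_distr[OF \<mu>(1) Tm])
    fix u :: "'x \<Rightarrow> real" assume u: "continuous_on UNIV u"
    have "u \<in> borel_measurable \<mu>"
      unfolding measurable_cong_sets[OF \<mu>(2) refl]
      by (rule measurable_restrict_space1) (rule borel_measurable_continuous_onI[OF u])
    thus "integral\<^sup>L (distr \<mu> \<mu> T) u = integral\<^sup>L \<mu> u"
      using shift[OF continuous_on_subset[OF u]] by (simp add: integral_distr[OF Tm])
  qed (use \<mu> in simp_all)
  hence "emeasure \<mu> (T -` A \<inter> X) = emeasure \<mu> A" if "A \<in> sets \<mu>" for A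
    using emeasure_distr[OF Tm that] by (simp add: sp)
  hence "invariant_borel_prob X T \<mu>" using \<mu> by (simp add: invariant_borel_prob_def)
  hence "\<mu> = \<nu>" by (rule unique)
  have "\<bar>integral\<^sup>L \<mu> h - integral\<^sup>L \<nu> h\<bar> \<ge> e"
  proof (rule tendsto_lowerbound)
    show "(\<lambda>n. \<bar>(\<Sum>j<L (r n). h (z (r n) j)) / real (L (r n)) - integral\<^sup>L \<nu> h\<bar>) \<longlonglongrightarrow>
      \<bar>integral\<^sup>L \<mu> h - integral\<^sup>L \<nu> h\<bar>" by (intro tendsto_intros lim h)
    show "eventually (\<lambda>n. e \<le> \<bar>(\<Sum>j<L (r n). h (z (r n) j)) / real (L (r n)) - integral\<^sup>L \<nu> h\<bar>) sequentially"
      using far by (intro always_eventually allI) (simp add: z_def less_imp_le)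
  qed simp
  thus False using \<open>\<mu> = \<nu>\<close> e by simp
qed

lemma uniquely_ergodic_uniform_averages:
  fixes h :: "'x::metric_space \<Rightarrow> complex"
  assumes ue: "uniquely_ergodic X \<nu> T" and h: "continuous_on X h" and e: "e > 0"
  shows "\<exists>n>0. \<forall>y\<in>X. norm ((\<Sum>j<n. h ((T ^^ j) y)) / of_nat n - integral\<^sup>L \<nu> h) \<le> e"
proof -
  have X: "compact X" and \<nu>: "prob_space \<nu>" "sets \<nu> = sets (restrict_space borel X)"
    using ue by (auto simp: uniquely_ergodic_def invariant_borel_prob_def)
  interpret prob_space \<nu> by fact
  have "space \<nu> = X" using sets_eq_imp_space_eq[OF \<nu>(2)] by (simp add: space_restrict_space)
  moreover obtain B where "\<And>x. x \<in> X \<Longrightarrow> norm (h x) \<le> B"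
    using compact_imp_bounded[OF compact_continuous_image[OF h X]] bounded_iff by (metis image_eqI)
  moreover have "h \<in> borel_measurable \<nu>"
    unfolding measurable_cong_sets[OF \<nu>(2) refl] by (rule borel_measurable_continuous_on_restrict[OF h])
  ultimately have int: "integrable \<nu> h" by (intro integrable_const_bound[of _ B]) auto
  have Re: "continuous_on X (\<lambda>x. Re (h x))" and Im: "continuous_on X (\<lambda>x. Im (h x))"
    by (intro continuous_intros h)+
  have e2: "e / 2 > 0" using e by simp
  obtain n1 n2 where n12:
    "\<forall>n\<ge>n1. \<forall>y\<in>X. \<bar>(\<Sum>j<n. Re (h ((T ^^ j) y))) / real n - integral\<^sup>L \<nu> (\<lambda>x. Re (h x))\<bar> \<le> e / 2"
    "\<forall>n\<ge>n2. \<forall>y\<in>X. \<bar>(\<Sum>j<n. Im (h ((T ^^ j) y))) / real n - integral\<^sup>L \<nu> (\<lambda>x. Im (h x))\<bar> \<le> e / 2"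
    using uniquely_ergodic_uniform_averages_real[OF ue Re e2]
      uniquely_ergodic_uniform_averages_real[OF ue Im e2] by blast
  define n where "n = Suc (max n1 n2)"
  show ?thesis
  proof (intro exI[of _ n] conjI ballI)
    fix y assume y: "y \<in> X"
    define D where "D = (\<Sum>j<n. h ((T ^^ j) y)) / of_nat n - integral\<^sup>L \<nu> h"
    have "Re D = (\<Sum>j<n. Re (h ((T ^^ j) y))) / real n - integral\<^sup>L \<nu> (\<lambda>x. Re (h x))"
      using int by (simp add: D_def integral_Re)
    moreover have "Im D = (\<Sum>j<n. Im (h ((T ^^ j) y))) / real n - integral\<^sup>L \<nu> (\<lambda>x. Im (h x))"
      using int by (simp add: D_def integral_Im)
    moreover have "n1 \<le> n" "n2 \<le> n" by (auto simp: n_def)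
    ultimately have "\<bar>Re D\<bar> \<le> e / 2" "\<bar>Im D\<bar> \<le> e / 2" using n12 y by auto
    thus "norm D \<le> e" using cmod_le[of D] by linarith
  qed (simp add: n_def)
qed

section \<open>Densities of level sets\<close>

text \<open>An eventual bound \<open>B\<close> for the size of \<open>e\<close> improves to
  \<open>\<kappa> * B + \<epsilon>\<close> with \<open>\<kappa> = suminf w < 1\<close>: the tail of
  the series is small by the uniform bound \<open>C\<close>, and in the finitely many other terms
  \<open>B\<close> applies. Iterating from \<open>C\<close> gives
  \<open>C * \<kappa> ^ n\<close>.\<close>

lemma tendsto_zero_of_contraction:
  fixes e :: "real \<Rightarrow> real" and w \<rho> :: "nat \<Rightarrow> real"
  assumes C: "\<And>x. x > 0 \<Longrightarrow> \<bar>e x\<bar> \<le> C"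
    and w: "\<And>d. w d \<ge> 0" "summable w" "suminf w < 1" and \<rho>: "\<And>d. \<rho> d > 0"
    and \<delta>: "(\<delta> \<longlongrightarrow> 0) at_top"
    and le: "\<And>x. x \<ge> 1 \<Longrightarrow> \<bar>e x\<bar> \<le> \<delta> x + (\<Sum>d. w d * \<bar>e (x / \<rho> d)\<bar>)"
  shows "(e \<longlongrightarrow> 0) at_top"
proof -
  define \<kappa> where "\<kappa> = suminf w"
  have \<kappa>: "0 \<le> \<kappa>" "\<kappa> < 1" using w by (auto simp: \<kappa>_def suminf_nonneg)
  have C0: "C \<ge> 0" using C[of 1] by linarith
  have summ: "summable (\<lambda>d. w d * \<bar>e (x / \<rho> d)\<bar>)" if "x > 0" for x
  proof (rule summable_comparison_test[OF _ summable_mult2[OF w(2), of C]], intro exI[of _ 0] allI impI)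
    fix d show "norm (w d * \<bar>e (x / \<rho> d)\<bar>) \<le> w d * C"
      using C[of "x / \<rho> d"] that \<rho>[of d] w(1)[of d] by (simp add: abs_mult mult_left_mono)
  qed
  have step: "eventually (\<lambda>x. \<bar>e x\<bar> \<le> \<kappa> * B + \<epsilon>) at_top"
    if B: "B \<ge> 0" "eventually (\<lambda>x. \<bar>e x\<bar> \<le> B) at_top" and eps: "\<epsilon> > 0" for B \<epsilon>
  proof -
    obtain D where D: "(\<Sum>d. w (d + D)) * C \<le> \<epsilon> / 2"
    proof -
      obtain D where "norm (\<Sum>d. w (d + D)) < \<epsilon> / (2 * (C + 1))"
        using suminf_exist_split[OF _ w(2), of "\<epsilon> / (2 * (C + 1))"] eps C0 by auto
      hence "(\<Sum>d. w (d + D)) * C \<le> \<epsilon> / (2 * (C + 1)) * C"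
        using C0 by (intro mult_right_mono) auto
      also have "\<dots> \<le> \<epsilon> / 2" using C0 eps by (simp add: field_simps)
      finally show ?thesis by (rule that)
    qed
    obtain x0 where x0: "\<And>x. x \<ge> x0 \<Longrightarrow> \<bar>e x\<bar> \<le> B" using B(2) by (auto simp: eventually_at_top_linorder)
    have ev: "eventually (\<lambda>x. \<forall>d<D. x / \<rho> d \<ge> x0) at_top"
    proof -
      have "eventually (\<lambda>x. x / \<rho> d \<ge> x0) at_top" for d
        using eventually_ge_at_top[of "x0 * \<rho> d"]
        by eventually_elim (use \<rho>[of d] in \<open>simp add: pos_le_divide_eq\<close>)
      hence "eventually (\<lambda>x. \<forall>d\<in>{..<D}. x / \<rho> d \<ge> x0) at_top"
        by (intro eventually_ball_finite) auto
      thus ?thesis by (simp only: Ball_def lessThan_iff)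
    qed
    have "eventually (\<lambda>x. \<delta> x < \<epsilon> / 2) at_top" using order_tendstoD(2)[OF \<delta>, of "\<epsilon> / 2"] eps by simp
    thus ?thesis using ev eventually_ge_at_top[of 1]
    proof eventually_elim
      case (elim x)
      have x: "x > 0" using elim(3) by simp
      have "(\<Sum>d. w d * \<bar>e (x / \<rho> d)\<bar>) =
          (\<Sum>d. w (d + D) * \<bar>e (x / \<rho> (d + D))\<bar>) + (\<Sum>d<D. w d * \<bar>e (x / \<rho> d)\<bar>)"
        by (rule suminf_split_initial_segment[OF summ[OF x]])
      also have "(\<Sum>d. w (d + D) * \<bar>e (x / \<rho> (d + D))\<bar>) \<le> (\<Sum>d. w (d + D) * C)"
        using summ[OF x] w(1,2) C x \<rho>
        by (intro suminf_le mult_left_mono summable_mult2 summable_ignore_initial_segment[of "\<lambda>d. w d * \<bar>e (x / \<rho> d)\<bar>"])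
           (auto simp: summable_iff_shift)
      also have "\<dots> = (\<Sum>d. w (d + D)) * C"
        using w(2) by (intro suminf_mult2[symmetric]) (simp add: summable_iff_shift)
      also have "\<dots> \<le> \<epsilon> / 2" by (rule D)
      also have "(\<Sum>d<D. w d * \<bar>e (x / \<rho> d)\<bar>) \<le> (\<Sum>d<D. w d * B)"
        using elim(2) x0 w(1) by (intro sum_mono mult_left_mono) auto
      also have "\<dots> = (\<Sum>d<D. w d) * B" by (simp add: sum_distrib_right)
      also have "\<dots> \<le> \<kappa> * B"
        unfolding \<kappa>_def using w B by (intro mult_right_mono sum_le_suminf) auto
      finally show ?case using le[OF elim(3)] elim(1) by simp
    qed
  qed
  have iter: "\<forall>\<epsilon>>0. eventually (\<lambda>x. \<bar>e x\<bar> \<le> C * \<kappa> ^ n + \<epsilon>) at_top" for n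
  proof (induction n)
    case 0
    have "eventually (\<lambda>x. \<bar>e x\<bar> \<le> C) at_top"
      using eventually_gt_at_top[of 0] by eventually_elim (rule C)
    thus ?case by (auto elim!: eventually_mono)
  next
    case (Suc n)
    show ?case
    proof (intro allI impI)
      fix \<epsilon> :: real assume eps: "\<epsilon> > 0"
      have "eventually (\<lambda>x. \<bar>e x\<bar> \<le> \<kappa> * (C * \<kappa> ^ n + \<epsilon> / 2) + \<epsilon> / 2) at_top"
        using Suc eps C0 \<kappa> by (intro step) auto
      moreover have "\<kappa> * (\<epsilon> / 2) \<le> 1 * (\<epsilon> / 2)" using \<kappa> eps by (intro mult_right_mono) auto
      ultimately show "eventually (\<lambda>x. \<bar>e x\<bar> \<le> C * \<kappa> ^ Suc n + \<epsilon>) at_top"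
        by (auto simp: algebra_simps elim!: eventually_mono)
    qed
  qed
  show ?thesis
  proof (rule tendstoI)
    fix \<epsilon> :: real assume eps: "\<epsilon> > 0"
    have "(\<lambda>n. C * \<kappa> ^ n) \<longlonglongrightarrow> C * 0" using \<kappa> by (intro tendsto_intros LIMSEQ_realpow_zero) auto
    hence "eventually (\<lambda>n. C * \<kappa> ^ n < \<epsilon> / 2) sequentially"
      using order_tendstoD(2)[of _ "C * 0" _ "\<epsilon> / 2"] eps by auto
    then obtain n where n: "C * \<kappa> ^ n < \<epsilon> / 2" by (auto simp: eventually_sequentially)
    have "eventually (\<lambda>x. \<bar>e x\<bar> \<le> C * \<kappa> ^ n + \<epsilon> / 2) at_top" using iter eps by simp
    thus "eventually (\<lambda>x. dist (e x) 0 < \<epsilon>) at_top" using n by (auto elim!: eventually_mono)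
  qed
qed

section \<open>Squarefree numbers free of given primes\<close>

definition squarefree_count :: "nat set \<Rightarrow> real \<Rightarrow> nat" where
  "squarefree_count S x = card {q \<in> {1..nat \<lfloor>x\<rfloor>}. squarefree q \<and> (\<forall>p\<in>S. \<not> p dvd q)}"

lemma squarefree_count_le: "x > 0 \<Longrightarrow> real (squarefree_count S x) \<le> x"
proof -
  assume "x > 0"
  have "squarefree_count S x \<le> card {1..nat \<lfloor>x\<rfloor>}"
    unfolding squarefree_count_def by (intro card_mono) auto
  thus ?thesis using \<open>x > 0\<close> by (simp add: le_nat_floor le_floor_iff flip: of_nat_le_iff) linarith
qed

lemma squarefree_count_small: "x < 1 \<Longrightarrow> squarefree_count S x = 0"
  by (simp add: squarefree_count_def)

lemma square_part_mult_square:
  fixes q d :: nat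
  assumes "squarefree q" "q > 0" "d > 0"
  shows "square_part (q * d\<^sup>2) = d"
proof (rule multiplicity_eq_nat)
  show "square_part (q * d\<^sup>2) > 0" using assms by (auto intro!: Nat.gr0I)
  fix p :: nat assume p: "prime p"
  have "multiplicity p q \<le> 1" using assms(1) p squarefree_factorial_semiring''[of q] assms(2) by auto
  thus "multiplicity p (square_part (q * d\<^sup>2)) = multiplicity p d"
    using p assms
    by (simp add: prime_multiplicity_square_part prime_elem_multiplicity_mult_distrib
          prime_elem_multiplicity_power_distrib)
qed (use assms in auto)

lemma nat_floor_divide: "x \<ge> 0 \<Longrightarrow> nat \<lfloor>x / real d\<rfloor> = nat \<lfloor>x\<rfloor> div d"
  using floor_divide_real_eq_div[of "int d" x] by (simp add: nat_div_distrib)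

lemma squarefree_count_dilates:
  assumes x: "x \<ge> 0"
  shows "(\<Sum>d=1..nat \<lfloor>x\<rfloor>. squarefree_count {} (x / real (d\<^sup>2))) = nat \<lfloor>x\<rfloor>"
proof -
  define N where "N = nat \<lfloor>x\<rfloor>"
  have "card {q \<in> {1..N div d\<^sup>2}. squarefree q} = card {n \<in> {1..N}. square_part n = d}"
    if d: "d \<in> {1..N}" for d
  proof (rule bij_betw_same_card[OF bij_betwI[where f = "\<lambda>q. q * d\<^sup>2" and g = squarefree_part]])
    show "(\<lambda>q. q * d\<^sup>2) \<in> {q \<in> {1..N div d\<^sup>2}. squarefree q} \<rightarrow> {n \<in> {1..N}. square_part n = d}"
      using d by (auto simp: square_part_mult_square less_eq_div_iff_mult_less_eq Suc_le_eq)
    show "squarefree_part \<in> {n \<in> {1..N}. square_part n = d} \<rightarrow> {q \<in> {1..N div d\<^sup>2}. squarefree q}"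
    proof
      fix n assume n: "n \<in> {n \<in> {1..N}. square_part n = d}"
      hence "squarefree_part n * d\<^sup>2 \<le> N" using squarefree_decompose[of n] by auto
      thus "squarefree_part n \<in> {q \<in> {1..N div d\<^sup>2}. squarefree q}"
        using d by (auto simp: less_eq_div_iff_mult_less_eq Suc_le_eq intro!: Nat.gr0I)
    qed
    show "squarefree_part (q * d\<^sup>2) = q" if "q \<in> {q \<in> {1..N div d\<^sup>2}. squarefree q}" for q
      using that d square_part_mult_square[of q d] by (simp add: squarefree_part_def)
    show "squarefree_part n * d\<^sup>2 = n" if "n \<in> {n \<in> {1..N}. square_part n = d}" for n
      using that squarefree_decompose[of n] by auto
  qed
  hence "(\<Sum>d=1..N. squarefree_count {} (x / real (d\<^sup>2))) = (\<Sum>d=1..N. card {n \<in> {1..N}. square_part n = d})"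
    unfolding squarefree_count_def nat_floor_divide[OF x] N_def[symmetric] by (intro sum.cong) auto
  also have "\<dots> = card (\<Union>d\<in>{1..N}. {n \<in> {1..N}. square_part n = d})"
    by (intro card_UN_disjoint[symmetric]) auto
  also have "(\<Union>d\<in>{1..N}. {n \<in> {1..N}. square_part n = d}) = {1..N}"
  proof -
    have "square_part n \<in> {1..N}" if "n \<in> {1..N}" for n
    proof -
      have "square_part n > 0" using that by (auto intro!: Nat.gr0I)
      moreover have "square_part n dvd n"
        using square_part_square_dvd[of n] dvd_trans[of "square_part n" "(square_part n)\<^sup>2" n] by auto
      hence "square_part n \<le> n" using that by (intro dvd_imp_le) auto
      ultimately show ?thesis using that by auto
    qed
    thus ?thesis by blast
  qed
  finally show ?thesis by (simp add: N_def)
qed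

text \<open>The strict bound follows by comparison with the telescoping series of
  \<open>1 / ((d + 1) * (d + 2))\<close>, whose sum is 1.\<close>

lemma sum_inverse_squares_from_2:
  "(\<lambda>d. 1 / real (d + 2) ^ 2) sums (pi\<^sup>2 / 6 - 1)" "pi\<^sup>2 / 6 - 1 < 1"
proof -
  show s: "(\<lambda>d. 1 / real (d + 2) ^ 2) sums (pi\<^sup>2 / 6 - 1)"
    using sums_split_initial_segment[OF inverse_squares_sums, of 1] by (simp add: add_ac)
  have t: "(\<lambda>d. 1 / real (Suc d) - 1 / real (Suc (Suc d))) sums (1 / real (Suc 0) - 0)"
    by (rule telescope_sums') (rule LIMSEQ_Suc[OF lim_1_over_n])
  have "0 < (\<Sum>d. 1 / real (Suc d) - 1 / real (Suc (Suc d)) - 1 / real (d + 2) ^ 2)"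
  proof (rule suminf_pos)
    show "summable (\<lambda>d. 1 / real (Suc d) - 1 / real (Suc (Suc d)) - 1 / real (d + 2) ^ 2)"
      by (intro summable_diff sums_summable[OF s] sums_summable[OF t])
    show "0 < 1 / real (Suc d) - 1 / real (Suc (Suc d)) - 1 / real (d + 2) ^ 2" for d
    proof -
      have "real (Suc d) * real (Suc (Suc d)) < real (d + 2) ^ 2"
        by (simp add: power2_eq_square algebra_simps)
      hence "1 / real (d + 2) ^ 2 < 1 / (real (Suc d) * real (Suc (Suc d)))"
        by (intro divide_strict_left_mono) simp_all
      also have "\<dots> = 1 / real (Suc d) - 1 / real (Suc (Suc d))" by (simp add: field_simps)
      finally show ?thesis by simp
    qed
  qed
  thus "pi\<^sup>2 / 6 - 1 < 1" using sums_diff[OF t s] by (simp add: sums_iff)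
qed

text \<open>
  Sorting \<open>n \<le> x\<close> by their largest square divisor \<open>d\<^sup>2\<close> expresses \<open>\<lfloor>x\<rfloor>\<close> through the counts up to
  \<open>x/d\<^sup>2\<close>. The resulting relation for the error term is contracting since the sum of \<open>1/d\<^sup>2\<close> over
  \<open>d \<ge> 2\<close> is less than 1.
\<close>

lemma squarefree_density:
  "((\<lambda>x. real (squarefree_count {} x) / x) \<longlongrightarrow> 6 / pi\<^sup>2) at_top"
proof -
  define e where "e = (\<lambda>x. real (squarefree_count {} x) / x - 6 / pi\<^sup>2)"
  have pi6: "0 \<le> 6 / pi\<^sup>2" "6 / pi\<^sup>2 \<le> 1"
    using power_mono[of 3 pi 2] pi_gt3 by (auto simp: field_simps)
  have e1: "\<bar>e x\<bar> \<le> 1" if "x > 0" for x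
  proof -
    have "0 \<le> real (squarefree_count {} x) / x" "real (squarefree_count {} x) / x \<le> 1"
      using squarefree_count_le[OF that] that by auto
    thus ?thesis using pi6 unfolding e_def abs_le_iff by linarith
  qed
  have "(e \<longlongrightarrow> 0) at_top"
  proof (rule tendsto_zero_of_contraction[OF e1, where w = "\<lambda>d. 1 / real (d + 2) ^ 2"
        and \<rho> = "\<lambda>d. real ((d + 2)\<^sup>2)" and \<delta> = "\<lambda>x. 1 / x"])
    show "summable (\<lambda>d. 1 / real (d + 2) ^ 2)" "(\<Sum>d. 1 / real (d + 2) ^ 2) < 1"
      using sum_inverse_squares_from_2 by (auto simp: sums_iff)
    show "((\<lambda>x. 1 / x) \<longlongrightarrow> (0::real)) at_top" by real_asymp
    fix x :: real assume x: "x \<ge> 1"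
    define N where "N = nat \<lfloor>x\<rfloor>"
    define g where "g = (\<lambda>d. real (squarefree_count {} (x / real (d\<^sup>2))) / x)"
    have g0: "g d = 0" if "d > N" for d
    proof -
      have "x < real d" using that x unfolding N_def by linarith
      also have "\<dots> \<le> real (d\<^sup>2)" by (simp add: power2_eq_square del: of_nat_mult flip: of_nat_mult)
      finally have "x / real (d\<^sup>2) < 1" using x by (subst divide_less_eq_1) auto
      thus ?thesis unfolding g_def by (subst squarefree_count_small) auto
    qed
    have "(\<lambda>d. g (Suc d)) sums (\<Sum>d<N. g (Suc d))" using g0 by (intro sums_finite) auto
    also have "(\<Sum>d<N. g (Suc d)) = (\<Sum>d=1..N. g d)" by (simp add: sum.atLeast1_atMost_eq)
    also have "\<dots> = real N / x"
      unfolding g_def sum_divide_distrib[symmetric] of_nat_sum[symmetric] N_def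
      using x by (subst squarefree_count_dilates) auto
    finally have gs: "(\<lambda>d. g (Suc d)) sums (real N / x)" .
    have ge: "g (Suc d) = 1 / real (Suc d) ^ 2 * e (x / real ((Suc d)\<^sup>2)) + 6 / pi\<^sup>2 * (1 / real (Suc d) ^ 2)" for d
      using x by (simp add: g_def e_def field_simps del: of_nat_Suc)
    \<comment> \<open>The density is forced here: the main terms sum to 1, so only the rounding
      error \<open>N / x - 1\<close> is left. The term at index 0 is \<open>e x\<close> itself and
      is split off next.\<close>
    have "(\<lambda>d. g (Suc d) - 6 / pi\<^sup>2 * (1 / real (Suc d) ^ 2)) sums (real N / x - 6 / pi\<^sup>2 * (pi\<^sup>2 / 6))"
      using inverse_squares_sums by (intro sums_diff gs sums_mult) (simp add: add.commute)
    hence es: "(\<lambda>d. 1 / real (Suc d) ^ 2 * e (x / real ((Suc d)\<^sup>2))) sums (real N / x - 1)"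
      by (simp add: ge del: of_nat_Suc)
    have "(\<lambda>d. 1 / real (Suc (d + 1)) ^ 2 * e (x / real ((Suc (d + 1))\<^sup>2))) sums (real N / x - 1 - e x)"
      using sums_split_initial_segment[OF es, of 1] by simp
    moreover have "Suc (d + 1) = d + 2" for d by simp
    ultimately have es2: "(\<lambda>d. 1 / real (d + 2) ^ 2 * e (x / real ((d + 2)\<^sup>2))) sums (real N / x - 1 - e x)"
      by (simp only:)
    have sa: "summable (\<lambda>d. 1 / real (d + 2) ^ 2 * \<bar>e (x / real ((d + 2)\<^sup>2))\<bar>)"
    proof (rule summable_comparison_test[OF _ sums_summable[OF sum_inverse_squares_from_2(1)]], intro exI[of _ 0] allI impI)
      fix d show "norm (1 / real (d + 2) ^ 2 * \<bar>e (x / real ((d + 2)\<^sup>2))\<bar>) \<le> 1 / real (d + 2) ^ 2"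
      proof -
        have "x / real ((d + 2)\<^sup>2) > 0" using x by (intro divide_pos_pos) auto
        hence "1 / real (d + 2) ^ 2 * \<bar>e (x / real ((d + 2)\<^sup>2))\<bar> \<le> 1 / real (d + 2) ^ 2 * 1"
          by (intro mult_left_mono e1) auto
        moreover have "0 \<le> 1 / real (d + 2) ^ 2 * \<bar>e (x / real ((d + 2)\<^sup>2))\<bar>"
          by (intro mult_nonneg_nonneg) auto
        ultimately show ?thesis unfolding real_norm_def by (subst abs_of_nonneg) linarith+
      qed
    qed
    have "norm (1 / real (d + 2) ^ 2 * e (x / real ((d + 2)\<^sup>2))) \<le>
        1 / real (d + 2) ^ 2 * \<bar>e (x / real ((d + 2)\<^sup>2))\<bar>" for d
      unfolding real_norm_def abs_mult by (intro mult_right_mono) auto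
    from norm_sums_le[OF es2 summable_sums[OF sa] this]
    have "\<bar>real N / x - 1 - e x\<bar> \<le> (\<Sum>d. 1 / real (d + 2) ^ 2 * \<bar>e (x / real ((d + 2)\<^sup>2))\<bar>)"
      by (simp only: real_norm_def)
    moreover have "\<bar>real N / x - 1\<bar> \<le> 1 / x"
    proof -
      have "x - 1 \<le> real N" "real N \<le> x" using x unfolding N_def by linarith+
      hence "\<bar>real N - x\<bar> / x \<le> 1 / x" using x by (intro divide_right_mono) linarith+
      moreover have "real N / x - 1 = (real N - x) / x" using x by (simp add: diff_divide_distrib)
      ultimately show ?thesis using x by (simp add: abs_divide)
    qed
    moreover have "\<bar>e x\<bar> \<le> \<bar>y\<bar> + \<bar>y - e x\<bar>" for y by linarith
    ultimately show "\<bar>e x\<bar> \<le> 1 / x + (\<Sum>d. 1 / real (d + 2) ^ 2 * \<bar>e (x / real ((d + 2)\<^sup>2))\<bar>)"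
      by (meson add_mono order.trans)
  qed simp_all
  hence "((\<lambda>x. e x + 6 / pi\<^sup>2) \<longlongrightarrow> 0 + 6 / pi\<^sup>2) at_top" by (intro tendsto_intros)
  thus ?thesis by (simp add: e_def)
qed

lemma squarefree_prime_mult_iff:
  fixes p q :: nat
  assumes "prime p"
  shows "squarefree (p * q) \<longleftrightarrow> squarefree q \<and> \<not> p dvd q"
proof
  assume pq: "squarefree (p * q)"
  have "\<not> p dvd q"
  proof
    assume "p dvd q"
    hence "p\<^sup>2 dvd p * q" by (simp add: power2_eq_square)
    hence "is_unit p" using pq by (rule squarefreeD[rotated])
    thus False using assms by auto
  qed
  moreover have "squarefree q" by (rule squarefree_mono[OF _ pq]) simp
  ultimately show "squarefree q \<and> \<not> p dvd q" by simp
next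
  assume "squarefree q \<and> \<not> p dvd q"
  thus "squarefree (p * q)"
    using assms squarefree_prime[of p] prime_imp_coprime[of p q] by (simp add: squarefree_mult_coprime)
qed

lemma squarefree_count_insert:
  assumes p: "prime p" "p \<notin> S" and S: "\<And>r. r \<in> S \<Longrightarrow> prime r" and x: "x \<ge> 0"
  shows "squarefree_count S x = squarefree_count (insert p S) x + squarefree_count (insert p S) (x / real p)"
proof -
  define N where "N = nat \<lfloor>x\<rfloor>"
  define A where "A = (\<lambda>(S :: nat set) n. {q \<in> {1..n}. squarefree q \<and> (\<forall>p\<in>S. \<not> p dvd q)})"
  have fin: "finite (A S n)" for S n
    unfolding A_def by (rule finite_subset[of _ "{1..n}"]) auto
  have p0: "p > 0" using p by (simp add: prime_gt_0_nat)
  have sp: "squarefree (m * p) \<longleftrightarrow> squarefree m \<and> \<not> p dvd m" for m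
    using squarefree_prime_mult_iff[OF p(1), of m] by (simp add: mult.commute)
  have rp: "r dvd p * m \<longleftrightarrow> r dvd m" if "r \<in> S" for r m
  proof -
    have "\<not> r dvd p" using that p S by (metis primes_dvd_imp_eq)
    thus ?thesis using S[OF that] by (simp add: prime_dvd_mult_iff)
  qed
  have "A S N = A (insert p S) N \<union> (\<lambda>q. p * q) ` A (insert p S) (N div p)"
  proof (intro set_eqI iffI)
    fix q assume q: "q \<in> A S N"
    show "q \<in> A (insert p S) N \<union> (\<lambda>q. p * q) ` A (insert p S) (N div p)"
    proof (cases "p dvd q")
      case True
      then obtain m where m: "q = p * m" by (rule dvdE)
      have "m \<in> A (insert p S) (N div p)"
        using q p0 rp unfolding m A_def
        by (auto simp: sp less_eq_div_iff_mult_less_eq mult.commute Suc_le_eq)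
      thus ?thesis using m by blast
    next
      case False
      thus ?thesis using q by (auto simp: A_def)
    qed
  next
    fix q assume "q \<in> A (insert p S) N \<union> (\<lambda>q. p * q) ` A (insert p S) (N div p)"
    thus "q \<in> A S N"
      using p0 rp
      by (auto simp: A_def sp less_eq_div_iff_mult_less_eq mult.commute Suc_le_eq)
  qed
  moreover have "A (insert p S) N \<inter> (\<lambda>q. p * q) ` A (insert p S) (N div p) = {}" by (auto simp: A_def)
  ultimately have "card (A S N) = card (A (insert p S) N) + card ((\<lambda>q. p * q) ` A (insert p S) (N div p))"
    by (simp add: card_Un_disjoint fin)
  also have "card ((\<lambda>q. p * q) ` A (insert p S) (N div p)) = card (A (insert p S) (N div p))"
    using p0 by (intro card_image) (auto simp: inj_on_def)
  finally show ?thesis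
    unfolding squarefree_count_def nat_floor_divide[OF x] N_def[symmetric] A_def .
qed

text \<open>The count for \<open>S\<close> at \<open>x\<close> is the count for
  \<open>insert p S\<close> at \<open>x\<close> plus that at \<open>x / p\<close>. The densities
  must then satisfy \<open>c = c' * (1 + 1 / p)\<close>, and the error obeys a contraction with the
  single weight \<open>1 / p \<le> 1/2\<close>.\<close>

lemma squarefree_coprime_density:
  assumes "finite S" "\<And>p. p \<in> S \<Longrightarrow> prime p"
  shows "((\<lambda>x. real (squarefree_count S x) / x) \<longlongrightarrow> 6 / pi\<^sup>2 * (\<Prod>p\<in>S. inverse (1 + 1 / real p))) at_top"
  using assms
proof (induction S rule: finite_induct)
  case empty
  show ?case using squarefree_density by simp
next
  case (insert p S)
  define c where "c = 6 / pi\<^sup>2 * (\<Prod>p\<in>S. inverse (1 + 1 / real p))"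
  define c' where "c' = c * inverse (1 + 1 / real p)"
  define e where "e = (\<lambda>x. real (squarefree_count (insert p S) x) / x - c')"
  define \<delta> where "\<delta> = (\<lambda>x. real (squarefree_count S x) / x - c)"
  have p: "prime p" "p \<notin> S" "real p \<ge> 2" using insert prime_ge_2_nat[of p] by auto
  have IH: "((\<lambda>x. real (squarefree_count S x) / x) \<longlongrightarrow> c) at_top"
    unfolding c_def using insert by auto
  have cc': "c' + c' / real p = c"
  proof -
    have "c' * (1 + 1 / real p) = c" 
    proof -
      have "1 + 1 / real p > 0" by (intro add_pos_nonneg) auto
      thus ?thesis by (simp add: c'_def)
    qed
    thus ?thesis by (simp add: algebra_simps)
  qed
  have eb: "\<bar>e x\<bar> \<le> 1 + \<bar>c'\<bar>" if "x > 0" for x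
  proof -
    have "0 \<le> real (squarefree_count (insert p S) x) / x" "real (squarefree_count (insert p S) x) / x \<le> 1"
      using squarefree_count_le[OF that] that by auto
    thus ?thesis unfolding e_def by linarith
  qed
  have "(e \<longlongrightarrow> 0) at_top"
  proof (rule tendsto_zero_of_contraction[OF eb, where w = "\<lambda>d. if d = 0 then 1 / real p else 0"
        and \<rho> = "\<lambda>_. real p" and \<delta> = "\<lambda>x. \<bar>\<delta> x\<bar>"])
    have s: "(\<lambda>d. if d = 0 then 1 / real p else 0) sums (1 / real p)"
      using sums_single[of 0 "\<lambda>_. 1 / real p"] by simp
    show "summable (\<lambda>d. if d = 0 then 1 / real p else 0)" using s by (rule sums_summable)
    show "(\<Sum>d. if d = 0 then 1 / real p else 0) < 1" using sums_unique[OF s, symmetric] p(3) by simp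
    show "((\<lambda>x. \<bar>\<delta> x\<bar>) \<longlongrightarrow> 0) at_top"
      using tendsto_rabs[OF tendsto_diff[OF IH tendsto_const[of c]]] by (simp add: \<delta>_def)
    show "real p > 0" using p(3) by simp
    fix x :: real assume x: "x \<ge> 1"
    have "\<delta> x = e x + e (x / real p) / real p"
    proof -
      have "e (x / real p) / real p = real (squarefree_count (insert p S) (x / real p)) / x - c' / real p"
        using x p(3) by (simp add: e_def diff_divide_distrib)
      moreover have "squarefree_count S x =
          squarefree_count (insert p S) x + squarefree_count (insert p S) (x / real p)"
        using x insert.prems by (intro squarefree_count_insert p(1,2)) auto
      ultimately show ?thesis by (simp add: \<delta>_def e_def add_divide_distrib cc'[symmetric])
    qed
    hence "\<bar>e x\<bar> \<le> \<bar>\<delta> x\<bar> + \<bar>e (x / real p) / real p\<bar>" by linarith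
    also have "\<bar>e (x / real p) / real p\<bar> = (\<Sum>d. (if d = 0 then 1 / real p else 0) * \<bar>e (x / real p)\<bar>)"
      using sums_unique[OF sums_mult2[OF s, of "\<bar>e (x / real p)\<bar>"]] p(3) by (simp add: abs_divide)
    finally show "\<bar>e x\<bar> \<le> \<bar>\<delta> x\<bar> + (\<Sum>d. (if d = 0 then 1 / real p else 0) * \<bar>e (x / real p)\<bar>)" .
  qed auto
  hence "((\<lambda>x. e x + c') \<longlongrightarrow> 0 + c') at_top" by (intro tendsto_intros)
  thus ?case using insert by (simp add: e_def c'_def c_def mult_ac)
qed

text \<open>No exponent of \<open>f\<close> equals 1, so an odd exponent is at least 3. Hence the
  squarefree part, made of the primes with odd exponent, divides the square part.\<close>

lemma squarefull_eq_cube_times_square: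
  assumes "squarefull f"
  shows "f = squarefree_part f ^ 3 * (square_part f div squarefree_part f) ^ 2"
    "squarefree_part f > 0" "square_part f div squarefree_part f > 0"
proof -
  have f0: "f > 0" using assms by (simp add: squarefull_def)
  have "squarefree_part f dvd square_part f"
  proof (rule multiplicity_le_imp_dvd)
    fix p :: nat assume p: "prime p"
    have "multiplicity p f \<noteq> 1"
    proof
      assume m: "multiplicity p f = 1"
      hence "p dvd f" by (metis not_dvd_imp_multiplicity_0 zero_neq_one)
      hence "p\<^sup>2 dvd f" using assms p by (auto simp: squarefull_def)
      hence "2 \<le> multiplicity p f" using p f0 by (intro multiplicity_geI) auto
      thus False using m by simp
    qed
    thus "multiplicity p (squarefree_part f) \<le> multiplicity p (square_part f)"
      using p by (simp add: prime_multiplicity_squarefree_part prime_multiplicity_square_part)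
  qed (use f0 in auto)
  then obtain u where u: "square_part f = squarefree_part f * u" by (rule dvdE)
  show s: "squarefree_part f > 0" using squarefree_part_nonzero[of f] by (intro Nat.gr0I) auto
  have "square_part f > 0" using f0 by (auto intro!: Nat.gr0I)
  hence "u > 0" using u by (auto intro!: Nat.gr0I)
  have div: "square_part f div squarefree_part f = u" using u s by simp
  show "square_part f div squarefree_part f > 0" using div \<open>u > 0\<close> by simp
  have "f = squarefree_part f * square_part f ^ 2" by (rule squarefree_decompose)
  also have "\<dots> = squarefree_part f ^ 3 * u ^ 2"
    unfolding u by (simp add: power2_eq_square power3_eq_cube mult_ac)
  finally show "f = squarefree_part f ^ 3 * (square_part f div squarefree_part f) ^ 2" unfolding div .
qed

text \<open>Writing \<open>f = s ^ 3 * u ^ 2\<close> injectively, \<open>1 / f\<close> is at most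
  \<open>1 / (s ^ 2 * u ^ 2)\<close>. The bound 9 is the product of two sums of inverse squares,
  each at most 3.\<close>

lemma summable_inverse_squarefull: "summable (\<lambda>f. if squarefull f then 1 / real f else 0)"
proof (rule summableI_nonneg_bounded[of _ 9])
  fix n
  define F where "F = {f. f < n \<and> squarefull f}"
  define g where "g = (\<lambda>f::nat. (squarefree_part f, square_part f div squarefree_part f))"
  have fin: "finite F" by (simp add: F_def)
  have sf: "squarefull f" if "f \<in> F" for f using that by (simp add: F_def)
  have inj: "inj_on g F"
  proof (rule inj_onI)
    fix f f' assume "f \<in> F" "f' \<in> F" "g f = g f'"
    thus "f = f'" using squarefull_eq_cube_times_square(1)[OF sf[of f]]
      squarefull_eq_cube_times_square(1)[OF sf[of f']] by (metis g_def prod.inject)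
  qed
  have "(\<Sum>f<n. if squarefull f then 1 / real f else 0) = (\<Sum>f\<in>F. 1 / real f)"
    unfolding F_def by (subst sum.inter_filter[symmetric]) (auto simp: lessThan_def)
  also have "\<dots> \<le> (\<Sum>f\<in>F. case g f of (s, u) \<Rightarrow> 1 / real s ^ 2 * (1 / real u ^ 2))"
  proof (intro sum_mono)
    fix f assume f: "f \<in> F"
    define s where "s = squarefree_part f"
    define u where "u = square_part f div squarefree_part f"
    have *: "f = s ^ 3 * u ^ 2" "s > 0" "u > 0"
      using squarefull_eq_cube_times_square[OF sf[OF f]] unfolding s_def u_def by blast+
    have "s ^ 2 * u ^ 2 \<le> s ^ 3 * u ^ 2" using *(2) by (intro mult_right_mono power_increasing) auto
    hence "s ^ 2 * u ^ 2 \<le> f" using *(1) by simp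
    hence "real s ^ 2 * real u ^ 2 \<le> real f" by (metis of_nat_le_iff of_nat_mult of_nat_power)
    moreover have "real s ^ 2 * real u ^ 2 > 0" using *(2,3) by simp
    ultimately have "1 / real f \<le> 1 / (real s ^ 2 * real u ^ 2)" by (intro divide_left_mono) auto
    thus "1 / real f \<le> (case g f of (s, u) \<Rightarrow> 1 / real s ^ 2 * (1 / real u ^ 2))"
      by (simp add: g_def s_def u_def)
  qed
  also have "\<dots> = (\<Sum>(s, u)\<in>g ` F. 1 / real s ^ 2 * (1 / real u ^ 2))"
    by (simp add: sum.reindex[OF inj])
  also have "\<dots> \<le> (\<Sum>(s, u)\<in>fst ` g ` F \<times> snd ` g ` F. 1 / real s ^ 2 * (1 / real u ^ 2))"
    using fin by (intro sum_mono2 subset_fst_snd) auto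
  also have "\<dots> = (\<Sum>s\<in>fst ` g ` F. 1 / real s ^ 2) * (\<Sum>u\<in>snd ` g ` F. 1 / real u ^ 2)"
    by (simp only: sum.cartesian_product[symmetric] sum_product)
  also have "\<dots> \<le> 3 * 3"
    using fin by (intro mult_mono sum_inverse_squares_le sum_nonneg) auto
  finally show "(\<Sum>f<n. if squarefull f then 1 / real f else 0) \<le> 9" by simp
qed auto

section \<open>Level sets sorted by squarefull part\<close>

lemma squarefull_part_props:
  assumes "n > 0"
  shows "squarefull (squarefull_part n)"
    "\<exists>q. squarefree q \<and> coprime q (squarefull_part n) \<and> n = q * squarefull_part n"
  using theI'[OF squarefull_part_unique[OF assms]] unfolding squarefull_part_def by blast+

lemma squarefull_part_mult:
  assumes "squarefull f" "squarefree q" "coprime q f"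
  shows "squarefull_part (q * f) = f"
proof -
  have "q * f > 0" using assms by (auto simp: squarefull_def intro!: Nat.gr0I)
  thus ?thesis unfolding squarefull_part_def
    by (intro the1_equality[OF squarefull_part_unique]) (use assms in auto)
qed

lemma coprime_iff_no_prime_factor:
  fixes q f :: nat
  assumes "f > 0"
  shows "coprime q f \<longleftrightarrow> (\<forall>p\<in>prime_factors f. \<not> p dvd q)"
proof
  assume "coprime q f"
  thus "\<forall>p\<in>prime_factors f. \<not> p dvd q"
    by (auto simp: in_prime_factors_iff dest: coprime_common_divisor)
next
  assume *: "\<forall>p\<in>prime_factors f. \<not> p dvd q"
  show "coprime q f"
  proof (rule ccontr)
    assume "\<not> coprime q f"
    hence "gcd q f \<noteq> 1" by (simp add: coprime_iff_gcd_eq_1)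
    then obtain p where "prime p" "p dvd gcd q f" using prime_factor_nat by blast
    hence "prime p" "p dvd q" "p dvd f" by auto
    thus False using * assms by (auto simp: in_prime_factors_iff)
  qed
qed

lemma card_level_set:
  assumes a: "\<forall>n\<ge>1. a n = a (squarefull_part n)"
  shows "card {n. 1 \<le> n \<and> n \<le> N \<and> a n = k} =
    (\<Sum>f | f \<le> N \<and> squarefull f \<and> a f = k. squarefree_count (prime_factors f) (real N / real f))"
proof -
  define F where "F = {f. f \<le> N \<and> squarefull f \<and> a f = k}"
  have fin: "finite F" by (rule finite_subset[of _ "{..N}"]) (auto simp: F_def)
  have fib: "card {n \<in> {1..N}. squarefull_part n = f} = squarefree_count (prime_factors f) (real N / real f)"
    if f: "f \<in> F" for f
  proof -
    have f0: "squarefull f" "f > 0" using f by (auto simp: F_def squarefull_def)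
    have "{n \<in> {1..N}. squarefull_part n = f} =
      (\<lambda>q. q * f) ` {q \<in> {1..N div f}. squarefree q \<and> (\<forall>p\<in>prime_factors f. \<not> p dvd q)}"
    proof (intro set_eqI iffI)
      fix n assume n: "n \<in> {n \<in> {1..N}. squarefull_part n = f}"
      then obtain q where q: "squarefree q" "coprime q f" "n = q * f"
        using squarefull_part_props(2)[of n] by auto
      have "q \<in> {1..N div f}"
        using n q(3) f0 by (auto simp: less_eq_div_iff_mult_less_eq Suc_le_eq intro!: Nat.gr0I)
      thus "n \<in> (\<lambda>q. q * f) ` {q \<in> {1..N div f}. squarefree q \<and> (\<forall>p\<in>prime_factors f. \<not> p dvd q)}"
        using q coprime_iff_no_prime_factor[OF f0(2), of q] by blast
    next
      fix n assume "n \<in> (\<lambda>q. q * f) ` {q \<in> {1..N div f}. squarefree q \<and> (\<forall>p\<in>prime_factors f. \<not> p dvd q)}"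
      then obtain q where q: "q \<in> {1..N div f}" "squarefree q" "coprime q f" "n = q * f"
        using coprime_iff_no_prime_factor[OF f0(2)] by auto
      thus "n \<in> {n \<in> {1..N}. squarefull_part n = f}"
        using squarefull_part_mult[OF f0(1) q(2,3)] f0(2)
        by (auto simp: less_eq_div_iff_mult_less_eq Suc_le_eq)
    qed
    hence "card {n \<in> {1..N}. squarefull_part n = f} =
      card {q \<in> {1..N div f}. squarefree q \<and> (\<forall>p\<in>prime_factors f. \<not> p dvd q)}"
      using f0(2) by (simp add: card_image inj_on_def)
    thus ?thesis by (simp add: squarefree_count_def nat_floor_divide)
  qed
  have "{n. 1 \<le> n \<and> n \<le> N \<and> a n = k} = (\<Union>f\<in>F. {n \<in> {1..N}. squarefull_part n = f})"
  proof (intro set_eqI iffI)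
    fix n assume n: "n \<in> {n. 1 \<le> n \<and> n \<le> N \<and> a n = k}"
    hence "squarefull (squarefull_part n)" using squarefull_part_props(1)[of n] by simp
    moreover have "squarefull_part n dvd n"
      using squarefull_part_props(2)[of n] n by (metis dvd_triv_right mem_Collect_eq less_le_trans zero_less_one)
    hence "squarefull_part n \<le> N" using n by (auto dest!: dvd_imp_le)
    moreover have "a (squarefull_part n) = k" using n a by auto
    ultimately show "n \<in> (\<Union>f\<in>F. {n \<in> {1..N}. squarefull_part n = f})" using n by (auto simp: F_def)
  next
    fix n assume "n \<in> (\<Union>f\<in>F. {n \<in> {1..N}. squarefull_part n = f})"
    thus "n \<in> {n. 1 \<le> n \<and> n \<le> N \<and> a n = k}" using a by (auto simp: F_def)
  qed
  also have "card \<dots> = (\<Sum>f\<in>F. card {n \<in> {1..N}. squarefull_part n = f})"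
    by (intro card_UN_disjoint fin) auto
  also have "\<dots> = (\<Sum>f\<in>F. squarefree_count (prime_factors f) (real N / real f))"
    by (intro sum.cong refl fib)
  finally show ?thesis by (simp add: F_def)
qed

text \<open>For fixed \<open>f\<close>, the numbers with squarefull part \<open>f\<close> have a
  density by \<open>squarefree_coprime_density\<close>. Limit and infinite sum are exchanged by
  Tannery's theorem: the share of \<open>f\<close> is at most \<open>1 / f\<close> for every
  \<open>N\<close>, and this is summable over the squarefull numbers.\<close>

lemma level_frequency_tendsto:
  fixes a :: "nat \<Rightarrow> nat" and k :: nat
  defines "c \<equiv> (\<lambda>f. 1 / real f * (\<Prod>p\<in>prime_factors f. inverse (1 + 1 / real p)))"
  assumes a: "\<forall>n\<ge>1. a n = a (squarefull_part n)"
  shows "c summable_on {f. squarefull f \<and> a f = k}"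
    "level_frequency a k \<longlonglongrightarrow> 6 / pi\<^sup>2 * (\<Sum>\<^sub>\<infinity>f\<in>{f. squarefull f \<and> a f = k}. c f)"
proof -
  define A where "A = {f. squarefull f \<and> a f = k}"
  define M where "M = (\<lambda>f. if squarefull f then 1 / real f else 0)"
  define t where "t = (\<lambda>f N. if f \<in> A then real (squarefree_count (prime_factors f) (real N / real f)) / real N else 0)"
  define b where "b = (\<lambda>f. if f \<in> A then 6 / pi\<^sup>2 * c f else 0)"
  have Apos: "f > 0" if "f \<in> A" for f using that by (auto simp: A_def squarefull_def)
  have lim: "t f \<longlonglongrightarrow> b f" for f
  proof (cases "f \<in> A")
    case True
    define P where "P = (\<Prod>p\<in>prime_factors f. inverse (1 + 1 / real p))"
    have f0: "real f > 0" using Apos[OF True] by simp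
    have "filterlim (\<lambda>N. real N / real f) at_top sequentially"
      using filterlim_tendsto_pos_mult_at_top[OF tendsto_const[of "1 / real f"] _ filterlim_real_sequentially] f0
      by simp
    from filterlim_compose[OF squarefree_coprime_density[of "prime_factors f"] this]
    have "(\<lambda>N. real (squarefree_count (prime_factors f) (real N / real f)) / (real N / real f)) \<longlonglongrightarrow> 6 / pi\<^sup>2 * P"
      by (simp add: P_def in_prime_factors_imp_prime)
    from tendsto_mult[OF this tendsto_const[of "1 / real f"]]
    have "(\<lambda>N. real (squarefree_count (prime_factors f) (real N / real f)) / (real N / real f) * (1 / real f))
      \<longlonglongrightarrow> 6 / pi\<^sup>2 * P * (1 / real f)" .
    moreover have "6 / pi\<^sup>2 * P * (1 / real f) = b f" using True by (simp add: b_def c_def P_def)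
    moreover have "real (squarefree_count (prime_factors f) (real N / real f)) / (real N / real f) * (1 / real f) = t f N" for N
      using True f0 by (simp add: t_def)
    ultimately show ?thesis by simp
  qed (simp add: t_def b_def)
  have bound: "norm (t f N) \<le> M f" for f N
  proof (cases "f \<in> A \<and> N > 0")
    case True
    hence f0: "f > 0" "squarefull f" using Apos by (auto simp: A_def)
    have "real (squarefree_count (prime_factors f) (real N / real f)) \<le> real N / real f"
      using True f0 by (intro squarefree_count_le) simp
    thus ?thesis using True f0 by (simp add: t_def M_def field_simps)
  qed (auto simp: t_def M_def)
  have "(summable (\<lambda>f. norm (b f))) \<and> ((\<lambda>N. \<Sum>f. t f N) \<longlonglongrightarrow> suminf b)"
    using tannerys_theorem[OF lim _ summable_inverse_squarefull[folded M_def] sequentially_bot] bound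
    by (simp add: case_prod_unfold)
  hence b: "summable (\<lambda>f. norm (b f))" and tl: "(\<lambda>N. \<Sum>f. t f N) \<longlonglongrightarrow> suminf b" by blast+
  have "(\<Sum>f. t f N) = level_frequency a k N" for N
  proof -
    have "t f N = 0" if "f \<notin> {..N}" for f
    proof -
      have "real N / real f < 1" using that by (simp add: divide_less_eq_1)
      thus ?thesis by (simp add: t_def squarefree_count_small)
    qed
    hence "(\<Sum>f. t f N) = (\<Sum>f\<le>N. t f N)" by (intro suminf_finite) auto
    also have "\<dots> = (\<Sum>f | f \<le> N \<and> f \<in> A. real (squarefree_count (prime_factors f) (real N / real f)) / real N)"
      unfolding t_def by (simp add: sum.inter_filter[symmetric] atMost_def)
    also have "\<dots> = level_frequency a k N"
      unfolding level_frequency_def card_level_set[OF a] A_def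
      by (simp add: sum_divide_distrib)
    finally show ?thesis .
  qed
  hence "(\<lambda>N. \<Sum>f. t f N) = level_frequency a k" by (rule ext)
  hence lf: "level_frequency a k \<longlonglongrightarrow> suminf b" using tl by simp
  have "(b has_sum suminf b) UNIV"
    by (rule norm_summable_imp_has_sum[OF b summable_sums[OF summable_norm_cancel[OF b]]])
  hence "((\<lambda>f. 6 / pi\<^sup>2 * c f) has_sum suminf b) A"
    using has_sum_cong_neutral[of A UNIV "\<lambda>f. 6 / pi\<^sup>2 * c f" b "suminf b"] by (auto simp: b_def)
  from has_sum_cmult_right[OF this, of "pi\<^sup>2 / 6"]
  have hs: "(c has_sum (pi\<^sup>2 / 6 * suminf b)) A" by simp
  thus "c summable_on {f. squarefull f \<and> a f = k}" unfolding A_def summable_on_def by blast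
  have "infsum c A = pi\<^sup>2 / 6 * suminf b" using hs by (rule infsumI)
  hence "6 / pi\<^sup>2 * infsum c A = suminf b" by (simp only:) simp
  thus "level_frequency a k \<longlonglongrightarrow> 6 / pi\<^sup>2 * (\<Sum>\<^sub>\<infinity>f\<in>{f. squarefull f \<and> a f = k}. c f)"
    using lf unfolding A_def[symmetric] by (simp only:)
qed

section \<open>Averages along the number of prime factors\<close>

lemma squarefull_part_prime_mult:
  assumes "prime p" "n > 0" "\<not> p dvd n"
  shows "squarefull_part (p * n) = squarefull_part n"
proof -
  obtain q where q: "squarefree q" "coprime q (squarefull_part n)" "n = q * squarefull_part n"
    using squarefull_part_props(2)[OF assms(2)] by blast
  have "\<not> p dvd q" "\<not> p dvd squarefull_part n"
    using assms(3) q(3) by (metis dvd_mult2, metis dvd_mult)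
  hence "squarefree (p * q)" "coprime (p * q) (squarefull_part n)"
    using assms(1) q by (auto simp: squarefree_prime_mult_iff intro: prime_imp_coprime)
  from squarefull_part_mult[OF squarefull_part_props(1)[OF assms(2)] this]
  have "squarefull_part (p * (q * squarefull_part n)) = squarefull_part n" by (simp only: mult.assoc)
  thus ?thesis using q(3) by simp
qed

lemma big_omega_prime_mult:
  assumes "prime p" "n > 0"
  shows "big_omega (p * n) = Suc (big_omega n)"
  using assms by (simp add: big_omega_def prime_factorization_mult prime_factorization_prime)

lemma mean_upto_iterated_shift:
  assumes "\<And>j. prime_shift (b j) (b (Suc j))"
  shows "((\<lambda>x. mean_upto (b 0) x - mean_upto (b j) x) \<longlongrightarrow> 0) at_top"
proof (induction j)
  case (Suc j)
  have "((\<lambda>x. mean_upto (b j) x - mean_upto (b (Suc j)) x) \<longlongrightarrow> 0) at_top"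
    by (rule mean_upto_shift_invariant[OF assms assms])
  from tendsto_add[OF Suc this] show ?case by simp
qed simp

text \<open>\<open>A 0 N\<close> is asymptotically the mean of \<open>A j N\<close> over
  \<open>j < m\<close>, for each fixed \<open>m\<close>. That mean is an average, over the level
  set, of ergodic averages of length \<open>m\<close> started at \<open>orb n\<close>. Since the
  starting points vary with \<open>n\<close>, uniformity over \<open>X\<close> is essential.\<close>

lemma weighted_average_tendsto:
  fixes a :: "nat \<Rightarrow> nat" and h :: "'x::metric_space \<Rightarrow> complex"
  assumes a: "\<forall>n\<ge>1. a n = a (squarefull_part n)" and ue: "uniquely_ergodic X \<nu> T"
    and h: "continuous_on X h" and x: "x \<in> X"
  shows "(\<lambda>N. (\<Sum>n | 1 \<le> n \<and> n \<le> N \<and> a n = k. h ((T ^^ big_omega n) x)) / of_nat N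
    - of_real (level_frequency a k N) * integral\<^sup>L \<nu> h) \<longlonglongrightarrow> 0"
proof -
  have X: "compact X" "T ` X \<subseteq> X" using ue by (auto simp: uniquely_ergodic_def)
  obtain B where B: "\<And>x. x \<in> X \<Longrightarrow> norm (h x) \<le> B"
    using compact_imp_bounded[OF compact_continuous_image[OF h X(1)]] bounded_iff by (metis image_eqI)
  \<comment> \<open>Dividing by \<open>C\<close> brings the values into the unit disc, as
    \<open>prime_shift\<close> demands; the 1 keeps \<open>C\<close> positive.\<close>
  define C where "C = max B 1"
  have C: "C > 0" "norm (h y) \<le> C" if "y \<in> X" for y using B[OF that] by (auto simp: C_def)
  define orb where "orb = (\<lambda>n. (T ^^ big_omega n) x)"
  have orb: "orb n \<in> X" for n unfolding orb_def using X(2) x by (rule funpow_mem)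
  have iter: "(T ^^ j) (orb n) \<in> X" for j n using X(2) orb by (rule funpow_mem)
  have C0: "C > 0" using C(1)[OF x] .
  define b where "b = (\<lambda>j n. if n > 0 \<and> a n = k then h ((T ^^ j) (orb n)) / of_real C else 0)"
  have shift: "prime_shift (b j) (b (Suc j))" for j
  proof
    show norm_b: "norm (b j n) \<le> 1" for j n
      using C(2)[OF iter[of j n]] C0 by (simp add: b_def norm_divide)
    show "norm (b (Suc j) n) \<le> 1" for n by (rule norm_b)
    fix p n :: nat assume p: "prime p" "n > 0" "\<not> p dvd n"
    have pn: "p * n > 0" using p by (simp add: prime_gt_0_nat)
    have "a (p * n) = a n" using a p pn squarefull_part_prime_mult[OF p] by (metis One_nat_def Suc_leI)
    moreover have "orb (p * n) = T (orb n)" by (simp add: orb_def big_omega_prime_mult[OF p(1,2)])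
    ultimately show "b j (p * n) = b (Suc j) n"
      using p pn by (simp add: b_def funpow_swap1)
  qed
  define G where "G = (\<lambda>N. {n. 1 \<le> n \<and> n \<le> N \<and> a n = k})"
  have finG: "finite (G N)" for N by (rule finite_subset[of _ "{1..N}"]) (auto simp: G_def)
  have mean_b: "mean_upto (b j) (real N) = (\<Sum>n\<in>G N. h ((T ^^ j) (orb n))) / of_nat N / of_real C" for j N
  proof -
    have "(\<Sum>n=1..N. b j n) = (\<Sum>n\<in>G N. h ((T ^^ j) (orb n)) / of_real C)"
      by (intro sum.mono_neutral_cong_right) (auto simp: b_def G_def)
    thus ?thesis by (simp add: mean_upto_def sum_divide_distrib[symmetric] divide_divide_eq_left mult.commute)
  qed
  define A where "A = (\<lambda>j N. (\<Sum>n\<in>G N. h ((T ^^ j) (orb n))) / of_nat N)"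
  have mean_bA: "mean_upto (b j) (real N) = A j N / of_real C" for j N by (simp add: mean_b A_def)
  have diff: "(\<lambda>N. A 0 N - A j N) \<longlonglongrightarrow> 0" for j
  proof -
    have "(\<lambda>N. mean_upto (b 0) (real N) - mean_upto (b j) (real N)) \<longlonglongrightarrow> 0"
      by (rule filterlim_compose[OF mean_upto_iterated_shift[of b, OF shift] filterlim_real_sequentially])
    from tendsto_mult[OF tendsto_const[of "of_real C"] this]
    show ?thesis using C0 by (simp add: mean_bA right_diff_distrib)
  qed
  have "(\<lambda>N. A 0 N - of_real (level_frequency a k N) * integral\<^sup>L \<nu> h) \<longlonglongrightarrow> 0"
  proof (rule tendstoI)
    fix \<epsilon> :: real assume eps: "\<epsilon> > 0"
    obtain m where m: "m > 0"
      "\<forall>y\<in>X. norm ((\<Sum>j<m. h ((T ^^ j) y)) / of_nat m - integral\<^sup>L \<nu> h) \<le> \<epsilon> / 2"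
      using uniquely_ergodic_uniform_averages[OF ue h, of "\<epsilon> / 2"] eps by auto
    have "(\<lambda>N. (\<Sum>j<m. A 0 N - A j N) / of_nat m) \<longlonglongrightarrow> (\<Sum>j<m. 0) / of_nat m"
      using m(1) by (intro tendsto_intros diff) auto
    hence "(\<lambda>N. (\<Sum>j<m. A 0 N - A j N) / of_nat m) \<longlonglongrightarrow> 0" by simp
    from tendstoD[OF this, of "\<epsilon> / 2"]
    have "eventually (\<lambda>N. norm ((\<Sum>j<m. A 0 N - A j N) / of_nat m) < \<epsilon> / 2) sequentially"
      using eps by simp
    thus "eventually (\<lambda>N. dist (A 0 N - of_real (level_frequency a k N) * integral\<^sup>L \<nu> h) 0 < \<epsilon>) sequentially"
      using eventually_gt_at_top[of 0]
    proof eventually_elim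
      case (elim N)
      define I where "I = integral\<^sup>L \<nu> h"
      have 1: "A 0 N = (\<Sum>j<m. A 0 N - A j N) / of_nat m + (\<Sum>j<m. A j N) / of_nat m"
        using m(1) by (simp add: sum_subtractf diff_divide_distrib)
      have "(\<Sum>j<m. A j N) / of_nat m - of_real (level_frequency a k N) * I =
          (\<Sum>n\<in>G N. (\<Sum>j<m. h ((T ^^ j) (orb n))) / of_nat m - I) / of_nat N"
      proof -
        have "(\<Sum>j<m. A j N) = (\<Sum>n\<in>G N. \<Sum>j<m. h ((T ^^ j) (orb n))) / of_nat N"
          unfolding A_def sum_divide_distrib[symmetric] by (subst sum.swap) simp
        hence "(\<Sum>j<m. A j N) / of_nat m = (\<Sum>n\<in>G N. (\<Sum>j<m. h ((T ^^ j) (orb n))) / of_nat m) / of_nat N"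
          by (simp add: sum_divide_distrib[symmetric] mult.commute)
        moreover have "of_real (level_frequency a k N) * I = (\<Sum>n\<in>G N. I) / of_nat N"
          by (simp add: level_frequency_def G_def)
        ultimately show ?thesis by (simp add: sum_subtractf diff_divide_distrib)
      qed
      also have "norm \<dots> \<le> \<epsilon> / 2"
      proof -
        have "norm (\<Sum>n\<in>G N. (\<Sum>j<m. h ((T ^^ j) (orb n))) / of_nat m - I) \<le> of_nat (card (G N)) * (\<epsilon> / 2)"
          using m(2) orb by (intro sum_norm_bound) (auto simp: I_def)
        also have "card (G N) \<le> card {1..N}" by (intro card_mono) (auto simp: G_def)
        hence "of_nat (card (G N)) * (\<epsilon> / 2) \<le> real N * (\<epsilon> / 2)" using eps by (intro mult_right_mono) auto
        finally show ?thesis using elim(2) by (simp add: norm_divide divide_le_eq mult.commute)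
      qed
      finally have 2: "norm ((\<Sum>j<m. A j N) / of_nat m - of_real (level_frequency a k N) * I) \<le> \<epsilon> / 2" .
      have "A 0 N - of_real (level_frequency a k N) * I = (\<Sum>j<m. A 0 N - A j N) / of_nat m +
          ((\<Sum>j<m. A j N) / of_nat m - of_real (level_frequency a k N) * I)"
        by (subst 1) simp
      hence "norm (A 0 N - of_real (level_frequency a k N) * I) \<le> norm ((\<Sum>j<m. A 0 N - A j N) / of_nat m) +
          norm ((\<Sum>j<m. A j N) / of_nat m - of_real (level_frequency a k N) * I)"
        by (simp only: norm_triangle_ineq)
      thus ?case using elim(1) 2 by (simp add: I_def)
    qed
  qed
  thus ?thesis by (simp add: A_def G_def orb_def)
qed

text \<open>\<open>lim\<close> and the infinite sum are total functions with arbitrary or default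
  values in the divergent case. Convergence and summability are therefore asserted along with the
  two formulas.\<close>

theorem corollary1p2:
  fixes a :: "nat \<Rightarrow> nat" and k :: nat
    and X :: "'x::metric_space set" and \<nu> :: "'x measure" and T :: "'x \<Rightarrow> 'x"
    and h :: "'x \<Rightarrow> complex" and x :: 'x
  assumes "s_function a"
    and "uniquely_ergodic X \<nu> T"
    and "continuous_on X h"
    and "x \<in> X"
  shows "(\<lambda>N. (\<Sum>n | 1 \<le> n \<and> n \<le> N \<and> a n = k. h ((T ^^ big_omega n) x)) / of_nat N)
           \<longlonglongrightarrow> complex_of_real (local_density a k) * (LINT y|\<nu>. h y)
       \<and> convergent (level_frequency a k)
       \<and> (\<lambda>f. 1 / real f * (\<Prod>p\<in>prime_factors f. inverse (1 + 1 / real p)))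
           summable_on {f. squarefull f \<and> a f = k}
       \<and> local_density a k =
           6 / pi\<^sup>2 * (\<Sum>\<^sub>\<infinity>f\<in>{f. squarefull f \<and> a f = k}.
             1 / real f * (\<Prod>p\<in>prime_factors f. inverse (1 + 1 / real p)))"
proof -
  have a: "\<forall>n\<ge>1. a n = a (squarefull_part n)" using assms(1) by (simp add: s_function_def)
  note density = level_frequency_tendsto[OF a, of k]
  have ld: "local_density a k = 6 / pi\<^sup>2 * (\<Sum>\<^sub>\<infinity>f\<in>{f. squarefull f \<and> a f = k}.
             1 / real f * (\<Prod>p\<in>prime_factors f. inverse (1 + 1 / real p)))"
    unfolding local_density_def by (rule limI[OF density(2)])
  hence lf: "level_frequency a k \<longlonglongrightarrow> local_density a k" using density(2) by simp
  have "(\<lambda>N. of_real (level_frequency a k N) * integral\<^sup>L \<nu> h) \<longlonglongrightarrow>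
      complex_of_real (local_density a k) * integral\<^sup>L \<nu> h"
    by (intro tendsto_intros lf)
  from tendsto_add[OF weighted_average_tendsto[OF a assms(2-4), of k] this]
  have "(\<lambda>N. (\<Sum>n | 1 \<le> n \<and> n \<le> N \<and> a n = k. h ((T ^^ big_omega n) x)) / of_nat N)
           \<longlonglongrightarrow> complex_of_real (local_density a k) * (LINT y|\<nu>. h y)" by simp
  thus ?thesis using ld lf density(1) by (auto simp: convergent_def)
qed

end
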